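(* Let $k\in\mathbb{N}$, $\tau\ge2$ and let $F(z)=\sum_{n\ge0}a_n\zeta_nz^n$ be a Gaussian analytic function. Then, for $z_1,\dots,z_k\in B_\tau(0)$, $$\rho_{k,F}(z_1,\dots,z_k)\le\left(\frac{\sup_{n\ge0}a_n(2\tau)^n}{\min_{0\le n<2k}a_n}\right)^{4k}\prod_{1\le i<j\le k}|z_i-z_j|^2.$$ In particular, if $F=F_L$ is the Gaussian entire function of intensity $L/\pi$, $L>0$, i.e. $a_n=L^{n/2}/\sqrt{n!}$, then $$\rho_{k,F}(z_1,\dots,z_k)\le(2k)^{4k^2}e^{8\tau^2Lk}\max\{1,L^{-4k^2}\}\prod_{1\le i<j\le k}|z_i-z_j|^2.$$
   Context: Gaussian analytic functions (GAFs) here are random power series $F(z)=\sum_{n\ge0}a_n\zeta_nz^n$ with $\zeta_n$ i.i.d. standard complex normal variables, $a_n\ge0$ and $\limsup_n a_n^{1/n}<\infty$. $B_\tau(0)$ is the disc of radius $\tau$ centred at $0$. The first bound is understood to be vacuous (right-hand side $+\infty$) if $\min_{0\le n<2k}a_n=0$ or $\sup_n a_n(2\tau)^n=\infty$. The $k$-point intensity function $\rho_{k,F}$ of the zero set $\mathcal{Z}_F$ of $F$ is determined by $$\mathbb{E}\Big[\sum^{\neq}_{z_1,\dots,z_k\in\mathcal{Z}_F}h(z_1,\dots,z_k)\Big]=\int h(w_1,\dots,w_k)\,\rho_{k,F}(w_1,\dots,w_k)\,dA(w_1)\cdots dA(w_k)$$ for all nonnegative measurable $h$, where the sum runs over ordered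 $k$-tuples of distinct points of $\mathcal{Z}_F$ and $dA$ is Lebesgue measure on $\mathbb{C}$. At pairwise distinct points at which the covariance matrix of $(F(z_1),\dots,F(z_k),F'(z_1),\dots,F'(z_k))$ is invertible, it is given by $\rho_{k,F}(z_1,\dots,z_k)=\int_{\mathbb{C}^k}|\eta_1\cdots\eta_k|^2\,\mathrm{p}(0,\dots,0,\eta_1,\dots,\eta_k)\,dA(\eta_1)\cdots dA(\eta_k)$, where $\mathrm{p}$ is the probability density on $\mathbb{C}^{2k}$ of this Gaussian vector; it is taken to be $0$ when two of the points coincide. *)

theory Defs
  imports "HOL-Probability.Probability" "HOL-Complex_Analysis.Complex_Analysis"
begin

definition std_complex_normal_density :: "complex \<Rightarrow> real" where
  "std_complex_normal_density z = exp (- (cmod z)\<^sup>2) / pi"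

locale gaussian_coefficients = prob_space M for M :: "'w measure" +
  fixes a :: "nat \<Rightarrow> real" and \<zeta> :: "nat \<Rightarrow> 'w \<Rightarrow> complex"
  assumes indep: "indep_vars (\<lambda>_. borel) \<zeta> UNIV"
    and normal: "\<And>n. distributed M lborel (\<zeta> n) (\<lambda>z. ennreal (std_complex_normal_density z))"
    and coeff_nonneg: "\<And>n. 0 \<le> a n"
    and limsup_finite: "limsup (\<lambda>n. ereal (root n (a n))) < \<infinity>"

text \<open>Almost surely the random power series has the same radius of convergence as the
  deterministic series with coefficients \<open>a n\<close>. On the exceptional null event we put \<open>F = 0\<close>, so
  that every sample function is holomorphic on the disc and the values and derivatives
  of \<open>F\<close> are measurable without any completeness assumption on the probability space.\<close>

definition gaf :: "(nat \<Rightarrow> real) \<Rightarrow> (nat \<Rightarrow> 'w \<Rightarrow> complex) \<Rightarrow> 'w \<Rightarrow> complex \<Rightarrow> complex" where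
  "gaf a \<zeta> \<omega> z =
     (if conv_radius a \<le> conv_radius (\<lambda>n. of_real (a n) * \<zeta> n \<omega>)
      then \<Sum>n. of_real (a n) * \<zeta> n \<omega> * z ^ n else 0)"

definition gaf_domain :: "(nat \<Rightarrow> real) \<Rightarrow> complex set" where
  "gaf_domain a = eball 0 (conv_radius a)"

definition gaf_zeros :: "(nat \<Rightarrow> real) \<Rightarrow> (nat \<Rightarrow> 'w \<Rightarrow> complex) \<Rightarrow> 'w \<Rightarrow> complex set" where
  "gaf_zeros a \<zeta> \<omega> = {z \<in> gaf_domain a. gaf a \<zeta> \<omega> z = 0}"

text \<open>Points of \<open>\<complex>\<^sup>k\<close> are of type \<open>complex^'k\<close> with \<open>k = CARD('k)\<close>. In \<open>complex^('k + 'k)\<close>, the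
  left summand indexes the values and the right summand the derivatives.\<close>

definition gaf_vector ::
  "(nat \<Rightarrow> real) \<Rightarrow> (nat \<Rightarrow> 'w \<Rightarrow> complex) \<Rightarrow> complex^'k \<Rightarrow> 'w \<Rightarrow> complex^('k::finite + 'k)" where
  "gaf_vector a \<zeta> z \<omega> =
     (\<chi> i. case i of Inl j \<Rightarrow> gaf a \<zeta> \<omega> (z $ j) | Inr j \<Rightarrow> deriv (gaf a \<zeta> \<omega>) (z $ j))"

definition covariance_matrix :: "'w measure \<Rightarrow> ('w \<Rightarrow> complex^'n) \<Rightarrow> complex^'n^('n::finite)" where
  "covariance_matrix M X =
     (\<chi> i j. \<integral>\<omega>. (X \<omega> $ i - (\<integral>\<omega>'. X \<omega>' $ i \<partial>M)) * cnj (X \<omega> $ j - (\<integral>\<omega>'. X \<omega>' $ j \<partial>M)) \<partial>M)"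

text \<open>A density is only determined almost everywhere; continuity singles out the usual
  Gaussian density, which can be evaluated pointwise.\<close>

definition continuous_density :: "'w measure \<Rightarrow> ('w \<Rightarrow> 'v) \<Rightarrow> ('v::euclidean_space \<Rightarrow> real) \<Rightarrow> bool" where
  "continuous_density M X p \<longleftrightarrow>
     continuous_on UNIV p \<and> (\<forall>v. 0 \<le> p v) \<and> distributed M lborel X (\<lambda>v. ennreal (p v))"

definition distinct_tuples :: "complex set \<Rightarrow> (complex^'k::finite) set" where
  "distinct_tuples Z = {w. inj (($) w) \<and> (\<forall>i. w $ i \<in> Z)}"

text \<open>\<open>\<rho>\<close> is the \<open>k\<close>-point intensity function of the zero set: the first two conjuncts
  characterise it as an almost-everywhere class of functions on the \<open>k\<close>-fold product of
  the domain, the last two fix the representative, by the Kac--Rice formula at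
  nondegenerate configurations and by \<open>0\<close> on the diagonals. Sums and integrals are
  taken in \<open>[0,\<infinity>]\<close>, so that no integrability is implied.\<close>

definition zero_intensity ::
  "'w measure \<Rightarrow> (nat \<Rightarrow> real) \<Rightarrow> (nat \<Rightarrow> 'w \<Rightarrow> complex) \<Rightarrow> (complex^'k::finite \<Rightarrow> ennreal) \<Rightarrow> bool" where
  "zero_intensity M a \<zeta> \<rho> \<longleftrightarrow>
     (let D = {w. \<forall>i. w $ i \<in> gaf_domain a} in
       \<rho> \<in> borel_measurable (restrict_space borel D) \<and>
       (\<forall>h \<in> borel_measurable borel.
          (\<integral>\<^sup>+\<omega>. (\<integral>\<^sup>+w. h w \<partial>count_space (distinct_tuples (gaf_zeros a \<zeta> \<omega>))) \<partial>M) =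
          (\<integral>\<^sup>+w\<in>D. h w * \<rho> w \<partial>lborel)) \<and>
       (\<forall>z\<in>D. inj (($) z) \<longrightarrow> invertible (covariance_matrix M (gaf_vector a \<zeta> z)) \<longrightarrow>
          (\<forall>p. continuous_density M (gaf_vector a \<zeta> z) p \<longrightarrow>
             \<rho> z = (\<integral>\<^sup>+\<eta>. ennreal ((cmod (\<Prod>j\<in>UNIV. \<eta> $ j))\<^sup>2 *
                        p (\<chi> i. case i of Inl _ \<Rightarrow> 0 | Inr j \<Rightarrow> \<eta> $ j)) \<partial>lborel))) \<and>
       (\<forall>z\<in>D. \<not> inj (($) z) \<longrightarrow> \<rho> z = 0))"

end

theory Submission
  imports Defs
begin

text \<open>Write \<open>k\<close> for the number of points, \<open>w\<^sub>i = \<Prod>\<^bsub>j \<noteq> i\<^esub> (z\<^sub>i - z\<^sub>j)\<close>, and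
\<open>\<Delta> = \<Prod>\<^bsub>i < j\<^esub> \<bar>z\<^sub>i - z\<^sub>j\<bar>\<^sup>2\<close>, so that \<open>\<Prod>\<^sub>i \<bar>w\<^sub>i\<bar>\<^sup>2 = \<Delta>\<^sup>2\<close>. On the diagonals the intensity is \<open>0\<close>,
so let the \<open>z\<^sub>i\<close> be distinct. The Kac--Rice formula then expresses \<open>\<rho> z\<close> as the integral of
\<open>\<bar>\<eta>\<^sub>1 \<dots> \<eta>\<^sub>k\<bar>\<^sup>2\<close> against the density of \<open>(F(z\<^sub>i), F'(z\<^sub>i))\<close> on the slice \<open>F(z\<^sub>i) = 0\<close>. The proof separates
two effects of nearly coinciding points. Near such a configuration the density of the
values \<open>F(z\<^sub>i)\<close> at \<open>0\<close> is large, but by no more than a factor of order \<open>1/\<Delta>\<close>; given that all values vanish, the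
derivatives are small, because \<open>F\<close> is divisible by \<open>\<Prod> (x - z\<^sub>j)\<close> and hence \<open>F'(z\<^sub>i) = w\<^sub>i G(z\<^sub>i)\<close>, which
contributes \<open>\<Delta>\<^sup>2\<close>. Together they leave the single power of \<open>\<Delta>\<close> in the theorem.

Conditional Gaussian laws are avoided by an algebraic choice of coordinates. Let \<open>B\<close> be the matrix
with \<open>R'(z\<^sub>i) = \<Sum>\<^sub>j B\<^sub>i\<^sub>j R(z\<^sub>j)\<close> for all polynomials \<open>R\<close> of degree less than \<open>k\<close>, and let \<open>Q\<^sub>n\<close> be the quotient of \<open>x\<^sup>n\<close> by
\<open>\<Prod> (x - z\<^sub>j)\<close>. Then
\<open>F'(z\<^sub>i) = \<Sum>\<^sub>j B\<^sub>i\<^sub>j F(z\<^sub>j) + w\<^sub>i \<Sum>\<^sub>n a\<^sub>n \<zeta>\<^sub>n Q\<^sub>n(z\<^sub>i)\<close>,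
and the last sum does not involve \<open>\<zeta>\<^sub>n\<close> for \<open>n < k\<close>, since then \<open>Q\<^sub>n = 0\<close>
(\<open>hermite_interpolation_remainder\<close>). Given all later coefficients, the vector of values is an affine image of
\<open>(\<zeta>\<^sub>0, \<dots>, \<zeta>\<^sub>k\<^sub>-\<^sub>1)\<close> under a Vandermonde matrix with columns multiplied by \<open>a\<^sub>n\<close>, so its density is at most
\<open>\<pi>\<^sup>-\<^sup>k \<Delta>\<^sup>-\<^sup>1 \<Prod>\<^bsub>n < k\<^esub> a\<^sub>n\<^sup>-\<^sup>2\<close>. Integrating out the remaining coefficients (\<open>affine_density\<close>, \<open>gaf_vector_density\<close>) gives
\<open>\<rho> z \<le> \<pi>\<^sup>-\<^sup>k \<Delta> (\<Prod>\<^bsub>n < k\<^esub> a\<^sub>n\<^sup>-\<^sup>2) E[W\<^sup>2\<^sup>k]\<close> with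
\<open>W = \<Sum>\<^bsub>n \<ge> k\<^esub> a\<^sub>n \<bar>\<zeta>\<^sub>n\<bar> (3\<tau>/2)\<^sup>n\<close>.
Here \<open>\<bar>Q\<^sub>n(z\<^sub>i)\<bar> \<le> (3\<tau>/2)\<^sup>n\<close>, because dividing by \<open>x - z\<^sub>j\<close> does not increase the sum of the absolute values of the
terms at radius \<open>3\<tau>/2\<close> when \<open>3\<tau>/2 - \<bar>z\<^sub>j\<bar> \<ge> \<tau>/2 \<ge> 1\<close>; this is where \<open>\<tau> \<ge> 2\<close> enters.

The block \<open>\<zeta>\<^sub>k, \<dots>, \<zeta>\<^sub>2\<^sub>k\<^sub>-\<^sub>1\<close> makes the vector of derivatives absolutely continuous as well, so that the joint density
exists and is continuous; the Jacobian of the corresponding matrix cancels in the estimate. A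
square integrable vector with a density has an invertible covariance matrix
(\<open>covariance_matrix_invertible\<close>), so the Kac--Rice formula is applicable. Finally, with
\<open>S = sup a\<^sub>n (2\<tau>)\<^sup>n\<close>, convexity gives \<open>E[W\<^sup>2\<^sup>k] \<le> (3S)\<^sup>2\<^sup>k \<cdot> 2\<^sup>k\<^sup>+\<^sup>1 k!\<close>, and the remaining constants are absorbed by
\<open>(S/m)\<^sup>2\<^sup>k \<ge> 4\<^bsup>2k(2k-1)\<^esup>\<close>, where \<open>m = min a\<^sub>n\<close> over \<open>n < 2k\<close>. The second bound inserts
\<open>S\<^sup>2 \<le> exp (4\<tau>\<^sup>2 L)\<close>, one term of the exponential series.\<close>

no_notation fps_nth (infixl \<open>$\<close> 75)

section \<open>Lebesgue measure on complex vectors\<close>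

lemma borel_measurable_vec_lambda [measurable (raw)]:
  fixes f :: "'x \<Rightarrow> 'n::finite \<Rightarrow> 'a::euclidean_space"
  assumes "\<And>i. (\<lambda>x. f x i) \<in> borel_measurable M"
  shows "(\<lambda>x. \<chi> i. f x i) \<in> borel_measurable M"
  using assms by (subst borel_measurable_euclidean_space) (auto simp: Basis_vec_def inner_axis)

lemma borel_measurable_vec_nth [measurable (raw)]:
  fixes f :: "'x \<Rightarrow> 'a::euclidean_space ^ 'n::finite"
  assumes "f \<in> borel_measurable M"
  shows "(\<lambda>x. f x $ i) \<in> borel_measurable M"
  by (rule measurable_compose[OF assms]) (intro borel_measurable_continuous_onI continuous_intros)

lemma lborel_vec:
  "distr (\<Pi>\<^sub>M i\<in>UNIV. lborel) borel vec_lambda = (lborel :: ('a::euclidean_space ^ 'n::finite) measure)"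
proof (rule lborel_eqI[symmetric])
  interpret product_sigma_finite "\<lambda>_::'n. lborel :: 'a measure" ..
  fix l u :: "'a ^ 'n"
  assume le: "\<And>b. b \<in> Basis \<Longrightarrow> l \<bullet> b \<le> u \<bullet> b"
  have le': "l $ i \<bullet> b \<le> u $ i \<bullet> b" if "b \<in> Basis" for i b
    using le[of "axis i b"] that by (auto simp: Basis_vec_def inner_axis)
  have box: "vec_lambda -` box l u = (\<Pi>\<^sub>E i\<in>UNIV. box (l $ i) (u $ i))"
    by (auto simp: box_def Basis_vec_def inner_axis PiE_def Pi_def)
  have inj: "inj_on (\<lambda>(i, b). axis i b) ((UNIV::'n set) \<times> (Basis :: 'a set))"
    by (auto simp: inj_on_def axis_eq_axis)
  have B: "(Basis :: ('a ^ 'n) set) = (\<lambda>(i, b). axis i b) ` (UNIV \<times> Basis)"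
    by (auto simp: Basis_vec_def)
  have "emeasure (distr (\<Pi>\<^sub>M i\<in>UNIV. lborel) borel vec_lambda) (box l u)
      = emeasure (\<Pi>\<^sub>M i\<in>(UNIV::'n set). lborel) (\<Pi>\<^sub>E i\<in>UNIV. box (l $ i) (u $ i))"
    by (subst emeasure_distr) (auto simp: box space_PiM PiE_def)
  also have "\<dots> = (\<Prod>i\<in>(UNIV::'n set). emeasure lborel (box (l $ i) (u $ i)))"
    by (intro emeasure_PiM) auto
  also have "\<dots> = (\<Prod>i\<in>(UNIV::'n set). ennreal (\<Prod>b\<in>Basis. (u $ i - l $ i) \<bullet> b))"
    using le' by simp
  also have "\<dots> = ennreal (\<Prod>i\<in>(UNIV::'n set). \<Prod>b\<in>Basis. (u $ i - l $ i) \<bullet> b)"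
    using le' by (subst prod_ennreal) (auto intro!: prod_nonneg simp: inner_diff_left)
  also have "(\<Prod>i\<in>(UNIV::'n set). \<Prod>b\<in>Basis. (u $ i - l $ i) \<bullet> b) = (\<Prod>b\<in>Basis. (u - l) \<bullet> b)"
    unfolding B by (subst prod.reindex[OF inj]) (simp add: prod.cartesian_product inner_axis case_prod_beta comp_def)
  finally show "emeasure (distr (\<Pi>\<^sub>M i\<in>UNIV. lborel) borel vec_lambda) (box l u) = (\<Prod>b\<in>Basis. (u - l) \<bullet> b)" .
qed simp

lemma lborel_complex: "distr (lborel \<Otimes>\<^sub>M lborel) borel (\<lambda>(x, y). Complex x y) = (lborel :: complex measure)"
proof (rule lborel_eqI[symmetric])
  have [measurable]: "(\<lambda>(x, y). Complex x y) \<in> borel_measurable (lborel \<Otimes>\<^sub>M lborel)"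
    by (subst borel_measurable_euclidean_space) (auto simp: Basis_complex_def inner_complex_def case_prod_beta)
  fix l u :: complex
  assume le: "\<And>b. b \<in> Basis \<Longrightarrow> l \<bullet> b \<le> u \<bullet> b"
  have le': "Re l \<le> Re u" "Im l \<le> Im u"
    using le[of 1] le[of \<i>] by (auto simp: Basis_complex_def inner_complex_def)
  have box: "(\<lambda>(x, y). Complex x y) -` box l u = {Re l<..<Re u} \<times> {Im l<..<Im u}"
    by (auto simp: box_def Basis_complex_def inner_complex_def)
  show "emeasure (distr (lborel \<Otimes>\<^sub>M lborel) borel (\<lambda>(x, y). Complex x y)) (box l u) = (\<Prod>b\<in>Basis. (u - l) \<bullet> b)"
    using le' by (subst emeasure_distr)
      (auto simp: box space_pair_measure lborel.emeasure_pair_measure_Times Basis_complex_def inner_complex_def ennreal_mult)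
qed simp

lemma lborel_vec_sum:
  "distr (lborel \<Otimes>\<^sub>M lborel) borel (\<lambda>(v, w). \<chi> i. case i of Inl j \<Rightarrow> v $ j | Inr j \<Rightarrow> w $ j)
     = (lborel :: ('a::euclidean_space ^ ('m::finite + 'n::finite)) measure)"
    (is "distr _ _ ?T = _")
proof (rule lborel_eqI[symmetric])
  have [measurable]: "?T \<in> borel_measurable (lborel \<Otimes>\<^sub>M lborel)"
    unfolding case_prod_beta
    apply (rule borel_measurable_vec_lambda)
    subgoal for i by (cases i) auto
    done
  fix l u :: "'a ^ ('m + 'n)"
  assume le: "\<And>b. b \<in> Basis \<Longrightarrow> l \<bullet> b \<le> u \<bullet> b"
  have le': "l $ i \<bullet> b \<le> u $ i \<bullet> b" if "b \<in> Basis" for i b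
    using le[of "axis i b"] that by (auto simp: Basis_vec_def inner_axis)
  let ?l = "\<lambda>(l::'a^('m+'n)). \<chi> i. l $ Inl i" and ?r = "\<lambda>(l::'a^('m+'n)). \<chi> i. l $ Inr i"
  have le2: "?l l \<bullet> b \<le> ?l u \<bullet> b" if "b \<in> Basis" for b :: "'a ^ 'm"
  proof -
    from that obtain i v where "b = axis i v" "v \<in> Basis" by (auto simp: Basis_vec_def)
    with le'[of v "Inl i"] show ?thesis by (simp add: inner_axis)
  qed
  have le3: "?r l \<bullet> b \<le> ?r u \<bullet> b" if "b \<in> Basis" for b :: "'a ^ 'n"
  proof -
    from that obtain i v where "b = axis i v" "v \<in> Basis" by (auto simp: Basis_vec_def)
    with le'[of v "Inr i"] show ?thesis by (simp add: inner_axis)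
  qed
  have box: "?T -` box l u = box (?l l) (?l u) \<times> box (?r l) (?r u)"
    by (auto simp: box_def Basis_vec_def inner_axis all_conj_distrib split_sum_all)
  have inj: "inj_on (\<lambda>(i, b). axis i b) ((UNIV::'i::finite set) \<times> (Basis :: 'a set))"
    by (auto simp: inj_on_def axis_eq_axis)
  have B: "(Basis :: ('a ^ 'i::finite) set) = (\<lambda>(i, b). axis i b) ` (UNIV \<times> Basis)"
    by (auto simp: Basis_vec_def)
  have Bp: "(\<Prod>b\<in>Basis. (v::'a^'i::finite) \<bullet> b) = (\<Prod>i\<in>UNIV. \<Prod>b\<in>Basis. v $ i \<bullet> b)" for v
    unfolding B by (subst prod.reindex[OF inj]) (simp add: prod.cartesian_product inner_axis case_prod_beta comp_def)
  have "emeasure (distr (lborel \<Otimes>\<^sub>M lborel) borel ?T) (box l u)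
     = emeasure lborel (box (?l l) (?l u)) * emeasure lborel (box (?r l) (?r u))"
    by (subst emeasure_distr) (auto simp: box space_pair_measure lborel.emeasure_pair_measure_Times)
  also have "\<dots> = ennreal (\<Prod>b\<in>Basis. (?l u - ?l l) \<bullet> b) * ennreal (\<Prod>b\<in>Basis. (?r u - ?r l) \<bullet> b)"
    using le2 le3 by simp
  also have "\<dots> = ennreal ((\<Prod>b\<in>Basis. (?l u - ?l l) \<bullet> b) * (\<Prod>b\<in>Basis. (?r u - ?r l) \<bullet> b))"
    using le2 le3 by (intro ennreal_mult[symmetric] prod_nonneg) (auto simp: inner_diff_left)
  also have "(\<Prod>b\<in>Basis. (?l u - ?l l) \<bullet> b) * (\<Prod>b\<in>Basis. (?r u - ?r l) \<bullet> b) = (\<Prod>b\<in>Basis. (u - l) \<bullet> b)"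
    unfolding Bp UNIV_sum by (subst prod.union_disjoint) (auto simp: prod.reindex)
  finally show "emeasure (distr (lborel \<Otimes>\<^sub>M lborel) borel ?T) (box l u) = (\<Prod>b\<in>Basis. (u - l) \<bullet> b)" .
qed simp

lemma nn_integral_lborel_translate:
  fixes s :: "'a::euclidean_space"
  assumes [measurable]: "f \<in> borel_measurable borel"
  shows "(\<integral>\<^sup>+x. f (x + s) \<partial>lborel) = (\<integral>\<^sup>+x. f x \<partial>lborel)"
proof -
  have "(\<integral>\<^sup>+x. f x \<partial>lborel) = (\<integral>\<^sup>+x. f x \<partial>distr lborel borel ((+) s))"
    by (simp add: lborel_distr_plus)
  also have "\<dots> = (\<integral>\<^sup>+x. f (x + s) \<partial>lborel)"
    by (subst nn_integral_distr) (auto simp: add.commute)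
  finally show ?thesis ..
qed

lemma borel_measurable_Complex [measurable (raw)]:
  assumes "f \<in> borel_measurable M" "g \<in> borel_measurable M"
  shows "(\<lambda>x. Complex (f x) (g x)) \<in> borel_measurable M"
  using assms by (subst borel_measurable_euclidean_space) (auto simp: Basis_complex_def inner_complex_def)

lemma nn_integral_lborel_complex:
  assumes [measurable]: "f \<in> borel_measurable borel"
  shows "(\<integral>\<^sup>+z. f z \<partial>lborel) = (\<integral>\<^sup>+y. \<integral>\<^sup>+x. f (Complex x y) \<partial>lborel \<partial>lborel)"
    and "(\<integral>\<^sup>+z. f z \<partial>lborel) = (\<integral>\<^sup>+x. \<integral>\<^sup>+y. f (Complex x y) \<partial>lborel \<partial>lborel)"
proof -
  have "(\<integral>\<^sup>+z. f z \<partial>lborel) = (\<integral>\<^sup>+p. f (Complex (fst p) (snd p)) \<partial>(lborel \<Otimes>\<^sub>M lborel))"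
    unfolding lborel_complex[symmetric] by (subst nn_integral_distr) (auto simp: case_prod_beta)
  also have "\<dots> = (\<integral>\<^sup>+x. \<integral>\<^sup>+y. f (Complex x y) \<partial>lborel \<partial>lborel)"
    by (subst lborel.nn_integral_fst[symmetric]) auto
  finally show 1: "(\<integral>\<^sup>+z. f z \<partial>lborel) = (\<integral>\<^sup>+x. \<integral>\<^sup>+y. f (Complex x y) \<partial>lborel \<partial>lborel)" .
  also have "\<dots> = (\<integral>\<^sup>+y. \<integral>\<^sup>+x. f (Complex x y) \<partial>lborel \<partial>lborel)"
    by (rule lborel_pair.Fubini') (auto simp: case_prod_beta)
  finally show "(\<integral>\<^sup>+z. f z \<partial>lborel) = (\<integral>\<^sup>+y. \<integral>\<^sup>+x. f (Complex x y) \<partial>lborel \<partial>lborel)" .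
qed

text \<open>As a real matrix, multiplication by \<open>p + iq\<close> with \<open>p \<noteq> 0\<close> factors into two operations, each changing one
coordinate: first \<open>x\<close> becomes \<open>px - qy\<close>, then \<open>y\<close> is scaled by \<open>(p\<^sup>2 + q\<^sup>2)/p\<close> and translated. Fubini and the
affine substitution on the line treat both.\<close>

lemma nn_integral_complex_mult_Re:
  fixes d :: complex
  assumes [measurable]: "f \<in> borel_measurable borel" and d: "Re d \<noteq> 0"
  shows "ennreal ((cmod d)\<^sup>2) * (\<integral>\<^sup>+z. f (d * z) \<partial>lborel) = (\<integral>\<^sup>+z. f z \<partial>lborel)"
proof -
  define p q where "p = Re d" and "q = Im d"
  have p: "p \<noteq> 0" and nz: "(p\<^sup>2 + q\<^sup>2) / p \<noteq> 0"
    using d by (auto simp: p_def sum_power2_eq_zero_iff)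
  have D: "d = Complex p q" by (simp add: p_def q_def)
  have mult: "d * Complex x y = Complex (p * x - q * y) (q * x + p * y)" for x y
    by (simp add: D complex_eq_iff)
  define g where "g x' y = f (Complex x' (q / p * x' + (p\<^sup>2 + q\<^sup>2) / p * y))" for x' y
  have g: "f (d * Complex x y) = g (- q * y + p * x) y" for x y
  proof -
    have "q * x + p * y = q / p * (- q * y + p * x) + (p\<^sup>2 + q\<^sup>2) / p * y"
      using p by (simp add: field_simps power2_eq_square)
    then show ?thesis by (simp only: mult g_def) (simp add: algebra_simps)
  qed
  have [measurable]: "case_prod g \<in> borel_measurable (borel \<Otimes>\<^sub>M borel)"
    unfolding g_def case_prod_beta by measurable
  have [measurable]: "g x \<in> borel_measurable borel" "(\<lambda>x. g x y) \<in> borel_measurable borel" for x y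
    unfolding g_def by measurable
  have "(\<integral>\<^sup>+z. f (d * z) \<partial>lborel) = (\<integral>\<^sup>+y. \<integral>\<^sup>+x. g (- q * y + p * x) y \<partial>lborel \<partial>lborel)"
    by (subst nn_integral_lborel_complex(1)) (auto simp: g)
  also have "\<dots> = (\<integral>\<^sup>+x. \<integral>\<^sup>+y. g (- q * y + p * x) y \<partial>lborel \<partial>lborel)"
    by (rule lborel_pair.Fubini') (auto simp: case_prod_beta)
  finally have "ennreal \<bar>p\<bar> * (\<integral>\<^sup>+z. f (d * z) \<partial>lborel) = ennreal \<bar>p\<bar> * (\<integral>\<^sup>+y. \<integral>\<^sup>+x. g (- q * y + p * x) y \<partial>lborel \<partial>lborel)"
    by (subst lborel_pair.Fubini') (auto simp: case_prod_beta)
  also have "\<dots> = (\<integral>\<^sup>+y. ennreal \<bar>p\<bar> * \<integral>\<^sup>+x. g (- q * y + p * x) y \<partial>lborel \<partial>lborel)"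
    by (subst nn_integral_cmult) auto
  also have "\<dots> = (\<integral>\<^sup>+y. \<integral>\<^sup>+x. g x y \<partial>lborel \<partial>lborel)"
    using p by (subst nn_integral_real_affine[symmetric]) auto
  also have "\<dots> = (\<integral>\<^sup>+x. \<integral>\<^sup>+y. g x y \<partial>lborel \<partial>lborel)"
    by (rule lborel_pair.Fubini') (auto simp: case_prod_beta)
  finally have 1: "ennreal \<bar>p\<bar> * (\<integral>\<^sup>+z. f (d * z) \<partial>lborel) = (\<integral>\<^sup>+x. \<integral>\<^sup>+y. g x y \<partial>lborel \<partial>lborel)" .
  have "ennreal \<bar>(p\<^sup>2 + q\<^sup>2) / p\<bar> * (\<integral>\<^sup>+x. \<integral>\<^sup>+y. g x y \<partial>lborel \<partial>lborel) =
     (\<integral>\<^sup>+x. ennreal \<bar>(p\<^sup>2 + q\<^sup>2) / p\<bar> * \<integral>\<^sup>+y. g x y \<partial>lborel \<partial>lborel)"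
    by (subst nn_integral_cmult) auto
  also have "\<dots> = (\<integral>\<^sup>+x. \<integral>\<^sup>+y. f (Complex x y) \<partial>lborel \<partial>lborel)"
    unfolding g_def using nz
    by (intro nn_integral_cong, subst nn_integral_real_affine[symmetric]) auto
  also have "\<dots> = (\<integral>\<^sup>+z. f z \<partial>lborel)"
    by (subst nn_integral_lborel_complex(2)) auto
  finally have "(\<integral>\<^sup>+z. f z \<partial>lborel) = ennreal \<bar>(p\<^sup>2 + q\<^sup>2) / p\<bar> * (ennreal \<bar>p\<bar> * (\<integral>\<^sup>+z. f (d * z) \<partial>lborel))"
    unfolding 1 ..
  also have "\<dots> = ennreal (\<bar>(p\<^sup>2 + q\<^sup>2) / p\<bar> * \<bar>p\<bar>) * (\<integral>\<^sup>+z. f (d * z) \<partial>lborel)"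
    by (subst ennreal_mult) (auto simp: mult.assoc)
  also have "\<bar>(p\<^sup>2 + q\<^sup>2) / p\<bar> * \<bar>p\<bar> = (cmod d)\<^sup>2"
    using p by (simp add: D cmod_power2 abs_mult[symmetric])
  finally show ?thesis ..
qed

text \<open>A purely imaginary factor is reduced to the previous case by writing it as \<open>(1 + i)\<close> times a number
with nonzero real part.\<close>

lemma nn_integral_complex_mult:
  fixes d s :: complex
  assumes [measurable]: "f \<in> borel_measurable borel" and d: "d \<noteq> 0"
  shows "(\<integral>\<^sup>+z. f (d * z + s) \<partial>lborel) = ennreal (1 / (cmod d)\<^sup>2) * (\<integral>\<^sup>+z. f z \<partial>lborel)"
proof -
  have *: "ennreal ((cmod d)\<^sup>2) * (\<integral>\<^sup>+z. f (d * z) \<partial>lborel) = (\<integral>\<^sup>+z. f z \<partial>lborel)"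
    if [measurable]: "f \<in> borel_measurable borel" for f
  proof (cases "Re d = 0")
    case False
    with nn_integral_complex_mult_Re that show ?thesis by blast
  next
    case True
    with d have "Im d \<noteq> 0" by (simp add: complex_eq_iff)
    \<comment> \<open>Dividing an imaginary number by \<open>1 + i\<close> leaves a nonzero real part.\<close>
    define e where "e = d / Complex 1 1"
    have e: "d = Complex 1 1 * e" "Re e \<noteq> 0"
      using True \<open>Im d \<noteq> 0\<close> by (auto simp: e_def complex_eq_iff Re_divide)
    have "ennreal ((cmod d)\<^sup>2) * (\<integral>\<^sup>+z. f (d * z) \<partial>lborel)
      = ennreal ((cmod (Complex 1 1))\<^sup>2) * (ennreal ((cmod e)\<^sup>2) * (\<integral>\<^sup>+z. f (Complex 1 1 * (e * z)) \<partial>lborel))"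
      unfolding e by (simp add: norm_mult power_mult_distrib ennreal_mult mult.assoc)
    also have "\<dots> = (\<integral>\<^sup>+z. f z \<partial>lborel)"
      using e by (simp add: nn_integral_complex_mult_Re[where f="\<lambda>z. f (Complex 1 1 * z)"] nn_integral_complex_mult_Re)
    finally show ?thesis .
  qed
  have "(\<integral>\<^sup>+z. f (d * z + s) \<partial>lborel) = ennreal (1 / (cmod d)\<^sup>2) * (ennreal ((cmod d)\<^sup>2) * (\<integral>\<^sup>+z. f (d * z + s) \<partial>lborel))"
    using d by (simp add: mult.assoc[symmetric] ennreal_mult[symmetric])
  also have "\<dots> = ennreal (1 / (cmod d)\<^sup>2) * (\<integral>\<^sup>+z. f (z + s) \<partial>lborel)"
    using *[of "\<lambda>z. f (z + s)"] by simp
  finally show ?thesis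
    by (simp add: nn_integral_lborel_translate)
qed

section \<open>Scaling of Lebesgue measure by triangular complex matrices\<close>

text \<open>The Jacobian of a linear substitution, expressed through the change of variables that it is used for. No
determinants occur: the constants below arise from triangular factorisations.\<close>

definition scales_lborel :: "('a::euclidean_space \<Rightarrow> 'a) \<Rightarrow> real \<Rightarrow> bool" where
  "scales_lborel T c \<longleftrightarrow> T \<in> borel_measurable borel \<and> 0 < c \<and>
     (\<forall>f \<in> borel_measurable borel. (\<integral>\<^sup>+x. f (T x) \<partial>lborel) = ennreal c * (\<integral>\<^sup>+x. f x \<partial>lborel))"

lemma scales_lborelI:
  assumes "T \<in> borel_measurable borel" "0 < c"
    "\<And>f. f \<in> borel_measurable borel \<Longrightarrow> (\<integral>\<^sup>+x. f (T x) \<partial>lborel) = ennreal c * (\<integral>\<^sup>+x. f x \<partial>lborel)"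
  shows "scales_lborel T c"
  using assms by (auto simp: scales_lborel_def)

lemma scales_lborelD:
  assumes "scales_lborel T c"
  shows "T \<in> borel_measurable borel" "0 < c"
    "f \<in> borel_measurable borel \<Longrightarrow> (\<integral>\<^sup>+x. f (T x) \<partial>lborel) = ennreal c * (\<integral>\<^sup>+x. f x \<partial>lborel)"
  using assms by (auto simp: scales_lborel_def)

lemma scales_lborel_compose:
  assumes T: "scales_lborel T c" and S: "scales_lborel S d"
  shows "scales_lborel (\<lambda>x. T (S x)) (c * d)"
proof (rule scales_lborelI)
  note [measurable] = scales_lborelD(1)[OF T] scales_lborelD(1)[OF S]
  show "(\<lambda>x. T (S x)) \<in> borel_measurable borel" by measurable
  show "0 < c * d" using scales_lborelD(2)[OF T] scales_lborelD(2)[OF S] by simp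
  fix f :: "'a \<Rightarrow> ennreal" assume [measurable]: "f \<in> borel_measurable borel"
  show "(\<integral>\<^sup>+x. f (T (S x)) \<partial>lborel) = ennreal (c * d) * (\<integral>\<^sup>+x. f x \<partial>lborel)"
    using scales_lborelD(2)[OF T] scales_lborelD(2)[OF S]
      scales_lborelD(3)[OF S, of "\<lambda>x. f (T x)"] scales_lborelD(3)[OF T, of f]
    by (simp add: ennreal_mult mult_ac)
qed

text \<open>The elementary step: by Fubini in the coordinate \<open>m\<close>, on which the translation \<open>h x\<close> does not depend, only the
factor \<open>d\<close> contributes.\<close>

lemma scales_lborel_coordinate:
  fixes h :: "complex ^ 'n::finite \<Rightarrow> complex"
  assumes d: "d \<noteq> 0" and [measurable]: "h \<in> borel_measurable borel"
    and h: "\<And>x y. (\<And>i. i \<noteq> m \<Longrightarrow> x $ i = y $ i) \<Longrightarrow> h x = h y"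
  shows "scales_lborel (\<lambda>x. \<chi> i. if i = m then d * x $ m + h x else x $ i) (1 / (cmod d)\<^sup>2)"
    (is "scales_lborel ?T _")
proof (rule scales_lborelI)
  show T [measurable]: "?T \<in> borel_measurable borel" by measurable
  show "0 < 1 / (cmod d)\<^sup>2" using d by simp
  fix f :: "complex ^ 'n \<Rightarrow> ennreal" assume [measurable]: "f \<in> borel_measurable borel"
  interpret product_sigma_finite "\<lambda>_::'n. lborel :: complex measure" ..
  let ?J = "UNIV - {m}"
  have U: "(UNIV :: 'n set) = insert m ?J" by auto
  have fub: "(\<integral>\<^sup>+x. g x \<partial>lborel) = (\<integral>\<^sup>+x. \<integral>\<^sup>+y. g (vec_lambda (x(m := y))) \<partial>lborel \<partial>(\<Pi>\<^sub>M i\<in>?J. lborel))"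
    if [measurable]: "g \<in> borel_measurable borel" for g :: "complex ^ 'n \<Rightarrow> ennreal"
  proof -
    have [measurable]: "vec_lambda \<in> borel_measurable (\<Pi>\<^sub>M i\<in>UNIV. lborel)" by measurable
    have "(\<integral>\<^sup>+x. g x \<partial>lborel) = (\<integral>\<^sup>+x. g (vec_lambda x) \<partial>(\<Pi>\<^sub>M i\<in>UNIV. lborel))"
      unfolding lborel_vec[symmetric] by (subst nn_integral_distr) auto
    also have "\<dots> = (\<integral>\<^sup>+x. g (vec_lambda x) \<partial>(\<Pi>\<^sub>M i\<in>insert m ?J. lborel))"
      using U by simp
    also have "\<dots> = (\<integral>\<^sup>+x. \<integral>\<^sup>+y. g (vec_lambda (x(m := y))) \<partial>lborel \<partial>(\<Pi>\<^sub>M i\<in>?J. lborel))"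
      by (rule product_nn_integral_insert) (auto simp: U[symmetric])
    finally show ?thesis .
  qed
  have meas [measurable]: "(\<lambda>y. vec_lambda (x(m := y))) \<in> borel_measurable borel" for x :: "'n \<Rightarrow> complex"
    by (rule borel_measurable_vec_lambda) (simp add: fun_upd_def)
  have "(\<integral>\<^sup>+x. f (?T x) \<partial>lborel) = (\<integral>\<^sup>+x. \<integral>\<^sup>+y. f (?T (vec_lambda (x(m := y)))) \<partial>lborel \<partial>(\<Pi>\<^sub>M i\<in>?J. lborel))"
    by (rule fub) measurable
  also have "\<dots> = (\<integral>\<^sup>+x. \<integral>\<^sup>+y. f (vec_lambda (x(m := d * y + h (vec_lambda (x(m := 0)))))) \<partial>lborel \<partial>(\<Pi>\<^sub>M i\<in>?J. lborel))"
  proof (intro nn_integral_cong arg_cong[of _ _ f])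
    fix x :: "'n \<Rightarrow> complex" and y
    have "h (vec_lambda (x(m := y))) = h (vec_lambda (x(m := 0)))" by (rule h) auto
    then show "?T (vec_lambda (x(m := y))) = vec_lambda (x(m := d * y + h (vec_lambda (x(m := 0)))))"
      by (auto simp: vec_eq_iff)
  qed
  also have "\<dots> = (\<integral>\<^sup>+x. ennreal (1 / (cmod d)\<^sup>2) * \<integral>\<^sup>+y. f (vec_lambda (x(m := y))) \<partial>lborel \<partial>(\<Pi>\<^sub>M i\<in>?J. lborel))"
    using d by (intro nn_integral_cong) (subst nn_integral_complex_mult[where f="\<lambda>y. f (vec_lambda (_(m := y)))"], auto)
  also have "\<dots> = ennreal (1 / (cmod d)\<^sup>2) * (\<integral>\<^sup>+x. \<integral>\<^sup>+y. f (vec_lambda (x(m := y))) \<partial>lborel \<partial>(\<Pi>\<^sub>M i\<in>?J. lborel))"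
  proof (rule nn_integral_cmult)
    have "(\<lambda>(x, y). vec_lambda (x(m := y))) \<in> borel_measurable ((\<Pi>\<^sub>M i\<in>?J. lborel) \<Otimes>\<^sub>M (lborel :: complex measure))"
      unfolding case_prod_beta
    proof (rule borel_measurable_vec_lambda)
      show "(\<lambda>p. ((fst p)(m := snd p)) i) \<in> borel_measurable ((\<Pi>\<^sub>M i\<in>?J. lborel) \<Otimes>\<^sub>M (lborel :: complex measure))" for i
      proof (cases "i = m")
        case False
        then have "(\<lambda>x. x i) \<in> measurable (\<Pi>\<^sub>M i\<in>?J. lborel) (borel :: complex measure)"
          using measurable_component_singleton[of i ?J "\<lambda>_. lborel :: complex measure"] by simp
        from measurable_compose[OF measurable_fst this] False show ?thesis by simp
      qed simp
    qed
    then show "(\<lambda>x. \<integral>\<^sup>+y. f (vec_lambda (x(m := y))) \<partial>lborel) \<in> borel_measurable (\<Pi>\<^sub>M i\<in>?J. lborel)"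
      by (intro lborel.borel_measurable_nn_integral) (auto simp: case_prod_beta)
  qed
  also have "(\<integral>\<^sup>+x. \<integral>\<^sup>+y. f (vec_lambda (x(m := y))) \<partial>lborel \<partial>(\<Pi>\<^sub>M i\<in>?J. lborel)) = (\<integral>\<^sup>+x. f x \<partial>lborel)"
    by (rule fub[symmetric]) measurable
  finally show "(\<integral>\<^sup>+x. f (?T x) \<partial>lborel) = ennreal (1 / (cmod d)\<^sup>2) * (\<integral>\<^sup>+x. f x \<partial>lborel)" .
qed

lemma borel_measurable_matrix_vector_mult [measurable]:
  fixes A :: "complex ^ 'n::finite ^ 'm::finite"
  shows "(\<lambda>x. A *v x) \<in> borel_measurable borel"
  unfolding matrix_vector_mult_def by measurable

text \<open>The ordering \<open>r\<close> lets one lemma serve for upper and lower triangular matrices. Coordinates are replaced one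
at a time in increasing order of \<open>r\<close>; the row of a coordinate only involves coordinates that have not
been replaced yet, so every step is an instance of \<open>scales_lborel_coordinate\<close>.\<close>

lemma scales_lborel_triangular:
  fixes A :: "complex ^ 'n::finite ^ 'n" and r :: "'n \<Rightarrow> 'b::linorder"
  assumes r: "inj r" and tri: "\<And>i j. r j < r i \<Longrightarrow> A $ i $ j = 0" and diag: "\<And>i. A $ i $ i \<noteq> 0"
  shows "scales_lborel ((*v) A) (\<Prod>i\<in>UNIV. 1 / (cmod (A $ i $ i))\<^sup>2)"
proof -
  have "scales_lborel (\<lambda>x. \<chi> i. if i \<in> S then (A *v x) $ i else x $ i) (\<Prod>i\<in>S. 1 / (cmod (A $ i $ i))\<^sup>2)"
    if "finite S" for S
    using that
  proof (induction S rule: finite_ranking_induct[where f = r])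
    case empty
    show ?case by (simp add: scales_lborel_def)
  next
    case (insert m S)
    show ?case
    proof (cases "m \<in> S")
      case True
      with insert show ?thesis by (simp add: insert_absorb)
    next
      case False
      define h :: "complex ^ 'n \<Rightarrow> complex" where "h x = (\<Sum>j\<in>UNIV - {m} - S. A $ m $ j * x $ j)" for x
      have [measurable]: "h \<in> borel_measurable borel" unfolding h_def by measurable
      let ?U = "\<lambda>x. \<chi> i. if i = m then A $ m $ m * x $ m + h x else x $ i"
      have zero: "A $ m $ j = 0" if "j \<in> S" for j
        using insert(2)[OF that] that False r by (intro tri) (metis inj_eq order_le_less)
      have row: "(A *v x) $ m = A $ m $ m * x $ m + h x" for x
      proof -
        have "(A *v x) $ m = A $ m $ m * x $ m + (\<Sum>j\<in>UNIV - {m}. A $ m $ j * x $ j)"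
          by (simp add: matrix_vector_mult_def sum.remove[of UNIV m])
        also have "(\<Sum>j\<in>UNIV - {m}. A $ m $ j * x $ j) = h x"
          unfolding h_def by (rule sum.mono_neutral_right) (auto simp: zero)
        finally show ?thesis .
      qed
      have "scales_lborel ?U (1 / (cmod (A $ m $ m))\<^sup>2)"
        by (rule scales_lborel_coordinate) (auto simp: diag h_def intro!: sum.cong)
      from scales_lborel_compose[OF this insert.IH]
      have "scales_lborel (\<lambda>x. ?U (\<chi> i. if i \<in> S then (A *v x) $ i else x $ i))
         (\<Prod>i\<in>insert m S. 1 / (cmod (A $ i $ i))\<^sup>2)"
        using insert False by simp
      also have "(\<lambda>x. ?U (\<chi> i. if i \<in> S then (A *v x) $ i else x $ i))
          = (\<lambda>x. \<chi> i. if i \<in> insert m S then (A *v x) $ i else x $ i)"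
        using False by (auto simp: fun_eq_iff vec_eq_iff row h_def intro!: sum.cong)
      finally show ?thesis .
    qed
  qed
  from this[of UNIV] show ?thesis by simp
qed

text \<open>Yields the constant of one factor of a matrix product from that of the product and of the other factor.\<close>

lemma scales_lborel_cancel:
  assumes T: "T \<in> borel_measurable borel" and S: "scales_lborel S c" and TS: "scales_lborel (\<lambda>x. T (S x)) d"
  shows "scales_lborel T (d / c)"
proof (rule scales_lborelI)
  have c: "0 < c" "0 < d" using S TS by (auto simp: scales_lborel_def)
  then show "0 < d / c" by simp
  fix f :: "'a \<Rightarrow> ennreal" assume f: "f \<in> borel_measurable borel"
  have "ennreal c * (\<integral>\<^sup>+x. f (T x) \<partial>lborel) = ennreal d * (\<integral>\<^sup>+x. f x \<partial>lborel)"
    using scales_lborelD(3)[OF S, of "\<lambda>x. f (T x)"] scales_lborelD(3)[OF TS f] measurable_compose[OF T f] by simp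
  then have "ennreal (1 / c) * (ennreal c * (\<integral>\<^sup>+x. f (T x) \<partial>lborel)) = ennreal (1 / c) * (ennreal d * (\<integral>\<^sup>+x. f x \<partial>lborel))"
    by simp
  then show "(\<integral>\<^sup>+x. f (T x) \<partial>lborel) = ennreal (d / c) * (\<integral>\<^sup>+x. f x \<partial>lborel)"
    using c by (simp add: mult.assoc[symmetric] ennreal_mult[symmetric])
qed (rule T)

text \<open>A singular matrix maps everything into a proper subspace, which is a null set; testing the scaling
identity on its indicator function gives \<open>\<infinity> = 0\<close>.\<close>

lemma scales_lborel_matrix_left_inverse:
  fixes A :: "complex ^ 'n::finite ^ 'n"
  assumes "scales_lborel ((*v) A) c"
  obtains A' where "A' ** A = mat 1"
proof -
  have lin: "linear ((*v) A)"
    by (rule linearI) (simp_all add: vec_eq_iff matrix_vector_mult_def scaleR_sum_right sum.distrib distrib_left)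
  have "surj ((*v) A)"
  proof (rule ccontr)
    assume ns: "\<not> surj ((*v) A)"
    have sub: "subspace (range ((*v) A))" using lin by (simp add: linear_subspace_image)
    have "dim (range ((*v) A)) \<noteq> DIM(complex ^ 'n)"
      using ns sub by (metis dim_eq_full span_eq_iff)
    then have "dim (range ((*v) A)) < DIM(complex ^ 'n)"
      using dim_subset_UNIV[of "range ((*v) A)"] by simp
    then have "negligible (range ((*v) A))" by (rule negligible_lowdim)
    moreover have [measurable]: "range ((*v) A) \<in> sets borel" using closed_subspace[OF sub] by simp
    ultimately have 0: "emeasure lborel (range ((*v) A)) = 0"
      by (auto simp: negligible_iff_null_sets null_sets_completion_iff null_setsD1)
    have "(\<integral>\<^sup>+x. indicator (range ((*v) A)) (A *v x) \<partial>lborel) = ennreal c * (\<integral>\<^sup>+x. indicator (range ((*v) A)) x \<partial>lborel)"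
      by (rule scales_lborelD(3)[OF assms]) simp
    then show False by (simp add: 0)
  qed
  then have "inj ((*v) A)" using lin by (simp add: linear_surjective_imp_injective)
  then show ?thesis using matrix_left_invertible_injective[of A] that by blast
qed

text \<open>The order isomorphism from the index type onto \<open>{..<CARD('k)}\<close>, used to let the entries of a vector run through
the coefficients of a polynomial of degree less than \<open>k\<close>.\<close>

definition index_rank :: "'k::{finite,linorder} \<Rightarrow> nat" where
  "index_rank i = card {j. j < i}"

lemma index_rank_mono: "i < j \<Longrightarrow> index_rank i < index_rank (j :: 'k::{finite,linorder})"
  unfolding index_rank_def by (intro psubset_card_mono) auto

lemma index_rank_less_iff: "index_rank i < index_rank j \<longleftrightarrow> i < (j :: 'k::{finite,linorder})"
  by (metis index_rank_mono less_asym linorder_neqE less_irrefl)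

lemma inj_index_rank: "inj (index_rank :: 'k::{finite,linorder} \<Rightarrow> nat)"
  by (rule injI) (metis index_rank_mono less_irrefl linorder_neqE)

lemma bij_index_rank: "bij_betw index_rank (UNIV :: 'k::{finite,linorder} set) {..<CARD('k)}"
proof -
  have "index_rank i < CARD('k)" for i :: 'k
    unfolding index_rank_def by (intro psubset_card_mono) auto
  then have "range (index_rank :: 'k \<Rightarrow> nat) \<subseteq> {..<CARD('k)}" by auto
  then have "range (index_rank :: 'k \<Rightarrow> nat) = {..<CARD('k)}"
    by (rule card_subset_eq[rotated]) (simp_all add: card_image inj_index_rank)
  then show ?thesis by (simp add: bij_betw_def inj_index_rank)
qed

lemma index_rank_less_card: "index_rank (i :: 'k::{finite,linorder}) < CARD('k)"
  using bij_index_rank by (auto simp: bij_betw_def)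

lemma sum_index_rank: "(\<Sum>i\<in>(UNIV :: 'k::{finite,linorder} set). f (index_rank i)) = (\<Sum>n<CARD('k). f n)"
  by (rule sum.reindex_bij_betw[OF bij_index_rank])

lemma prod_index_rank: "(\<Prod>i\<in>(UNIV :: 'k::{finite,linorder} set). f (index_rank i)) = (\<Prod>n<CARD('k). f n)"
  by (rule prod.reindex_bij_betw[OF bij_index_rank])

lemma poly_eq_sum_index_rank:
  fixes p :: "'a::comm_ring_1 poly"
  assumes "degree p < CARD('k::{finite,linorder})"
  shows "poly p x = (\<Sum>l\<in>(UNIV :: 'k set). x ^ index_rank l * coeff p (index_rank l))"
proof -
  have "poly p x = (\<Sum>n\<le>degree p. coeff p n * x ^ n)" by (rule poly_altdef)
  also have "\<dots> = (\<Sum>n<CARD('k). coeff p n * x ^ n)"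
    using assms by (intro sum.mono_neutral_left) (auto simp: coeff_eq_0)
  finally show ?thesis by (subst sum_index_rank) (simp add: mult.commute)
qed

lemma poly_pderiv_eq_sum_index_rank:
  fixes p :: "'a::{comm_ring_1,semiring_no_zero_divisors} poly"
  assumes "degree p < CARD('k::{finite,linorder})"
  shows "poly (pderiv p) x = (\<Sum>l\<in>(UNIV :: 'k set). of_nat (index_rank l) * x ^ (index_rank l - 1) * coeff p (index_rank l))"
proof -
  have atMost: "{..CARD('k) - 1} = {..<CARD('k)}"
    using zero_less_card_finite[where 'a='k] by (cases "CARD('k)") (auto simp: lessThan_Suc_atMost)
  have deg: "degree p \<le> CARD('k) - 1" using assms by linarith
  have "pderiv p = pderiv (\<Sum>n<CARD('k). monom (coeff p n) n)"
    using poly_as_sum_of_monoms'[OF deg] unfolding atMost by simp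
  also have "\<dots> = (\<Sum>n<CARD('k). monom (of_nat n * coeff p n) (n - 1))"
    using higher_pderiv_sum[of 1 "\<lambda>n. monom (coeff p n) n"] by (simp add: pderiv_monom)
  finally have "pderiv p = (\<Sum>n<CARD('k). monom (of_nat n * coeff p n) (n - 1))" .
  then show ?thesis
    by (subst sum_index_rank) (simp add: poly_sum poly_monom mult_ac)
qed

lemma scales_lborel_diagonal:
  fixes d :: "'k::{finite,linorder} \<Rightarrow> complex"
  assumes "\<And>i. d i \<noteq> 0"
  shows "scales_lborel ((*v) (\<chi> i j. if i = j then d i else 0)) (\<Prod>i\<in>UNIV. 1 / (cmod (d i))\<^sup>2)"
proof -
  let ?D = "\<chi> i j. if i = j then d i else 0"
  have "scales_lborel ((*v) ?D) (\<Prod>i\<in>UNIV. 1 / (cmod (?D $ i $ i))\<^sup>2)"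
    by (rule scales_lborel_triangular[where r = index_rank]) (auto simp: inj_index_rank assms)
  then show ?thesis by simp
qed

lemma scales_lborel_column_scaling:
  fixes A :: "((complex, 'k::{finite,linorder}) vec, 'k) vec"
  assumes "scales_lborel ((*v) A) c" "\<And>i. d i \<noteq> 0"
  shows "scales_lborel ((*v) (\<chi> i j. d j * A $ i $ j)) (c * (\<Prod>i\<in>UNIV. 1 / (cmod (d i))\<^sup>2))"
proof -
  have "A ** (\<chi> i j. if i = j then d i else 0) = (\<chi> i j. d j * A $ i $ j)"
    by (simp add: vec_eq_iff matrix_matrix_mult_def if_distrib cong: if_cong)
  then show ?thesis
    using scales_lborel_compose[OF assms(1) scales_lborel_diagonal[of d, OF assms(2)]] by (simp add: matrix_vector_mul_assoc)
qed

lemma scales_lborel_row_scaling: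
  fixes A :: "((complex, 'k::{finite,linorder}) vec, 'k) vec"
  assumes "scales_lborel ((*v) A) c" "\<And>i. d i \<noteq> 0"
  shows "scales_lborel ((*v) (\<chi> i j. d i * A $ i $ j)) ((\<Prod>i\<in>UNIV. 1 / (cmod (d i))\<^sup>2) * c)"
proof -
  have "(\<chi> i j. if i = j then d i else 0) ** A = (\<chi> i j. d i * A $ i $ j)"
    by (simp add: vec_eq_iff matrix_matrix_mult_def if_distrib if_distribR cong: if_cong)
  then show ?thesis
    using scales_lborel_compose[OF scales_lborel_diagonal[of d, OF assms(2)] assms(1)] by (simp add: matrix_vector_mul_assoc)
qed

section \<open>Vandermonde matrices and Hermite interpolation\<close>

text \<open>\<open>poly (map_poly cmod p) r\<close> is the weighted coefficient norm \<open>\<Sum>\<^sub>n \<bar>p\<^sub>n\<bar> r\<^sup>n\<close>. Dividing \<open>x\<^sup>n\<close> by \<open>x - c\<close> produces a geometric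
sum, so the norm of the quotient is at most that of the dividend times \<open>1/(r - \<bar>c\<bar>)\<close>. Including the remainder
\<open>p(c)\<close> makes Horner's recursion prove this by induction.\<close>

lemma poly_norm_synthetic_div:
  fixes c :: complex
  assumes "cmod c \<le> r"
  shows "cmod (poly p c) + (r - cmod c) * poly (map_poly cmod (synthetic_div p c)) r \<le> poly (map_poly cmod p) r"
proof (induction p)
  case 0
  then show ?case by simp
next
  case (pCons a p)
  let ?P = "cmod (poly p c)" and ?S = "poly (map_poly cmod (synthetic_div p c)) r"
  have r: "0 \<le> r" using assms norm_ge_zero order_trans by blast
  have "cmod (poly (pCons a p) c) + (r - cmod c) * poly (map_poly cmod (synthetic_div (pCons a p) c)) r
      \<le> (cmod a + cmod c * ?P) + (r - cmod c) * (?P + r * ?S)"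
    using norm_triangle_ineq[of a "c * poly p c"] by (simp add: map_poly_pCons norm_mult)
  also have "\<dots> = cmod a + r * (?P + (r - cmod c) * ?S)"
    by (simp add: algebra_simps)
  also have "\<dots> \<le> cmod a + r * poly (map_poly cmod p) r"
    using pCons r by (intro add_left_mono mult_left_mono)
  finally show ?case by (simp add: map_poly_pCons)
qed

lemma poly_map_norm_nonneg: "0 \<le> r \<Longrightarrow> 0 \<le> poly (map_poly cmod p) r"
  by (induction p) (auto simp: map_poly_pCons)

lemma degree_prod_roots: "degree (\<Prod>i\<in>I. [:- z i, 1:] :: complex poly) = card I"
  by (cases "finite I") (auto simp: degree_prod_eq_sum_degree)

lemma lead_coeff_prod_roots: "lead_coeff (\<Prod>i\<in>I. [:- z i, 1:] :: complex poly) = 1"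
  by (simp add: lead_coeff_prod)

text \<open>The gap \<open>r - \<bar>z i\<bar> \<ge> 1\<close> makes each division by a linear factor a contraction of the weighted coefficient norm, so
the bound does not deteriorate with the number of roots.\<close>

lemma division_by_roots_bound:
  fixes z :: "'i \<Rightarrow> complex"
  assumes "finite I" and "\<And>i. i \<in> I \<Longrightarrow> cmod (z i) + 1 \<le> r"
  shows "\<exists>Q R. p = (\<Prod>i\<in>I. [:- z i, 1:]) * Q + R \<and> (R = 0 \<or> degree R < card I) \<and>
           poly (map_poly cmod Q) r \<le> poly (map_poly cmod p) r"
  using assms
proof (induction I rule: finite_induct)
  case empty
  show ?case by (rule exI[of _ p], rule exI[of _ 0]) simp
next
  case (insert i I)
  let ?W = "\<Prod>i\<in>I. [:- z i, 1:]"
  from insert obtain Q R where QR: "p = ?W * Q + R" "R = 0 \<or> degree R < card I"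
    "poly (map_poly cmod Q) r \<le> poly (map_poly cmod p) r" by auto
  define S where "S = synthetic_div Q (z i)"
  have Q: "Q = [:- z i, 1:] * S + [:poly Q (z i):]"
    using synthetic_div_correct'[of "z i" Q] by (simp add: S_def)
  have r: "cmod (z i) + 1 \<le> r" using insert.prems by auto
  then have r0: "0 \<le> r" using norm_ge_zero[of "z i"] by linarith
  have "poly (map_poly cmod S) r \<le> (r - cmod (z i)) * poly (map_poly cmod S) r"
    using r mult_right_mono[of 1 "r - cmod (z i)" "poly (map_poly cmod S) r"] poly_map_norm_nonneg[OF r0, of S] by simp
  also have "\<dots> \<le> poly (map_poly cmod Q) r"
    using poly_norm_synthetic_div[of "z i" r Q] r norm_ge_zero[of "poly Q (z i)"] unfolding S_def by linarith
  finally have S: "poly (map_poly cmod S) r \<le> poly (map_poly cmod p) r" using QR(3) by linarith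
  have "p = (\<Prod>i\<in>insert i I. [:- z i, 1:]) * S + (smult (poly Q (z i)) ?W + R)"
    using insert by (subst QR(1), subst Q) (simp add: algebra_simps)
  moreover have "degree (smult (poly Q (z i)) ?W + R) < card (insert i I)"
  proof -
    have "degree (smult (poly Q (z i)) ?W) \<le> card I" using degree_smult_le degree_prod_roots by metis
    moreover have "degree R \<le> card I" using QR(2) by auto
    ultimately show ?thesis using insert degree_add_le[of "smult (poly Q (z i)) ?W" "card I" R] by auto
  qed
  ultimately show ?case using S by blast
qed

lemma norm_poly_le: "cmod c \<le> r \<Longrightarrow> cmod (poly p c) \<le> poly (map_poly cmod p) r"
  using poly_norm_synthetic_div[of c r p] poly_map_norm_nonneg[of r "synthetic_div p c"] norm_ge_zero[of c]
  by (smt (verit) mult_nonneg_nonneg)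

lemma quotient_monom_degree:
  fixes W :: "complex poly"
  assumes "monom 1 (k + m) = W * Q + R" "lead_coeff W = 1" "degree W = k" "R = 0 \<or> degree R < k"
  shows "degree Q = m" "lead_coeff Q = 1"
proof -
  have W0: "W \<noteq> 0" using assms(2) by auto
  have "Q \<noteq> 0"
  proof
    assume "Q = 0"
    then have R: "R = monom 1 (k + m)" using assms(1) by simp
    then have "degree R = k + m" "R \<noteq> 0" by (simp_all add: degree_monom_eq)
    with assms(4) show False by auto
  qed
  have d: "degree (W * Q) = k + degree Q" using W0 \<open>Q \<noteq> 0\<close> assms(3) by (simp add: degree_mult_eq)
  have eq: "degree (W * Q + R) = degree (W * Q) \<and> lead_coeff (W * Q + R) = lead_coeff (W * Q)"
  proof (cases "R = 0")
    case False
    with assms(4) d have "degree R < degree (W * Q)" by simp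
    then show ?thesis
      using degree_add_eq_left[of R "W * Q"] lead_coeff_add_le[of R "W * Q"] by (simp add: add.commute)
  qed simp
  have "degree (W * Q + R) = k + m" "lead_coeff (W * Q + R) = 1"
    unfolding assms(1)[symmetric] by (simp_all add: degree_monom_eq)
  then have "degree (W * Q) = k + m" "lead_coeff (W * Q) = 1" using eq by auto
  then show "degree Q = m" "lead_coeff Q = 1"
    using d assms(2) lead_coeff_mult[of W Q] by simp_all
qed

lemma quotient_monom_eq_0:
  fixes W :: "complex poly"
  assumes "monom 1 n = W * Q + R" "degree W = k" "W \<noteq> 0" "R = 0 \<or> degree R < k" "n < k"
  shows "Q = 0"
proof (rule ccontr)
  assume "Q \<noteq> 0"
  then have "k \<le> degree (W * Q)" using assms by (simp add: degree_mult_eq)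
  moreover have "W * Q = monom 1 n - R" using assms(1) by simp
  moreover have "degree (monom 1 n - R :: complex poly) < k"
    using assms(4,5) by (intro degree_diff_less) (auto simp: degree_monom_eq)
  ultimately show False by simp
qed

definition vandermonde :: "(complex, 'k::{finite,linorder}) vec \<Rightarrow> ((complex, 'k) vec, 'k) vec" where
  "vandermonde z = (\<chi> i j. (z $ i) ^ index_rank j)"

text \<open>Passing from the monomial basis to a monic basis is unit upper triangular and therefore preserves
volume.\<close>

lemma scales_lborel_monic_coeffs:
  fixes P :: "'k::{finite,linorder} \<Rightarrow> complex poly"
  assumes "\<And>j. degree (P j) = index_rank j" "\<And>j. lead_coeff (P j) = 1"
  shows "scales_lborel ((*v) (\<chi> l j. coeff (P j) (index_rank l))) 1"
proof -
  have d: "coeff (P j) (index_rank j) = 1" for j using assms(1,2)[of j] by simp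
  have "scales_lborel ((*v) (\<chi> l j. coeff (P j) (index_rank l)))
     (\<Prod>i\<in>UNIV. 1 / (cmod ((\<chi> l j. coeff (P j) (index_rank l)) $ i $ i))\<^sup>2)"
  proof (rule scales_lborel_triangular[where r = index_rank])
    show "inj (index_rank :: 'k \<Rightarrow> nat)" by (rule inj_index_rank)
    show "(\<chi> l j. coeff (P j) (index_rank l)) $ i $ j = 0" if "index_rank j < index_rank i" for i j
      using that assms(1)[of j] by (simp add: coeff_eq_0)
    show "(\<chi> l j. coeff (P j) (index_rank l)) $ i $ i \<noteq> 0" for i
      by (simp add: d)
  qed
  then show ?thesis by (simp add: d)
qed

lemma vandermonde_monic_factor:
  fixes P :: "'k::{finite,linorder} \<Rightarrow> complex poly" and z :: "(complex, 'k) vec"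
  assumes "\<And>j. degree (P j) = index_rank j"
  shows "(\<chi> i j. poly (P j) (z $ i)) = vandermonde z ** (\<chi> l j. coeff (P j) (index_rank l))"
  using poly_eq_sum_index_rank[where 'k='k, of "P _"] index_rank_less_card[where 'k='k] 
  by (simp add: vandermonde_def vec_eq_iff matrix_matrix_mult_def assms)

text \<open>In the Newton basis \<open>\<Prod>\<^bsub>i < j\<^esub> (x - z\<^sub>i)\<close> evaluation at the points is lower triangular with diagonal
\<open>\<Prod>\<^bsub>l < i\<^esub> (z\<^sub>i - z\<^sub>l)\<close>, and the change of basis preserves volume.\<close>

lemma scales_lborel_vandermonde:
  fixes z :: "(complex, 'k::{finite,linorder}) vec"
  assumes z: "inj (($) z)"
  shows "scales_lborel ((*v) (vandermonde z)) (1 / (\<Prod>(i, j)\<in>{(i, j). i < j}. (cmod (z $ i - z $ j))\<^sup>2))"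
proof -
  \<comment> \<open>The Newton basis.\<close>
  define P where "P j = (\<Prod>i\<in>{i. i < j}. [:- z $ i, 1:])" for j
  have P: "degree (P j) = index_rank j" "lead_coeff (P j) = 1" for j
    unfolding P_def index_rank_def by (rule degree_prod_roots, rule lead_coeff_prod_roots)
  let ?N = "\<chi> i j. poly (P j) (z $ i)" and ?U = "\<chi> l j. coeff (P j) (index_rank l)"
  have N: "poly (P j) (z $ i) = (\<Prod>l\<in>{l. l < j}. z $ i - z $ l)" for i j
    by (simp add: P_def poly_prod)
  have nz: "z $ i \<noteq> z $ j" if "i \<noteq> j" for i j using z that by (auto simp: inj_eq)
  have "scales_lborel ((*v) ?N) (\<Prod>i\<in>UNIV. 1 / (cmod (?N $ i $ i))\<^sup>2)"
  proof (rule scales_lborel_triangular[where r = "\<lambda>i. - int (index_rank i)"])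
    show "inj (\<lambda>i::'k. - int (index_rank i))" using inj_index_rank by (auto simp: inj_def)
    fix i j :: 'k assume "- int (index_rank j) < - int (index_rank i)"
    then have "i < j" by (simp add: index_rank_less_iff)
    then show "?N $ i $ j = 0" by (auto simp: N)
  qed (auto simp: N nz)
  also have "(\<Prod>i\<in>UNIV. 1 / (cmod (?N $ i $ i))\<^sup>2) = 1 / (\<Prod>(j, i)\<in>(SIGMA j:UNIV. {i. i < j}). (cmod (z $ j - z $ i))\<^sup>2)"
    by (simp add: N prod_dividef prod_norm[symmetric] prod_power_distrib prod.Sigma)
  also have "(\<Prod>(j, i)\<in>(SIGMA j:UNIV. {i. i < j}). (cmod (z $ j - z $ i))\<^sup>2) = (\<Prod>(i, j)\<in>{(i, j). i < j}. (cmod (z $ i - z $ j))\<^sup>2)"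
    by (rule prod.reindex_bij_witness[of _ "\<lambda>(i, j). (j, i)" "\<lambda>(i, j). (j, i)"]) (auto simp: norm_minus_commute)
  finally have "scales_lborel (\<lambda>x. vandermonde z *v (?U *v x)) (1 / (\<Prod>(i, j)\<in>{(i, j). i < j}. (cmod (z $ i - z $ j))\<^sup>2))"
    using vandermonde_monic_factor[of P z] P by (simp add: matrix_vector_mul_assoc)
  from scales_lborel_cancel[OF _ scales_lborel_monic_coeffs[OF P] this] show ?thesis by simp
qed

lemma pderiv_prod_roots:
  fixes z :: "complex ^ 'k::finite"
  shows "poly (pderiv (\<Prod>j\<in>UNIV. [:- z $ j, 1:])) (z $ i) = (\<Prod>j\<in>UNIV - {i}. z $ i - z $ j)"
proof -
  have "poly (pderiv (\<Prod>j\<in>UNIV. [:- z $ j, 1:])) (z $ i) = (\<Sum>a\<in>UNIV. \<Prod>j\<in>UNIV - {a}. z $ i - z $ j)"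
    by (simp add: pderiv_prod poly_sum poly_prod pderiv_pCons)
  also have "\<dots> = (\<Prod>j\<in>UNIV - {i}. z $ i - z $ j)"
  proof -
    have "(\<Prod>j\<in>UNIV - {a}. z $ i - z $ j) = 0" if "a \<noteq> i" for a
      using that by (intro prod_zero) auto
    then have "(\<Sum>a\<in>UNIV - {i}. \<Prod>j\<in>UNIV - {a}. z $ i - z $ j) = 0"
      by (intro sum.neutral) blast
    then show ?thesis by (simp add: sum.remove[of UNIV i])
  qed
  finally show ?thesis .
qed

text \<open>\<open>B\<close> differentiates interpolation polynomials of degree less than \<open>k\<close>, \<open>k = CARD('k)\<close>, at the nodes; it exists because the
Vandermonde matrix is invertible. If \<open>x\<^sup>n = \<Omega> Q\<^sub>n + R\<^sub>n\<close> with \<open>\<Omega> = \<Prod> (x - z\<^sub>j)\<close>, then \<open>R\<^sub>n\<close> agrees with \<open>x\<^sup>n\<close> at the nodes, and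
the derivative of \<open>\<Omega> Q\<^sub>n\<close> at \<open>z\<^sub>i\<close> is \<open>\<Omega>'(z\<^sub>i) Q\<^sub>n(z\<^sub>i) = w\<^sub>i Q\<^sub>n(z\<^sub>i)\<close>. This factor \<open>w\<^sub>i\<close> is what makes derivatives at
nearly coinciding zeros small. That \<open>Q\<^sub>k\<^sub>+\<^sub>m\<close> is monic of degree \<open>m\<close> makes the matrix
\<open>Q\<^sub>k\<^sub>+\<^sub>m(z\<^sub>i)\<close> a Vandermonde matrix up to a volume preserving factor.\<close>

lemma hermite_interpolation_remainder:
  fixes z :: "(complex, 'k::{finite,linorder}) vec"
  assumes z: "inj (($) z)" and r: "\<And>i. cmod (z $ i) + 1 \<le> r"
  defines "w \<equiv> \<lambda>i. \<Prod>j\<in>UNIV - {i}. z $ i - z $ j"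
  obtains B :: "((complex, 'k) vec, 'k) vec" and Q :: "nat \<Rightarrow> complex poly" where
    "\<And>n i. of_nat n * z $ i ^ (n - 1) = (\<Sum>j\<in>UNIV. B $ i $ j * z $ j ^ n) + w i * poly (Q n) (z $ i)"
    "\<And>n. n < CARD('k) \<Longrightarrow> Q n = 0"
    "\<And>m. degree (Q (CARD('k) + m)) = m" "\<And>m. lead_coeff (Q (CARD('k) + m)) = 1"
    "\<And>n i. cmod (poly (Q n) (z $ i)) \<le> r ^ n"
proof -
  define W where "W = (\<Prod>j\<in>(UNIV::'k set). [:- z $ j, 1:])"
  have W: "lead_coeff W = 1" "degree W = CARD('k)"
    unfolding W_def by (rule lead_coeff_prod_roots, rule degree_prod_roots)
  then have W0: "W \<noteq> 0" by auto
  have Wz: "poly W (z $ i) = 0" for i by (auto simp: W_def poly_prod)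
  obtain V' where V': "V' ** vandermonde z = mat 1"
    using scales_lborel_matrix_left_inverse[OF scales_lborel_vandermonde[OF z]] by blast
  \<comment> \<open>The derivatives of the monomials at the nodes, so that \<open>B\<close> maps values to derivatives.\<close>
  define D :: "((complex, 'k) vec, 'k) vec" where "D = (\<chi> i j. of_nat (index_rank j) * z $ i ^ (index_rank j - 1))"
  define B where "B = D ** V'"
  have BV: "B ** vandermonde z = D"
    by (simp add: B_def V' matrix_mul_assoc[symmetric])
  have interp: "poly (pderiv R) (z $ i) = (\<Sum>j\<in>UNIV. B $ i $ j * poly R (z $ j))" if "degree R < CARD('k)" for R i
  proof -
    define c where "c = (\<chi> l::'k. coeff R (index_rank l))"
    have "poly (pderiv R) (z $ i) = (D *v c) $ i"
      using that by (simp add: poly_pderiv_eq_sum_index_rank[where 'k='k] D_def c_def matrix_vector_mult_def)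
    also have "\<dots> = (B *v (vandermonde z *v c)) $ i"
      by (simp add: matrix_vector_mul_assoc BV)
    also have "vandermonde z *v c = (\<chi> j. poly R (z $ j))"
      using that by (simp add: poly_eq_sum_index_rank[where 'k='k] vandermonde_def c_def matrix_vector_mult_def)
    finally show ?thesis by (simp add: matrix_vector_mult_def)
  qed
  have "\<exists>Q R. monom 1 n = W * Q + R \<and> (R = 0 \<or> degree R < CARD('k)) \<and>
           poly (map_poly cmod Q) r \<le> poly (map_poly cmod (monom 1 n)) r" for n
    unfolding W_def using division_by_roots_bound[of UNIV "($) z" r "monom 1 n"] r by simp
  then obtain Q R where QR: "\<And>n. monom 1 n = W * Q n + R n" "\<And>n. R n = 0 \<or> degree (R n) < CARD('k)"
    "\<And>n. poly (map_poly cmod (Q n)) r \<le> poly (map_poly cmod (monom 1 n)) r" by metis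
  show thesis
  proof
    fix n i
    have R: "poly (R n) (z $ j) = z $ j ^ n" for j
      using arg_cong[OF QR(1)[of n], of "\<lambda>p. poly p (z $ j)"] by (simp add: poly_monom Wz)
    have "of_nat n * z $ i ^ (n - 1) = poly (pderiv (monom 1 n)) (z $ i)"
      by (simp add: pderiv_monom poly_monom)
    also have "\<dots> = poly (pderiv (W * Q n + R n)) (z $ i)" by (simp only: QR(1)[of n])
    also have "\<dots> = w i * poly (Q n) (z $ i) + poly (pderiv (R n)) (z $ i)"
      by (simp add: pderiv_add pderiv_mult Wz w_def pderiv_prod_roots[of z, folded W_def])
    also have "poly (pderiv (R n)) (z $ i) = (\<Sum>j\<in>UNIV. B $ i $ j * z $ j ^ n)"
      using QR(2)[of n] by (subst interp) (auto simp: R)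
    finally show "of_nat n * z $ i ^ (n - 1) = (\<Sum>j\<in>UNIV. B $ i $ j * z $ j ^ n) + w i * poly (Q n) (z $ i)"
      by simp
    have "cmod (z $ i) \<le> r" using r[of i] by simp
    then have "cmod (poly (Q n) (z $ i)) \<le> poly (map_poly cmod (Q n)) r" by (rule norm_poly_le)
    also have "\<dots> \<le> r ^ n" using QR(3)[of n] by (simp add: map_poly_monom poly_monom)
    finally show "cmod (poly (Q n) (z $ i)) \<le> r ^ n" .
  next
    fix n assume "n < CARD('k)"
    then show "Q n = 0" using quotient_monom_eq_0[OF QR(1) W(2) W0 QR(2)] by simp
  next
    fix m
    show "degree (Q (CARD('k) + m)) = m" "lead_coeff (Q (CARD('k) + m)) = 1"
      using quotient_monom_degree[OF QR(1) W QR(2), of m] by auto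
  qed
qed

section \<open>Densities of affine images of independent vectors\<close>

text \<open>Integrating out one of two independent blocks that enters only through a vector \<open>\<phi> (X \<omega>)\<close> with a density.
The blocks \<open>X\<close> and \<open>Y\<close> share a type, as \<open>indep_var\<close> demands; the functions \<open>\<phi>\<close> and \<open>\<psi>\<close> do not.\<close>

lemma (in prob_space) nn_integral_indep_density:
  fixes q :: "'c::euclidean_space \<Rightarrow> real"
  assumes ind: "indep_var S X T Y" and \<phi> [measurable]: "\<phi> \<in> borel_measurable S" and \<psi> [measurable]: "\<psi> \<in> measurable T N"
    and C: "distr M borel (\<lambda>\<omega>. \<phi> (X \<omega>)) = density lborel (\<lambda>c. ennreal (q c))"
    and [measurable]: "q \<in> borel_measurable borel" and F [measurable]: "F \<in> borel_measurable (borel \<Otimes>\<^sub>M N)"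
  shows "(\<integral>\<^sup>+\<omega>. F (\<phi> (X \<omega>), \<psi> (Y \<omega>)) \<partial>M) =
    (\<integral>\<^sup>+\<omega>. (\<integral>\<^sup>+c. ennreal (q c) * F (c, \<psi> (Y \<omega>)) \<partial>lborel) \<partial>M)"
proof -
  have [measurable]: "X \<in> measurable M S" "Y \<in> measurable M T"
    using indep_var_rv1[OF ind] indep_var_rv2[OF ind] by auto
  interpret Y: prob_space "distr M T Y" by (rule prob_space_distr) measurable
  interpret X: prob_space "distr M S X" by (rule prob_space_distr) measurable
  interpret P: pair_sigma_finite "distr M S X" "distr M T Y" ..
  have "(\<integral>\<^sup>+\<omega>. F (\<phi> (X \<omega>), \<psi> (Y \<omega>)) \<partial>M) = (\<integral>\<^sup>+x. F (\<phi> (fst x), \<psi> (snd x)) \<partial>distr M (S \<Otimes>\<^sub>M T) (\<lambda>\<omega>. (X \<omega>, Y \<omega>)))"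
    by (subst nn_integral_distr) auto
  also have "\<dots> = (\<integral>\<^sup>+x. F (\<phi> (fst x), \<psi> (snd x)) \<partial>(distr M S X \<Otimes>\<^sub>M distr M T Y))"
    using ind by (simp add: indep_var_distribution_eq)
  also have "\<dots> = (\<integral>\<^sup>+y. \<integral>\<^sup>+x. F (\<phi> x, \<psi> y) \<partial>distr M S X \<partial>distr M T Y)"
    by (subst P.nn_integral_snd[symmetric]) (auto cong: measurable_cong_sets)
  also have "\<dots> = (\<integral>\<^sup>+y. (\<integral>\<^sup>+c. ennreal (q c) * F (c, \<psi> y) \<partial>lborel) \<partial>distr M T Y)"
  proof (rule nn_integral_cong)
    fix y assume "y \<in> space (distr M T Y)"
    then have y: "\<psi> y \<in> space N" using measurable_space[OF \<psi>] by simp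
    have Fy [measurable]: "(\<lambda>c. F (c, \<psi> y)) \<in> borel_measurable borel"
      using y by (intro measurable_compose[OF _ F]) simp
    have "(\<integral>\<^sup>+x. F (\<phi> x, \<psi> y) \<partial>distr M S X) = (\<integral>\<^sup>+\<omega>. F (\<phi> (X \<omega>), \<psi> y) \<partial>M)"
      by (rule nn_integral_distr) (use measurable_compose[OF \<phi> Fy] in simp_all)
    also have "\<dots> = (\<integral>\<^sup>+c. F (c, \<psi> y) \<partial>distr M borel (\<lambda>\<omega>. \<phi> (X \<omega>)))"
      by (rule nn_integral_distr[symmetric]) auto
    also have "\<dots> = (\<integral>\<^sup>+c. ennreal (q c) * F (c, \<psi> y) \<partial>lborel)"
      unfolding C by (rule nn_integral_density) auto
    finally show "(\<integral>\<^sup>+x. F (\<phi> x, \<psi> y) \<partial>distr M S X) = (\<integral>\<^sup>+c. ennreal (q c) * F (c, \<psi> y) \<partial>lborel)" .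
  qed
  also have "\<dots> = (\<integral>\<^sup>+\<omega>. (\<integral>\<^sup>+c. ennreal (q c) * F (c, \<psi> (Y \<omega>)) \<partial>lborel) \<partial>M)"
    by (subst nn_integral_distr) (auto intro!: lborel.borel_measurable_nn_integral simp: case_prod_beta)
  finally show ?thesis .
qed

lemma (in prob_space) distr_vec_indep_density:
  fixes Z :: "'n::finite \<Rightarrow> 'a \<Rightarrow> 'b::euclidean_space" and q :: "'b \<Rightarrow> ennreal"
  assumes ind: "indep_vars (\<lambda>_. borel) Z UNIV"
    and Z: "\<And>i. distributed M lborel (Z i) q"
  shows "distr M borel (\<lambda>\<omega>. \<chi> i. Z i \<omega>) = density lborel (\<lambda>c. \<Prod>i\<in>UNIV. q (c $ i))"
proof -
  have q [measurable]: "q \<in> borel_measurable borel"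
    using distributed_borel_measurable[OF Z[of undefined]] by simp
  have rv [measurable]: "Z i \<in> borel_measurable M" for i
    using distributed_measurable[OF Z[of i]] by simp
  have Zd: "distr M borel (Z i) = density lborel q" for i
    using distributed_distr_eq_density[OF Z[of i]] by (simp cong: distr_cong)
  interpret L: product_sigma_finite "\<lambda>_::'n. lborel :: 'b measure" ..
  interpret D: prob_space "density lborel q"
    unfolding Zd[of undefined, symmetric] by (rule prob_space_distr) measurable
  interpret D: product_sigma_finite "\<lambda>_::'n. density lborel q" ..
  have [measurable]: "vec_lambda \<in> borel_measurable (\<Pi>\<^sub>M i\<in>(UNIV::'n set). borel :: 'b measure)" by measurable
  have [measurable]: "vec_lambda \<in> borel_measurable (\<Pi>\<^sub>M i\<in>(UNIV::'n set). lborel :: 'b measure)" by measurable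
  have [simp]: "sets (\<Pi>\<^sub>M i\<in>(UNIV::'n set). borel) = sets (\<Pi>\<^sub>M i\<in>UNIV. density lborel q)"
    by (intro sets_PiM_cong) auto
  have restr: "(\<lambda>\<omega>. \<lambda>i\<in>UNIV. Z i \<omega>) \<in> measurable M (\<Pi>\<^sub>M i\<in>UNIV. borel)"
    by (rule measurable_restrict) auto
  have prod: "density (\<Pi>\<^sub>M i\<in>(UNIV::'n set). lborel) (\<lambda>x. \<Prod>i\<in>UNIV. q (x i)) = (\<Pi>\<^sub>M i\<in>UNIV. density lborel q)"
  proof (rule D.PiM_eqI)
    fix A :: "'n \<Rightarrow> 'b set" assume A: "\<And>i. i \<in> UNIV \<Longrightarrow> A i \<in> sets (density lborel q)"
    then have [measurable]: "A i \<in> sets borel" for i by simp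
    have "emeasure (density (\<Pi>\<^sub>M i\<in>(UNIV::'n set). lborel) (\<lambda>x. \<Prod>i\<in>UNIV. q (x i))) (Pi\<^sub>E UNIV A)
       = (\<integral>\<^sup>+x. (\<Prod>i\<in>UNIV. q (x i)) * indicator (Pi\<^sub>E UNIV A) x \<partial>(\<Pi>\<^sub>M i\<in>(UNIV::'n set). lborel))"
      by (subst emeasure_density) auto
    also have "\<dots> = (\<integral>\<^sup>+x. (\<Prod>i\<in>UNIV. q (x i) * indicator (A i) (x i)) \<partial>(\<Pi>\<^sub>M i\<in>(UNIV::'n set). lborel))"
      by (intro nn_integral_cong) (auto simp: prod.distrib indicator_def PiE_def Pi_def)
    also have "\<dots> = (\<Prod>i\<in>UNIV. \<integral>\<^sup>+x. q x * indicator (A i) x \<partial>lborel)"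
      by (subst L.product_nn_integral_prod) auto
    also have "\<dots> = (\<Prod>i\<in>UNIV. emeasure (density lborel q) (A i))"
      by (simp add: emeasure_density)
    finally show "emeasure (density (\<Pi>\<^sub>M i\<in>(UNIV::'n set). lborel) (\<lambda>x. \<Prod>i\<in>UNIV. q (x i))) (Pi\<^sub>E UNIV A)
      = (\<Prod>i\<in>UNIV. emeasure (density lborel q) (A i))" .
  qed (auto intro!: sets_PiM_cong)
  have "distr M borel (\<lambda>\<omega>. \<chi> i. Z i \<omega>) = distr (distr M (\<Pi>\<^sub>M i\<in>UNIV. borel) (\<lambda>\<omega>. \<lambda>i\<in>UNIV. Z i \<omega>)) borel vec_lambda"
    using restr by (subst distr_distr) (auto simp: comp_def restrict_UNIV)
  also have "\<dots> = distr (\<Pi>\<^sub>M i\<in>UNIV. density lborel q) borel vec_lambda"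
    using indep_vars_iff_distr_eq_PiM'[of UNIV Z "\<lambda>_. borel"] ind by (simp add: Zd)
  also have "\<dots> = density (distr (\<Pi>\<^sub>M i\<in>(UNIV::'n set). lborel) borel vec_lambda) (\<lambda>c. \<Prod>i\<in>UNIV. q (c $ i))"
    unfolding prod[symmetric] by (subst density_distr) auto
  finally show ?thesis unfolding lborel_vec .
qed

lemma (in prob_space) indep_vars_compose_inj:
  assumes X: "indep_vars (\<lambda>_. N) X UNIV" and r: "inj r"
  shows "indep_vars (\<lambda>_. N) (\<lambda>i. X (r i)) UNIV"
  unfolding indep_vars_def2
proof safe
  have rv: "X i \<in> measurable M N" for i using X by (auto simp: indep_vars_def2)
  then show "X (r i) \<in> measurable M N" for i .
  show "indep_sets (\<lambda>i. {X (r i) -` A \<inter> space M |A. A \<in> sets N}) UNIV"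
  proof (rule indep_setsI)
    show "{X (r i) -` A \<inter> space M |A. A \<in> sets N} \<subseteq> events" for i
      using measurable_sets[OF rv[of "r i"]] by auto
    fix A J assume J: "J \<noteq> {}" "J \<subseteq> UNIV" "finite J" and A: "\<forall>j\<in>J. A j \<in> {X (r j) -` A \<inter> space M |A. A \<in> sets N}"
    have [simp]: "inv r (r j) = j" for j using r by simp
    have "prob (\<Inter>i\<in>r ` J. A (inv r i)) = (\<Prod>i\<in>r ` J. prob (A (inv r i)))"
      using X J A by (intro indep_setsD[of "\<lambda>i. {X i -` A \<inter> space M |A. A \<in> sets N}" UNIV]) (auto simp: indep_vars_def2)
    then show "prob (\<Inter>j\<in>J. A j) = (\<Prod>j\<in>J. prob (A j))"
      using r by (simp add: prod.reindex inj_on_def)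
  qed
qed

lemma continuous_on_integral_bounded:
  fixes f :: "'a \<Rightarrow> 'b::metric_space \<Rightarrow> real"
  assumes "finite_measure M" and meas: "\<And>x. (\<lambda>\<omega>. f \<omega> x) \<in> borel_measurable M"
    and cont: "\<And>\<omega>. continuous_on UNIV (f \<omega>)" and bound: "\<And>\<omega> x. \<bar>f \<omega> x\<bar> \<le> c"
  shows "continuous_on UNIV (\<lambda>x. \<integral>\<omega>. f \<omega> x \<partial>M)"
  unfolding continuous_on_sequentially comp_def
proof safe
  interpret finite_measure M by fact
  fix x :: "nat \<Rightarrow> 'b" and a assume x: "x \<longlonglongrightarrow> a"
  show "(\<lambda>n. \<integral>\<omega>. f \<omega> (x n) \<partial>M) \<longlonglongrightarrow> (\<integral>\<omega>. f \<omega> a \<partial>M)"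
  proof (rule integral_dominated_convergence[where w = "\<lambda>_. c"])
    show "AE \<omega> in M. (\<lambda>n. f \<omega> (x n)) \<longlonglongrightarrow> f \<omega> a"
      using cont x by (auto simp: continuous_on_sequentially comp_def)
  qed (auto simp: meas bound)
qed

text \<open>The kernel of the Kac--Rice estimate. Conditionally on \<open>C2\<close>, \<open>Rv\<close> and \<open>Rg\<close>, the vector \<open>Xv\<close> is an affine image of \<open>C1\<close>; conditionally on \<open>Xv\<close>,
\<open>Rv\<close> and \<open>Rg\<close>, the substitution from \<open>C2\<close> to \<open>Xd\<close> is affine too. Substituting in both integrals and averaging over
\<open>(Rv, Rg)\<close> gives a density \<open>p\<close> that is an average of bounded continuous functions, hence continuous. In the last
conclusion the density of \<open>C1\<close> is bounded by \<open>m\<close>, which leaves \<open>J1\<close> as the only Jacobian: on the slice \<open>Xv = 0\<close> the substitution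
from \<open>\<eta>\<close> back to \<open>C2\<close> cancels \<open>J2\<close>.\<close>

lemma (in prob_space) affine_density:
  fixes C1 C2 Rv Rg :: "'a \<Rightarrow> 'b::euclidean_space" and q :: "'b \<Rightarrow> real"
    and T1 T1' T2 T2' N B :: "'b \<Rightarrow> 'b"
  assumes joint: "\<And>F. F \<in> borel_measurable borel \<Longrightarrow>
      (\<integral>\<^sup>+\<omega>. F ((C1 \<omega>, C2 \<omega>), (Rv \<omega>, Rg \<omega>)) \<partial>M) =
      (\<integral>\<^sup>+\<omega>. (\<integral>\<^sup>+c2. (\<integral>\<^sup>+c1. ennreal (q c2) * (ennreal (q c1) * F ((c1, c2), (Rv \<omega>, Rg \<omega>))) \<partial>lborel) \<partial>lborel) \<partial>M)"
    and joint2: "\<And>F. F \<in> borel_measurable borel \<Longrightarrow>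
      (\<integral>\<^sup>+\<omega>. F (C2 \<omega>, Rg \<omega>) \<partial>M) =
      (\<integral>\<^sup>+\<omega>. (\<integral>\<^sup>+c2. ennreal (q c2) * F (c2, Rg \<omega>) \<partial>lborel) \<partial>M)"
    and C [measurable]: "C1 \<in> borel_measurable M" "C2 \<in> borel_measurable M"
    and R [measurable]: "Rv \<in> borel_measurable M" "Rg \<in> borel_measurable M"
    and T: "scales_lborel T1 J1" "scales_lborel T2 J2"
    and inverse: "\<And>x. T1' (T1 x) = x" "\<And>x. T2' (T2 x) = x"
    and cont: "continuous_on UNIV T1'" "continuous_on UNIV T2'" "continuous_on UNIV N" "continuous_on UNIV B"
      "continuous_on UNIV q"
    and B0: "B 0 = 0" and q: "\<And>c. 0 \<le> q c" "\<And>c. q c \<le> m"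
  defines "Xv \<equiv> \<lambda>\<omega>. T1 (C1 \<omega>) + N (C2 \<omega>) + Rv \<omega>"
  defines "Xd \<equiv> \<lambda>\<omega>. B (Xv \<omega>) + (T2 (C2 \<omega>) + Rg \<omega>)"
  obtains p where "continuous_on UNIV p" "\<And>x. 0 \<le> p x"
    "distr M borel (\<lambda>\<omega>. (Xv \<omega>, Xd \<omega>)) = density lborel (\<lambda>x. ennreal (p x))"
    "\<And>\<phi>. \<phi> \<in> borel_measurable borel \<Longrightarrow>
      (\<integral>\<^sup>+\<eta>. \<phi> \<eta> * ennreal (p (0, \<eta>)) \<partial>lborel) \<le> ennreal (J1 * m) * (\<integral>\<^sup>+\<omega>. \<phi> (T2 (C2 \<omega>) + Rg \<omega>) \<partial>M)"
proof -
  note [measurable] = borel_measurable_continuous_onI[OF cont(1)] borel_measurable_continuous_onI[OF cont(2)]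
    borel_measurable_continuous_onI[OF cont(3)] borel_measurable_continuous_onI[OF cont(4)]
    borel_measurable_continuous_onI[OF cont(5)] scales_lborelD(1)[OF T(1)] scales_lborelD(1)[OF T(2)]
  have J: "0 < J1" "0 < J2" using T by (auto simp: scales_lborel_def)
  have m: "0 \<le> m" using q[of undefined] by linarith
  \<comment> \<open>The joint density given \<open>Rv\<close> and \<open>Rg\<close>, obtained by solving for \<open>C2\<close> and then for \<open>C1\<close>.\<close>
  define K where "K \<omega> x = J1 * J2 * (q (T2' (snd x - B (fst x) - Rg \<omega>)) *
     q (T1' (fst x - (N (T2' (snd x - B (fst x) - Rg \<omega>)) + Rv \<omega>))))" for \<omega> x
  define p where "p x = (\<integral>\<omega>. K \<omega> x \<partial>M)" for x
  have [measurable]: "case_prod K \<in> borel_measurable (M \<Otimes>\<^sub>M borel)"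
    unfolding K_def case_prod_beta borel_prod[symmetric] by measurable
  have K0: "0 \<le> K \<omega> x" for \<omega> x using J q by (simp add: K_def)
  have Kb: "K \<omega> x \<le> J1 * J2 * (m * m)" for \<omega> x
    unfolding K_def using J q m by (intro mult_left_mono mult_mono) auto
  have Kc: "continuous_on UNIV (K \<omega>)" for \<omega>
    unfolding K_def
    by (intro continuous_intros continuous_on_compose2[OF cont(1)] continuous_on_compose2[OF cont(2)]
        continuous_on_compose2[OF cont(3)] continuous_on_compose2[OF cont(4)] continuous_on_compose2[OF cont(5)]) auto
  have Ki: "integrable M (\<lambda>\<omega>. K \<omega> x)" for x
    by (rule integrable_const_bound[where B="J1 * J2 * (m * m)"]) (use K0 Kb in auto)
  have pK: "ennreal (p x) = (\<integral>\<^sup>+\<omega>. ennreal (K \<omega> x) \<partial>M)" for x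
    unfolding p_def using Ki K0 by (intro nn_integral_eq_integral[symmetric]) auto
  have p1: "continuous_on UNIV p" unfolding p_def
    by (rule continuous_on_integral_bounded[where c="J1 * J2 * (m * m)"])
      (use K0 Kb Kc in \<open>auto intro: finite_measure_axioms\<close>)
  have p2: "0 \<le> p x" for x using K0 by (simp add: p_def)
  note [measurable] = borel_measurable_continuous_onI[OF p1]
  have [measurable]: "Xv \<in> borel_measurable M" "Xd \<in> borel_measurable M"
    unfolding Xv_def Xd_def by measurable
  have shift: "ennreal J2 * (\<integral>\<^sup>+u. g (u - s) \<partial>lborel) = (\<integral>\<^sup>+x. g (T2 x) \<partial>lborel)"
    if [measurable]: "g \<in> borel_measurable borel" for g s
    using nn_integral_lborel_translate[of g "- s"] scales_lborelD(3)[OF T(2), of g] by simp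
  have shift1: "(\<integral>\<^sup>+x. g (T1 x) \<partial>lborel) = ennreal J1 * (\<integral>\<^sup>+u. g (u - s) \<partial>lborel)"
    if [measurable]: "g \<in> borel_measurable borel" for g s
    using nn_integral_lborel_translate[of g "- s"] scales_lborelD(3)[OF T(1), of g] by simp
  have p3: "(\<integral>\<^sup>+\<omega>. F (Xv \<omega>, Xd \<omega>) \<partial>M) = (\<integral>\<^sup>+x. ennreal (p x) * F x \<partial>lborel)"
    if F [measurable]: "F \<in> borel_measurable borel" for F
  proof -
    have "(\<integral>\<^sup>+\<omega>. F (Xv \<omega>, Xd \<omega>) \<partial>M) =
      (\<integral>\<^sup>+\<omega>. (\<integral>\<^sup>+c2. (\<integral>\<^sup>+c1. ennreal (q c2) * (ennreal (q c1) *
          F (T1 c1 + N c2 + Rv \<omega>, B (T1 c1 + N c2 + Rv \<omega>) + (T2 c2 + Rg \<omega>))) \<partial>lborel) \<partial>lborel) \<partial>M)"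
    proof -
      have "(\<lambda>x. F (T1 (fst (fst x)) + N (snd (fst x)) + fst (snd x),
        B (T1 (fst (fst x)) + N (snd (fst x)) + fst (snd x)) + (T2 (snd (fst x)) + snd (snd x)))) \<in> borel_measurable borel"
        unfolding borel_prod[symmetric] by measurable
      from joint[OF this] show ?thesis by (simp add: Xv_def Xd_def)
    qed
    also have "\<dots> = (\<integral>\<^sup>+\<omega>. (\<integral>\<^sup>+c2. (\<integral>\<^sup>+v. ennreal J1 * (ennreal (q c2) * (ennreal (q (T1' (v - (N c2 + Rv \<omega>)))) *
          F (v, B v + (T2 c2 + Rg \<omega>)))) \<partial>lborel) \<partial>lborel) \<partial>M)"
    proof (rule nn_integral_cong, rule nn_integral_cong)
      fix \<omega> c2
      show "(\<integral>\<^sup>+c1. ennreal (q c2) * (ennreal (q c1) *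
          F (T1 c1 + N c2 + Rv \<omega>, B (T1 c1 + N c2 + Rv \<omega>) + (T2 c2 + Rg \<omega>))) \<partial>lborel)
       = (\<integral>\<^sup>+v. ennreal J1 * (ennreal (q c2) * (ennreal (q (T1' (v - (N c2 + Rv \<omega>)))) *
          F (v, B v + (T2 c2 + Rg \<omega>)))) \<partial>lborel)"
        using shift1[of "\<lambda>u. ennreal (q c2) * (ennreal (q (T1' u)) *
          F (u + (N c2 + Rv \<omega>), B (u + (N c2 + Rv \<omega>)) + (T2 c2 + Rg \<omega>)))" "N c2 + Rv \<omega>"]
        by (simp add: inverse nn_integral_cmult add.assoc)
    qed
    also have "\<dots> = (\<integral>\<^sup>+\<omega>. (\<integral>\<^sup>+v. (\<integral>\<^sup>+c2. ennreal J1 * (ennreal (q c2) * (ennreal (q (T1' (v - (N c2 + Rv \<omega>)))) *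
          F (v, B v + (T2 c2 + Rg \<omega>)))) \<partial>lborel) \<partial>lborel) \<partial>M)"
      by (rule nn_integral_cong, rule lborel_pair.Fubini') (auto simp: case_prod_beta)
    also have "\<dots> = (\<integral>\<^sup>+\<omega>. (\<integral>\<^sup>+v. (\<integral>\<^sup>+\<eta>. ennreal (K \<omega> (v, \<eta>)) * F (v, \<eta>) \<partial>lborel) \<partial>lborel) \<partial>M)"
    proof (rule nn_integral_cong, rule nn_integral_cong)
      fix \<omega> v
      show "(\<integral>\<^sup>+c2. ennreal J1 * (ennreal (q c2) * (ennreal (q (T1' (v - (N c2 + Rv \<omega>)))) *
          F (v, B v + (T2 c2 + Rg \<omega>)))) \<partial>lborel) = (\<integral>\<^sup>+\<eta>. ennreal (K \<omega> (v, \<eta>)) * F (v, \<eta>) \<partial>lborel)"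
        using shift[of "\<lambda>u. ennreal J1 * (ennreal (q (T2' u)) * (ennreal (q (T1' (v - (N (T2' u) + Rv \<omega>)))) *
          F (v, B v + (u + Rg \<omega>))))" "B v + Rg \<omega>"] J q
        by (simp add: inverse nn_integral_cmult[symmetric] K_def ennreal_mult mult_ac diff_diff_eq algebra_simps)
    qed
    also have "\<dots> = (\<integral>\<^sup>+\<omega>. (\<integral>\<^sup>+x. ennreal (K \<omega> x) * F x \<partial>lborel) \<partial>M)"
      unfolding lborel_prod[symmetric] 
      by (rule nn_integral_cong, rule lborel.nn_integral_fst)
        (auto simp: lborel_prod intro!: borel_measurable_continuous_onI[OF Kc])
    also have "\<dots> = (\<integral>\<^sup>+x. (\<integral>\<^sup>+\<omega>. ennreal (K \<omega> x) * F x \<partial>M) \<partial>lborel)"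
    proof -
      interpret pair_sigma_finite M "lborel :: ('b \<times> 'b) measure" ..
      show ?thesis by (rule Fubini'[symmetric]) (auto simp: case_prod_beta)
    qed
    also have "\<dots> = (\<integral>\<^sup>+x. ennreal (p x) * F x \<partial>lborel)"
      by (simp add: pK nn_integral_multc)
    finally show ?thesis .
  qed
  have p4: "distr M borel (\<lambda>\<omega>. (Xv \<omega>, Xd \<omega>)) = density lborel (\<lambda>x. ennreal (p x))"
  proof (rule measure_eqI)
    fix A assume A: "A \<in> sets (distr M borel (\<lambda>\<omega>. (Xv \<omega>, Xd \<omega>)))"
    then have [measurable]: "A \<in> sets borel" by simp
    have "emeasure (distr M borel (\<lambda>\<omega>. (Xv \<omega>, Xd \<omega>))) A = (\<integral>\<^sup>+x. indicator A x \<partial>distr M borel (\<lambda>\<omega>. (Xv \<omega>, Xd \<omega>)))"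
      by simp
    also have "\<dots> = (\<integral>\<^sup>+\<omega>. indicator A (Xv \<omega>, Xd \<omega>) \<partial>M)"
      by (rule nn_integral_distr) auto
    finally show "emeasure (distr M borel (\<lambda>\<omega>. (Xv \<omega>, Xd \<omega>))) A = emeasure (density lborel (\<lambda>x. ennreal (p x))) A"
      by (simp add: p3 emeasure_density)
  qed simp
  have p5: "(\<integral>\<^sup>+\<eta>. \<phi> \<eta> * ennreal (p (0, \<eta>)) \<partial>lborel) \<le> ennreal (J1 * m) * (\<integral>\<^sup>+\<omega>. \<phi> (T2 (C2 \<omega>) + Rg \<omega>) \<partial>M)"
    if [measurable]: "\<phi> \<in> borel_measurable borel" for \<phi>
  proof -
    let ?g = "\<lambda>\<omega> u. ennreal (q (T2' u)) * \<phi> (u + Rg \<omega>)"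
    have "(\<integral>\<^sup>+\<eta>. \<phi> \<eta> * ennreal (p (0, \<eta>)) \<partial>lborel) = (\<integral>\<^sup>+\<eta>. (\<integral>\<^sup>+\<omega>. \<phi> \<eta> * ennreal (K \<omega> (0, \<eta>)) \<partial>M) \<partial>lborel)"
      by (simp add: pK nn_integral_cmult)
    also have "\<dots> = (\<integral>\<^sup>+\<omega>. (\<integral>\<^sup>+\<eta>. \<phi> \<eta> * ennreal (K \<omega> (0, \<eta>)) \<partial>lborel) \<partial>M)"
    proof -
      interpret pair_sigma_finite M "lborel :: 'b measure" ..
      show ?thesis by (rule Fubini') (auto simp: case_prod_beta)
    qed
    also have "\<dots> \<le> (\<integral>\<^sup>+\<omega>. (\<integral>\<^sup>+\<eta>. ennreal (J1 * m) * (ennreal J2 * (ennreal (q (T2' (\<eta> - Rg \<omega>))) * \<phi> \<eta>)) \<partial>lborel) \<partial>M)"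
    proof (intro nn_integral_mono)
      fix \<omega> \<eta>
      have "K \<omega> (0, \<eta>) \<le> J1 * m * (J2 * q (T2' (\<eta> - Rg \<omega>)))"
      proof -
        let ?a = "q (T2' (\<eta> - Rg \<omega>))" and ?b = "q (T1' (0 - (N (T2' (\<eta> - Rg \<omega>)) + Rv \<omega>)))"
        have "J1 * J2 * (?a * ?b) \<le> J1 * J2 * (?a * m)"
          using J q by (intro mult_left_mono) auto
        then show ?thesis by (simp add: K_def B0 mult_ac)
      qed
      then have "ennreal (K \<omega> (0, \<eta>)) \<le> ennreal (J1 * m) * (ennreal J2 * ennreal (q (T2' (\<eta> - Rg \<omega>))))"
        using J q m by (simp add: ennreal_mult[symmetric])
      from mult_right_mono[OF this, of "\<phi> \<eta>"]
      show "\<phi> \<eta> * ennreal (K \<omega> (0, \<eta>)) \<le> ennreal (J1 * m) * (ennreal J2 * (ennreal (q (T2' (\<eta> - Rg \<omega>))) * \<phi> \<eta>))"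
        by (simp add: mult_ac)
    qed
    also have "\<dots> = (\<integral>\<^sup>+\<omega>. ennreal (J1 * m) * (\<integral>\<^sup>+c2. ennreal (q c2) * \<phi> ((T2 c2 + Rg \<omega>)) \<partial>lborel) \<partial>M)"
    proof (rule nn_integral_cong)
      fix \<omega>
      show "(\<integral>\<^sup>+\<eta>. ennreal (J1 * m) * (ennreal J2 * (ennreal (q (T2' (\<eta> - Rg \<omega>))) * \<phi> \<eta>)) \<partial>lborel)
        = ennreal (J1 * m) * (\<integral>\<^sup>+c2. ennreal (q c2) * \<phi> ((T2 c2 + Rg \<omega>)) \<partial>lborel)"
        using shift[of "?g \<omega>" "Rg \<omega>"]
        by (simp add: inverse nn_integral_cmult diff_diff_eq)
    qed
    also have "\<dots> = ennreal (J1 * m) * (\<integral>\<^sup>+\<omega>. (\<integral>\<^sup>+c2. ennreal (q c2) * \<phi> ((T2 c2 + Rg \<omega>)) \<partial>lborel) \<partial>M)"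
      by (intro nn_integral_cmult lborel.borel_measurable_nn_integral) (auto simp: case_prod_beta)
    also have "(\<integral>\<^sup>+\<omega>. (\<integral>\<^sup>+c2. ennreal (q c2) * \<phi> ((T2 c2 + Rg \<omega>)) \<partial>lborel) \<partial>M) = (\<integral>\<^sup>+\<omega>. \<phi> ((T2 (C2 \<omega>) + Rg \<omega>)) \<partial>M)"
    proof -
      have "(\<lambda>x. \<phi> (T2 (fst x) + snd x)) \<in> borel_measurable borel"
        unfolding borel_prod[symmetric] by measurable
      from joint2[OF this] show ?thesis by simp
    qed
    finally show ?thesis .
  qed
  from that[OF p1 p2 p4 p5] show thesis .
qed

text \<open>If \<open>x \<noteq> 0\<close> is in the kernel of the covariance matrix, then the linear functional given by \<open>x\<close> has variance \<open>0\<close>, so the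
vector lies almost surely in a hyperplane. A hyperplane is a null set, which contradicts the density.\<close>

lemma (in prob_space) covariance_matrix_invertible:
  fixes X :: "'a \<Rightarrow> (complex, 'n::finite) vec"
  assumes X: "distributed M lborel X p"
    and sq: "\<And>i. integrable M (\<lambda>\<omega>. (cmod (X \<omega> $ i))\<^sup>2)"
  shows "invertible (covariance_matrix M X)"
proof -
  have Xm [measurable]: "X \<in> borel_measurable M" using distributed_measurable[OF X] by simp
  have [measurable]: "cnj \<in> borel_measurable borel"
    by (intro borel_measurable_continuous_onI continuous_intros)
  have int: "integrable M (\<lambda>\<omega>. X \<omega> $ i)" for i
  proof (rule Bochner_Integration.integrable_bound[where f = "\<lambda>\<omega>. 1 + (cmod (X \<omega> $ i))\<^sup>2"])
    have "x \<le> 1 + x\<^sup>2" for x :: real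
      using zero_le_power2[of "x - 1 / 2"] unfolding power2_diff by (simp add: power2_eq_square)
    then show "AE \<omega> in M. norm (X \<omega> $ i) \<le> norm (1 + (cmod (X \<omega> $ i))\<^sup>2)" by auto
  qed (use sq in auto)
  define e where "e i = (\<integral>\<omega>. X \<omega> $ i \<partial>M)" for i
  define Y where "Y i \<omega> = X \<omega> $ i - e i" for i \<omega>
  have [measurable]: "Y i \<in> borel_measurable M" for i unfolding Y_def by measurable
  have Ysq: "integrable M (\<lambda>\<omega>. (cmod (Y i \<omega>))\<^sup>2)" for i
  proof (rule Bochner_Integration.integrable_bound[where f = "\<lambda>\<omega>. 2 * (cmod (X \<omega> $ i))\<^sup>2 + 2 * (cmod (e i))\<^sup>2"])
    have "(cmod (Y i \<omega>))\<^sup>2 \<le> 2 * (cmod (X \<omega> $ i))\<^sup>2 + 2 * (cmod (e i))\<^sup>2" for \<omega>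
    proof -
      have "(cmod (Y i \<omega>))\<^sup>2 \<le> (cmod (X \<omega> $ i) + cmod (e i))\<^sup>2"
        unfolding Y_def by (intro power_mono norm_triangle_ineq4) auto
      also have "\<dots> \<le> 2 * (cmod (X \<omega> $ i))\<^sup>2 + 2 * (cmod (e i))\<^sup>2"
        using zero_le_power2[of "cmod (X \<omega> $ i) - cmod (e i)"] by (simp add: power2_sum power2_diff)
      finally show ?thesis .
    qed
    then show "AE \<omega> in M. norm ((cmod (Y i \<omega>))\<^sup>2) \<le> norm (2 * (cmod (X \<omega> $ i))\<^sup>2 + 2 * (cmod (e i))\<^sup>2)"
      by auto
  qed (use sq in auto)
  have YY: "integrable M (\<lambda>\<omega>. Y i \<omega> * cnj (Y j \<omega>))" for i j
  proof (rule Bochner_Integration.integrable_bound[where f = "\<lambda>\<omega>. (cmod (Y i \<omega>))\<^sup>2 + (cmod (Y j \<omega>))\<^sup>2"])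
    have "x * y \<le> x\<^sup>2 + y\<^sup>2" if "0 \<le> x" "0 \<le> y" for x y :: real
      using zero_le_power2[of "x - y"] mult_nonneg_nonneg[OF that] unfolding power2_diff by linarith
    then have "cmod (Y i \<omega> * cnj (Y j \<omega>)) \<le> (cmod (Y i \<omega>))\<^sup>2 + (cmod (Y j \<omega>))\<^sup>2" for \<omega>
      by (simp add: norm_mult)
    then show "AE \<omega> in M. norm (Y i \<omega> * cnj (Y j \<omega>)) \<le> norm ((cmod (Y i \<omega>))\<^sup>2 + (cmod (Y j \<omega>))\<^sup>2)"
      by auto
  qed (use Ysq in auto)
  let ?A = "covariance_matrix M X"
  have A: "?A $ i $ j = (\<integral>\<omega>. Y i \<omega> * cnj (Y j \<omega>) \<partial>M)" for i j
    by (simp add: covariance_matrix_def Y_def e_def)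
  have "x = 0" if Ax: "?A *v x = 0" for x
  proof (rule ccontr)
    assume "x \<noteq> 0"
    define L where "L \<omega> = (\<Sum>i\<in>UNIV. cnj (x $ i) * Y i \<omega>)" for \<omega>
    have [measurable]: "L \<in> borel_measurable M" unfolding L_def by measurable
    have LL: "complex_of_real ((cmod (L \<omega>))\<^sup>2) = (\<Sum>i\<in>UNIV. \<Sum>j\<in>UNIV. cnj (x $ i) * (Y i \<omega> * cnj (Y j \<omega>)) * x $ j)" for \<omega>
      unfolding complex_norm_square L_def cnj_sum sum_product by (simp add: mult_ac)
    have "(\<integral>\<omega>. complex_of_real ((cmod (L \<omega>))\<^sup>2) \<partial>M) = (\<Sum>i\<in>UNIV. \<Sum>j\<in>UNIV. cnj (x $ i) * ?A $ i $ j * x $ j)"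
      unfolding LL A using YY
      by (subst Bochner_Integration.integral_sum; (intro Bochner_Integration.integrable_sum)?; simp?)
    also have "\<dots> = (\<Sum>i\<in>UNIV. cnj (x $ i) * (?A *v x) $ i)"
      by (simp add: matrix_vector_mult_def sum_distrib_left mult.assoc)
    also have "\<dots> = 0" by (simp add: Ax)
    finally have 0: "(\<integral>\<omega>. (cmod (L \<omega>))\<^sup>2 \<partial>M) = 0" by (simp flip: of_real_power)
    have "integrable M (\<lambda>\<omega>. complex_of_real ((cmod (L \<omega>))\<^sup>2))"
      unfolding LL using YY by (intro Bochner_Integration.integrable_sum integrable_mult_left integrable_mult_right) auto
    then have "integrable M (\<lambda>\<omega>. (cmod (L \<omega>))\<^sup>2)" by (simp only: complex_of_real_integrable_eq)
    with 0 have "AE \<omega> in M. L \<omega> = 0"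
      by (simp add: integral_nonneg_eq_0_iff_AE)
    define c where "c = (\<Sum>i\<in>UNIV. cnj (x $ i) * e i)"
    define H where "H = {v. x \<bullet> v = Re c}"
    have Hm [measurable]: "H \<in> sets borel" unfolding H_def by measurable
    have L: "L \<omega> = (\<Sum>i\<in>UNIV. cnj (x $ i) * X \<omega> $ i) - c" for \<omega>
      by (simp add: L_def Y_def c_def right_diff_distrib sum_subtractf)
    have inn: "x \<bullet> v = Re (\<Sum>i\<in>UNIV. cnj (x $ i) * v $ i)" for v
      by (simp add: inner_vec_def inner_complex_def)
    have "AE \<omega> in M. X \<omega> \<in> H"
      using \<open>AE \<omega> in M. L \<omega> = 0\<close> by eventually_elim (simp only: H_def inn L mem_Collect_eq right_minus_eq)
    then have "emeasure M {\<omega>\<in>space M. X \<omega> \<in> H} = 1" by (subst emeasure_eq_1_AE) auto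
    moreover have "emeasure M {\<omega>\<in>space M. X \<omega> \<in> H} = emeasure (distr M lborel X) H"
      by (subst emeasure_distr) (auto simp: vimage_def Int_def conj_commute)
    moreover have "emeasure (distr M lborel X) H = emeasure (density lborel p) H"
      using distributed_distr_eq_density[OF X] by simp
    moreover have "H \<in> null_sets lborel"
      using negligible_hyperplane[of x "Re c"] \<open>x \<noteq> 0\<close> Hm unfolding H_def
      by (simp add: negligible_iff_null_sets null_sets_completion_iff)
    then have "emeasure (density lborel p) H = 0"
      using absolutely_continuousI_density[OF distributed_borel_measurable[OF X]]
      by (auto simp: absolutely_continuous_def)
    ultimately show False by simp
  qed
  then have "\<exists>B. B ** ?A = mat 1" unfolding matrix_left_invertible_ker by blast
  then show ?thesis by (simp add: invertible_left_inverse)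
qed

section \<open>Moments of Gaussian series\<close>

text \<open>Jensen's inequality for the weights \<open>b n\<close> divided by their sum, first for partial sums; it is stated in
\<open>[0, \<infinity>]\<close> because the right-hand side may diverge for individual sample points.\<close>

lemma convex_combination_power_le:
  fixes b x :: "nat \<Rightarrow> real"
  assumes b: "\<And>n. 0 \<le> b n" "summable b" and x: "\<And>n. 0 \<le> x n" and p: "0 < p" "even p"
    and sm: "summable (\<lambda>n. b n * x n)"
  shows "ennreal ((\<Sum>n. b n * x n) ^ p) \<le> (\<Sum>n. ennreal ((\<Sum>n. b n) ^ (p - 1) * b n * x n ^ p))"
proof -
  let ?B = "\<Sum>n. b n"
  have fin: "(\<Sum>n<N. b n * x n) ^ p \<le> (\<Sum>n<N. ?B ^ (p - 1) * b n * x n ^ p)" for N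
  proof (cases "(\<Sum>n<N. b n) = 0")
    case True
    then have "b n = 0" if "n < N" for n using that b(1) by (auto simp: sum_nonneg_eq_0_iff)
    then show ?thesis using p by (simp add: zero_power)
  next
    case False
    let ?C = "\<Sum>n<N. b n"
    have C: "0 < ?C" using False sum_nonneg[of "{..<N}" b] b(1) by (simp add: order_less_le)
    have N: "0 < N" using False by (intro Nat.gr0I) auto
    have CB: "?C \<le> ?B" using b by (intro sum_le_suminf) auto
    have "(\<Sum>n<N. (b n / ?C) *\<^sub>R x n) ^ p \<le> (\<Sum>n<N. (b n / ?C) * x n ^ p)"
      using b x C by (intro convex_on_sum[OF _ _ convex_power_even[OF p(2)]])
         (auto simp: sum_divide_distrib[symmetric] lessThan_empty_iff N)
    also have "(\<Sum>n<N. (b n / ?C) *\<^sub>R x n) = (\<Sum>n<N. b n * x n) / ?C"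
      by (simp add: sum_divide_distrib)
    finally have "(\<Sum>n<N. b n * x n) ^ p / ?C ^ p \<le> (\<Sum>n<N. b n * x n ^ p) / ?C"
      by (simp add: power_divide flip: sum_divide_distrib)
    then have "(\<Sum>n<N. b n * x n) ^ p \<le> ?C ^ p / ?C * (\<Sum>n<N. b n * x n ^ p)"
      using C by (simp add: field_simps)
    also have "?C ^ p / ?C = ?C ^ (p - 1)" using C p by (simp add: power_diff)
    also have "?C ^ (p - 1) * (\<Sum>n<N. b n * x n ^ p) \<le> ?B ^ (p - 1) * (\<Sum>n<N. b n * x n ^ p)"
      using C CB b x by (intro mult_right_mono power_mono sum_nonneg) auto
    finally show ?thesis by (simp add: sum_distrib_left mult_ac)
  qed
  have "(\<lambda>N. ennreal ((\<Sum>n<N. b n * x n) ^ p)) \<longlonglongrightarrow> ennreal ((\<Sum>n. b n * x n) ^ p)"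
    using summable_LIMSEQ[OF sm] by (intro tendsto_ennrealI tendsto_power)
  moreover have "ennreal ((\<Sum>n<N. b n * x n) ^ p) \<le> (\<Sum>n. ennreal (?B ^ (p - 1) * b n * x n ^ p))" for N
  proof -
    have "ennreal ((\<Sum>n<N. b n * x n) ^ p) \<le> ennreal (\<Sum>n<N. ?B ^ (p - 1) * b n * x n ^ p)"
      using fin by (rule ennreal_leI)
    also have "\<dots> = (\<Sum>n<N. ennreal (?B ^ (p - 1) * b n * x n ^ p))"
      using b x suminf_nonneg[of b] by (intro sum_ennreal[symmetric]) auto
    also have "\<dots> \<le> (\<Sum>n. ennreal (?B ^ (p - 1) * b n * x n ^ p))"
      by (intro sum_le_suminf) auto
    finally show ?thesis .
  qed
  ultimately show ?thesis by (intro LIMSEQ_le_const2) auto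
qed

lemma power_div_fact_le_exp:
  fixes x :: real
  assumes "0 \<le> x"
  shows "x ^ k / fact k \<le> exp x"
proof -
  have "(\<Sum>n\<in>{k}. x ^ n /\<^sub>R fact n) \<le> (\<Sum>n. x ^ n /\<^sub>R fact n)"
    using summable_exp_generic[of x] assms by (intro sum_le_suminf) auto
  then have "x ^ k /\<^sub>R fact k \<le> exp x" unfolding exp_def by simp
  then show ?thesis by (simp add: divide_inverse mult.commute)
qed

text \<open>One term of the exponential series bounds \<open>\<bar>z\<bar>\<^sup>2\<^sup>k\<close> by \<open>2\<^sup>k k! exp (\<bar>z\<bar>\<^sup>2/2)\<close>; the product with the normal density is again a normal
density, rescaled by \<open>\<surd>2\<close>, which has twice the mass. The exact value would be \<open>k!\<close> times the mass.\<close>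

lemma nn_integral_std_complex_normal_moment:
  "(\<integral>\<^sup>+z. ennreal (std_complex_normal_density z) * ennreal (cmod z ^ (2 * k)) \<partial>lborel)
     \<le> ennreal (2 * 2 ^ k * fact k) * (\<integral>\<^sup>+z. ennreal (std_complex_normal_density z) \<partial>lborel)"
proof -
  have [measurable]: "std_complex_normal_density \<in> borel_measurable borel"
    unfolding std_complex_normal_density_def[abs_def] by measurable
  let ?d = "complex_of_real (1 / sqrt 2)"
  have "std_complex_normal_density z * cmod z ^ (2 * k) \<le> 2 ^ k * fact k * std_complex_normal_density (?d * z)" for z
  proof -
    let ?x = "(cmod z)\<^sup>2 / 2"
    have "cmod z ^ (2 * k) = 2 ^ k * fact k * (?x ^ k / fact k)"
      by (simp add: power_divide power_mult)
    also have "\<dots> \<le> 2 ^ k * fact k * exp ?x"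
      by (intro mult_left_mono power_div_fact_le_exp) auto
    finally have "cmod z ^ (2 * k) \<le> 2 ^ k * fact k * exp ?x" .
    then have "std_complex_normal_density z * cmod z ^ (2 * k) \<le> std_complex_normal_density z * (2 ^ k * fact k * exp ?x)"
      by (intro mult_left_mono) (auto simp: std_complex_normal_density_def)
    also have "\<dots> = 2 ^ k * fact k * (exp (- (cmod z)\<^sup>2 + ?x) / pi)"
      unfolding exp_add by (simp add: std_complex_normal_density_def)
    also have "exp (- (cmod z)\<^sup>2 + ?x) / pi = std_complex_normal_density (?d * z)"
      by (simp add: std_complex_normal_density_def norm_mult power_mult_distrib norm_divide power_divide real_sqrt_abs)
    finally show ?thesis .
  qed
  then have "(\<integral>\<^sup>+z. ennreal (std_complex_normal_density z) * ennreal (cmod z ^ (2 * k)) \<partial>lborel)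
      \<le> (\<integral>\<^sup>+z. ennreal (2 ^ k * fact k) * ennreal (std_complex_normal_density (?d * z)) \<partial>lborel)"
    by (intro nn_integral_mono) (auto simp: ennreal_mult[symmetric] std_complex_normal_density_def intro!: ennreal_leI)
  also have "\<dots> = ennreal (2 ^ k * fact k) * (\<integral>\<^sup>+z. ennreal (std_complex_normal_density (?d * z)) \<partial>lborel)"
    by (rule nn_integral_cmult) measurable
  also have "(\<integral>\<^sup>+z. ennreal (std_complex_normal_density (?d * z)) \<partial>lborel)
     = ennreal 2 * (\<integral>\<^sup>+z. ennreal (std_complex_normal_density z) \<partial>lborel)"
    using nn_integral_complex_mult[of "\<lambda>z. ennreal (std_complex_normal_density z)" ?d 0]
    by (simp add: norm_divide power_divide)
  finally show ?thesis by (simp add: ennreal_mult mult_ac)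
qed

lemma (in prob_space) std_complex_normal_moment:
  assumes Z: "distributed M lborel Z (\<lambda>z. ennreal (std_complex_normal_density z))"
  shows "(\<integral>\<^sup>+\<omega>. ennreal (cmod (Z \<omega>) ^ (2 * k)) \<partial>M) \<le> ennreal (2 * 2 ^ k * fact k)"
proof -
  have "(\<integral>\<^sup>+z. ennreal (std_complex_normal_density z) * 1 \<partial>lborel) = (\<integral>\<^sup>+\<omega>. 1 \<partial>M)"
    by (rule distributed_nn_integral[OF Z]) simp
  then have 1: "(\<integral>\<^sup>+z. ennreal (std_complex_normal_density z) \<partial>lborel) = 1"
    by (simp add: emeasure_space_1)
  have "(\<integral>\<^sup>+\<omega>. ennreal (cmod (Z \<omega>) ^ (2 * k)) \<partial>M)
      = (\<integral>\<^sup>+z. ennreal (std_complex_normal_density z) * ennreal (cmod z ^ (2 * k)) \<partial>lborel)"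
    by (rule distributed_nn_integral[OF Z, symmetric]) measurable
  with nn_integral_std_complex_normal_moment[of k] 1 show ?thesis by simp
qed

lemma (in prob_space) weighted_series_moment:
  fixes Z :: "nat \<Rightarrow> 'a \<Rightarrow> complex" and b :: "nat \<Rightarrow> real"
  assumes [measurable]: "\<And>n. Z n \<in> borel_measurable M" and b: "\<And>n. 0 \<le> b n" "summable b" and p: "0 < p" "even p"
    and moment: "\<And>n. (\<integral>\<^sup>+\<omega>. ennreal (cmod (Z n \<omega>) ^ p) \<partial>M) \<le> ennreal \<mu>" and \<mu>: "0 \<le> \<mu>"
  shows "AE \<omega> in M. summable (\<lambda>n. b n * cmod (Z n \<omega>))"
    and "(\<integral>\<^sup>+\<omega>. ennreal ((\<Sum>n. b n * cmod (Z n \<omega>)) ^ p) \<partial>M) \<le> ennreal ((\<Sum>n. b n) ^ p * \<mu>)"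
proof -
  have m1: "(\<integral>\<^sup>+\<omega>. ennreal (cmod (Z n \<omega>)) \<partial>M) \<le> ennreal (1 + \<mu>)" for n
  proof -
    have x: "x \<le> 1 + x ^ p" if "0 \<le> x" for x :: real
    proof (cases "x \<le> 1")
      case False
      then have "x ^ 1 \<le> x ^ p" using p by (intro power_increasing) auto
      then show ?thesis by simp
    qed (use that in \<open>simp add: add_increasing2\<close>)
    have "(\<integral>\<^sup>+\<omega>. ennreal (cmod (Z n \<omega>)) \<partial>M) \<le> (\<integral>\<^sup>+\<omega>. 1 + ennreal (cmod (Z n \<omega>) ^ p) \<partial>M)"
      using x by (intro nn_integral_mono) (auto simp: ennreal_1[symmetric] ennreal_plus[symmetric] simp del: ennreal_1 ennreal_plus)
    also have "\<dots> = 1 + (\<integral>\<^sup>+\<omega>. ennreal (cmod (Z n \<omega>) ^ p) \<partial>M)"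
      by (subst nn_integral_add) (auto simp: emeasure_space_1)
    also have "\<dots> \<le> 1 + ennreal \<mu>" using moment by (intro add_left_mono)
    finally show ?thesis using \<mu> by simp
  qed
  have "(\<integral>\<^sup>+\<omega>. (\<Sum>n. ennreal (b n * cmod (Z n \<omega>))) \<partial>M) = (\<Sum>n. \<integral>\<^sup>+\<omega>. ennreal (b n * cmod (Z n \<omega>)) \<partial>M)"
    by (rule nn_integral_suminf) measurable
  also have "\<dots> \<le> (\<Sum>n. ennreal (b n * (1 + \<mu>)))"
  proof (intro suminf_le)
    fix n
    have "(\<integral>\<^sup>+\<omega>. ennreal (b n * cmod (Z n \<omega>)) \<partial>M) = ennreal (b n) * (\<integral>\<^sup>+\<omega>. ennreal (cmod (Z n \<omega>)) \<partial>M)"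
      using b by (subst nn_integral_cmult[symmetric]) (auto simp: ennreal_mult)
    also have "\<dots> \<le> ennreal (b n) * ennreal (1 + \<mu>)" by (intro mult_left_mono m1) auto
    finally show "(\<integral>\<^sup>+\<omega>. ennreal (b n * cmod (Z n \<omega>)) \<partial>M) \<le> ennreal (b n * (1 + \<mu>))"
      using b \<mu> by (simp add: ennreal_mult)
  qed auto
  also have "\<dots> < \<infinity>"
  proof -
    have "summable (\<lambda>n. b n * (1 + \<mu>))" using b by (intro summable_mult2)
    then have "(\<Sum>n. ennreal (b n * (1 + \<mu>))) = ennreal (\<Sum>n. b n * (1 + \<mu>))"
      using b \<mu> by (intro suminf_ennreal_eq summable_sums) auto
    then show ?thesis by simp
  qed
  finally have "AE \<omega> in M. (\<Sum>n. ennreal (b n * cmod (Z n \<omega>))) \<noteq> \<infinity>"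
    by (intro nn_integral_noteq_infinite) auto
  then show sm: "AE \<omega> in M. summable (\<lambda>n. b n * cmod (Z n \<omega>))"
    by eventually_elim (use b in \<open>auto intro!: summable_suminf_not_top\<close>)
  let ?B = "\<Sum>n. b n"
  have B: "0 \<le> ?B" using b by (intro suminf_nonneg)
  have "(\<integral>\<^sup>+\<omega>. ennreal ((\<Sum>n. b n * cmod (Z n \<omega>)) ^ p) \<partial>M)
      \<le> (\<integral>\<^sup>+\<omega>. (\<Sum>n. ennreal (?B ^ (p - 1) * b n * cmod (Z n \<omega>) ^ p)) \<partial>M)"
  proof (rule nn_integral_mono_AE)
    show "AE \<omega> in M. ennreal ((\<Sum>n. b n * cmod (Z n \<omega>)) ^ p)
        \<le> (\<Sum>n. ennreal (?B ^ (p - 1) * b n * cmod (Z n \<omega>) ^ p))"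
      using sm by eventually_elim (rule convex_combination_power_le, use b p in auto)
  qed
  also have "\<dots> = (\<Sum>n. \<integral>\<^sup>+\<omega>. ennreal (?B ^ (p - 1) * b n * cmod (Z n \<omega>) ^ p) \<partial>M)"
    by (rule nn_integral_suminf) measurable
  also have "\<dots> \<le> (\<Sum>n. ennreal (?B ^ (p - 1) * b n * \<mu>))"
  proof (intro suminf_le)
    fix n
    have "(\<integral>\<^sup>+\<omega>. ennreal (?B ^ (p - 1) * b n * cmod (Z n \<omega>) ^ p) \<partial>M)
       = ennreal (?B ^ (p - 1) * b n) * (\<integral>\<^sup>+\<omega>. ennreal (cmod (Z n \<omega>) ^ p) \<partial>M)"
      using b B by (subst nn_integral_cmult[symmetric]) (auto simp: ennreal_mult)
    also have "\<dots> \<le> ennreal (?B ^ (p - 1) * b n) * ennreal \<mu>" by (intro mult_left_mono moment) auto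
    finally show "(\<integral>\<^sup>+\<omega>. ennreal (?B ^ (p - 1) * b n * cmod (Z n \<omega>) ^ p) \<partial>M) \<le> ennreal (?B ^ (p - 1) * b n * \<mu>)"
      using b B \<mu> by (simp add: ennreal_mult)
  qed auto
  also have "\<dots> = ennreal (\<Sum>n. ?B ^ (p - 1) * b n * \<mu>)"
    using b B \<mu> by (intro suminf_ennreal_eq summable_sums summable_mult2 summable_mult) auto
  also have "(\<Sum>n. ?B ^ (p - 1) * b n * \<mu>) = ?B ^ (p - 1) * ?B * \<mu>"
    using b by (simp add: suminf_mult suminf_mult2[symmetric] summable_mult)
  also have "?B ^ (p - 1) * ?B = ?B ^ p" using p by (simp add: power_eq_if mult.commute)
  finally show "(\<integral>\<^sup>+\<omega>. ennreal ((\<Sum>n. b n * cmod (Z n \<omega>)) ^ p) \<partial>M) \<le> ennreal (?B ^ p * \<mu>)" .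
qed

section \<open>Gaussian coefficients and the random power series\<close>

definition gaussian_vec_density :: "(complex, 'n::finite) vec \<Rightarrow> real" where
  "gaussian_vec_density c = (\<Prod>i\<in>UNIV. std_complex_normal_density (c $ i))"

lemma continuous_std_complex_normal_density: "continuous_on A std_complex_normal_density"
  unfolding std_complex_normal_density_def[abs_def] by (intro continuous_intros) auto

lemma borel_measurable_std_complex_normal_density [measurable]: "std_complex_normal_density \<in> borel_measurable borel"
  by (intro borel_measurable_continuous_onI continuous_std_complex_normal_density)

lemma std_complex_normal_density_bounds:
  "0 \<le> std_complex_normal_density z" "std_complex_normal_density z \<le> 1 / pi"
  by (auto simp: std_complex_normal_density_def divide_right_mono)

lemma continuous_gaussian_vec_density: "continuous_on UNIV gaussian_vec_density"
  unfolding gaussian_vec_density_def[abs_def]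
  by (intro continuous_intros continuous_on_compose2[OF continuous_std_complex_normal_density[of UNIV]]) auto

lemma borel_measurable_gaussian_vec_density [measurable]: "gaussian_vec_density \<in> borel_measurable borel"
  by (intro borel_measurable_continuous_onI continuous_gaussian_vec_density)

lemma gaussian_vec_density_bounds:
  fixes c :: "(complex, 'n::finite) vec"
  shows "0 \<le> gaussian_vec_density c" "gaussian_vec_density c \<le> (1 / pi) ^ CARD('n)"
proof -
  show "0 \<le> gaussian_vec_density c"
    by (auto simp: gaussian_vec_density_def std_complex_normal_density_bounds intro!: prod_nonneg)
  have "gaussian_vec_density c \<le> (\<Prod>i\<in>(UNIV::'n set). 1 / pi)"
    unfolding gaussian_vec_density_def by (intro prod_mono) (auto simp: std_complex_normal_density_bounds)
  then show "gaussian_vec_density c \<le> (1 / pi) ^ CARD('n)" by simp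
qed

context gaussian_coefficients
begin

lemma random_variable_coeff [measurable]: "\<zeta> n \<in> borel_measurable M"
  using distributed_measurable[OF normal[of n]] by simp

abbreviation rcoeff :: "'w \<Rightarrow> nat \<Rightarrow> complex" where
  "rcoeff \<omega> n \<equiv> of_real (a n) * \<zeta> n \<omega>"

lemma measurable_conv_radius [measurable]:
  "Measurable.pred M (\<lambda>\<omega>. conv_radius a \<le> conv_radius (rcoeff \<omega>))"
  unfolding conv_radius_def by measurable

lemma gaf_eq_suminf:
  assumes "conv_radius a \<le> conv_radius (rcoeff \<omega>)"
  shows "gaf a \<zeta> \<omega> z = (\<Sum>n. rcoeff \<omega> n * z ^ n)"
  using assms by (simp add: gaf_def)

text \<open>On the good event the power series may be differentiated term by term, which also makes the derivative
measurable in \<open>\<omega>\<close>.\<close>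

lemma deriv_gaf_eq_suminf:
  assumes G: "conv_radius a \<le> conv_radius (rcoeff \<omega>)" and z: "z \<in> gaf_domain a"
  shows "deriv (gaf a \<zeta> \<omega>) z = (\<Sum>n. of_nat n * rcoeff \<omega> n * z ^ (n - 1))"
proof -
  have z': "ereal (cmod z) < conv_radius (rcoeff \<omega>)"
    using z G by (auto simp: gaf_domain_def intro: less_le_trans)
  then obtain K where K: "ereal (cmod z) < ereal K" "ereal K < conv_radius (rcoeff \<omega>)"
    using ereal_dense2 by blast
  then have K0: "0 < K" using le_less_trans[OF norm_ge_zero[of z], of K] by simp
  have "summable (\<lambda>n. rcoeff \<omega> n * of_real K ^ n)"
    using K K0 by (intro summable_in_conv_radius) auto
  then have "((\<lambda>x. \<Sum>n. rcoeff \<omega> n * x ^ n) has_field_derivative (\<Sum>n. diffs (rcoeff \<omega>) n * z ^ n)) (at z)"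
    using K by (intro termdiffs_strong[where K = "of_real K"]) auto
  moreover have "gaf a \<zeta> \<omega> = (\<lambda>x. \<Sum>n. rcoeff \<omega> n * x ^ n)" using G by (auto simp: gaf_def)
  ultimately have "deriv (gaf a \<zeta> \<omega>) z = (\<Sum>n. diffs (rcoeff \<omega>) n * z ^ n)" by (simp add: DERIV_imp_deriv)
  moreover have "summable (\<lambda>n. diffs (rcoeff \<omega>) n * z ^ n)"
  proof (rule termdiff_converges[where K = K])
    show "summable (\<lambda>n. rcoeff \<omega> n * x ^ n)" if "cmod x < K" for x
      using that K by (intro summable_in_conv_radius) (metis ereal_less(2) less_ereal.simps(1) order.strict_trans)
  qed (use K in auto)
  ultimately show ?thesis using diffs_equiv[of "rcoeff \<omega>" z] by (simp add: sums_iff)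
qed

lemma gaf_eq_0:
  assumes "\<not> conv_radius a \<le> conv_radius (rcoeff \<omega>)"
  shows "gaf a \<zeta> \<omega> z = 0" "deriv (gaf a \<zeta> \<omega>) z = 0"
proof -
  have "gaf a \<zeta> \<omega> = (\<lambda>_. 0)" using assms by (simp add: gaf_def fun_eq_iff)
  then show "gaf a \<zeta> \<omega> z = 0" "deriv (gaf a \<zeta> \<omega>) z = 0" by simp_all
qed

lemma gaf_vector_measurable:
  fixes z :: "(complex, 'k::finite) vec"
  assumes z: "\<And>i. z $ i \<in> gaf_domain a"
  shows "gaf_vector a \<zeta> z \<in> borel_measurable M"
proof -
  have "(\<lambda>\<omega>. gaf a \<zeta> \<omega> x) = (\<lambda>\<omega>. if conv_radius a \<le> conv_radius (rcoeff \<omega>) then \<Sum>n. rcoeff \<omega> n * x ^ n else 0)" for x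
    by (auto simp: gaf_def)
  then have 1: "(\<lambda>\<omega>. gaf a \<zeta> \<omega> x) \<in> borel_measurable M" for x by simp
  have "(\<lambda>\<omega>. deriv (gaf a \<zeta> \<omega>) (z $ i)) = (\<lambda>\<omega>. if conv_radius a \<le> conv_radius (rcoeff \<omega>) then \<Sum>n. of_nat n * rcoeff \<omega> n * z $ i ^ (n - 1) else 0)" for i
    by (auto simp: deriv_gaf_eq_suminf[OF _ z] gaf_eq_0)
  then have 2: "(\<lambda>\<omega>. deriv (gaf a \<zeta> \<omega>) (z $ i)) \<in> borel_measurable M" for i by simp
  show ?thesis unfolding gaf_vector_def
  proof (rule borel_measurable_vec_lambda)
    fix i show "(\<lambda>\<omega>. case i of Inl j \<Rightarrow> gaf a \<zeta> \<omega> (z $ j) | Inr j \<Rightarrow> deriv (gaf a \<zeta> \<omega>) (z $ j)) \<in> borel_measurable M"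
      using 1 2 by (cases i) auto
  qed
qed

lemma distr_coeff_vec:
  fixes r :: "'n::finite \<Rightarrow> nat"
  assumes "inj r"
  shows "distr M borel (\<lambda>\<omega>. \<chi> i. \<zeta> (r i) \<omega>) = density lborel (\<lambda>c. ennreal (gaussian_vec_density c))"
proof -
  have "indep_vars (\<lambda>_. borel) (\<lambda>i. \<zeta> (r i)) UNIV"
    by (rule indep_vars_compose_inj[OF indep assms])
  from distr_vec_indep_density[OF this normal] show ?thesis
    by (simp add: gaussian_vec_density_def prod_ennreal std_complex_normal_density_bounds)
qed

text \<open>The disjoint index sets make \<open>C1\<close>, \<open>C2\<close> and \<open>R\<close> independent; \<open>\<Psi>\<close> may be any measurable function of the
infinitely many coefficients with index in \<open>J\<close>, which is how the tail of the power series enters.\<close>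

lemma coeff_blocks_joint:
  fixes r1 r2 :: "'n::finite \<Rightarrow> nat" and F :: "_ \<Rightarrow> ennreal"
    and \<Psi> :: "(nat \<Rightarrow> complex) \<Rightarrow> 'c::euclidean_space"
  assumes r: "inj r1" "inj r2" and dis: "range r1 \<inter> range r2 = {}" "(range r1 \<union> range r2) \<inter> J = {}"
    and [measurable]: "\<Psi> \<in> borel_measurable (\<Pi>\<^sub>M n\<in>J. borel)"
  defines "C1 \<equiv> \<lambda>\<omega>. \<chi> i. \<zeta> (r1 i) \<omega>" and "C2 \<equiv> \<lambda>\<omega>. \<chi> i. \<zeta> (r2 i) \<omega>" and "R \<equiv> \<lambda>\<omega>. \<Psi> (\<lambda>n\<in>J. \<zeta> n \<omega>)"
  shows "F \<in> borel_measurable borel \<Longrightarrow> (\<integral>\<^sup>+\<omega>. F ((C1 \<omega>, C2 \<omega>), R \<omega>) \<partial>M) =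
      (\<integral>\<^sup>+\<omega>. (\<integral>\<^sup>+c2. (\<integral>\<^sup>+c1. ennreal (gaussian_vec_density c2) *
        (ennreal (gaussian_vec_density c1) * F ((c1, c2), R \<omega>)) \<partial>lborel) \<partial>lborel) \<partial>M)"
    and "G \<in> borel_measurable borel \<Longrightarrow> (\<integral>\<^sup>+\<omega>. G (C2 \<omega>, R \<omega>) \<partial>M) =
      (\<integral>\<^sup>+\<omega>. (\<integral>\<^sup>+c2. ennreal (gaussian_vec_density c2) * G (c2, R \<omega>) \<partial>lborel) \<partial>M)"
proof -
  let ?P = "\<lambda>I. PiM I (\<lambda>_::nat. borel :: complex measure)"
  have comp: "(\<lambda>f. \<chi> i. f (r i)) \<in> borel_measurable (?P I)" if "range r \<subseteq> I" for r :: "'n \<Rightarrow> nat" and I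
    using that by (intro borel_measurable_vec_lambda measurable_component_singleton) auto
  have 2: "(\<integral>\<^sup>+\<omega>. G (C2 \<omega>, R \<omega>) \<partial>M) =
      (\<integral>\<^sup>+\<omega>. (\<integral>\<^sup>+c2. ennreal (gaussian_vec_density c2) * G (c2, R \<omega>) \<partial>lborel) \<partial>M)"
    if [measurable]: "G \<in> borel_measurable borel" for G
  proof -
    have "indep_var (?P (range r2)) (\<lambda>\<omega>. \<lambda>n\<in>range r2. \<zeta> n \<omega>) (?P J) (\<lambda>\<omega>. \<lambda>n\<in>J. \<zeta> n \<omega>)"
      using dis by (intro indep_var_restrict[OF indep]) auto
    from nn_integral_indep_density[OF this comp[of r2, OF order_refl] \<open>\<Psi> \<in> _\<close>, of gaussian_vec_density G]
    show ?thesis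
      using distr_coeff_vec[OF r(2)] that by (simp add: C2_def R_def borel_prod)
  qed
  then show "G \<in> borel_measurable borel \<Longrightarrow> (\<integral>\<^sup>+\<omega>. G (C2 \<omega>, R \<omega>) \<partial>M) =
      (\<integral>\<^sup>+\<omega>. (\<integral>\<^sup>+c2. ennreal (gaussian_vec_density c2) * G (c2, R \<omega>) \<partial>lborel) \<partial>M)" .
  assume F: "F \<in> borel_measurable borel"
  have F' [measurable]: "(\<lambda>x. F ((f x, g x), h x)) \<in> borel_measurable N"
    if [measurable]: "f \<in> borel_measurable N" "g \<in> borel_measurable N" "h \<in> borel_measurable N" for f g h and N :: "'x measure"
    by (rule measurable_compose[OF _ F]) measurable
  let ?J = "range r2 \<union> J"
  let ?Y = "\<lambda>f. (\<chi> i. f (r2 i), \<Psi> (restrict f J))"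
  have i1: "indep_var (?P (range r1)) (\<lambda>\<omega>. \<lambda>n\<in>range r1. \<zeta> n \<omega>) (?P ?J) (\<lambda>\<omega>. \<lambda>n\<in>?J. \<zeta> n \<omega>)"
    using dis by (intro indep_var_restrict[OF indep]) auto
  have i2: "?Y \<in> borel_measurable (?P ?J)"
  proof -
    have "(\<lambda>f. restrict f J) \<in> measurable (?P ?J) (?P J)" by (rule measurable_restrict_subset) auto
    then have "(\<lambda>f. \<Psi> (restrict f J)) \<in> borel_measurable (?P ?J)" by (rule measurable_compose) measurable
    with comp[of r2 ?J] show ?thesis by (intro borel_measurable_Pair) auto
  qed
  have i3: "?Y (\<lambda>n\<in>?J. \<zeta> n \<omega>) = (C2 \<omega>, R \<omega>)" for \<omega>
  proof -
    have "restrict (\<lambda>n\<in>?J. \<zeta> n \<omega>) J = (\<lambda>n\<in>J. \<zeta> n \<omega>)" by auto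
    then show ?thesis by (simp add: C2_def R_def)
  qed
  have i4: "(\<lambda>x. F ((fst x, fst (snd x)), snd (snd x))) \<in> borel_measurable (borel \<Otimes>\<^sub>M borel)"
    by (rule F') (auto simp: borel_prod[symmetric])
  have "(\<integral>\<^sup>+\<omega>. F ((C1 \<omega>, C2 \<omega>), R \<omega>) \<partial>M) =
      (\<integral>\<^sup>+\<omega>. (\<integral>\<^sup>+c1. ennreal (gaussian_vec_density c1) * F ((c1, C2 \<omega>), R \<omega>) \<partial>lborel) \<partial>M)"
    using nn_integral_indep_density[where \<psi> = ?Y and N = borel and q = gaussian_vec_density
        and F = "\<lambda>x. F ((fst x, fst (snd x)), snd (snd x))", OF i1 comp[of r1, OF order_refl] i2 _ _ i4]
      distr_coeff_vec[OF r(1)] unfolding i3 by (simp add: C1_def)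
  also have "\<dots> = (\<integral>\<^sup>+\<omega>. (\<integral>\<^sup>+c2. ennreal (gaussian_vec_density c2) *
        (\<integral>\<^sup>+c1. ennreal (gaussian_vec_density c1) * F ((c1, c2), R \<omega>) \<partial>lborel) \<partial>lborel) \<partial>M)"
  proof -
    have "(\<lambda>x. \<integral>\<^sup>+c1. ennreal (gaussian_vec_density c1) * F ((c1, fst x), snd x) \<partial>lborel) \<in> borel_measurable borel"
      unfolding borel_prod[symmetric] by (intro lborel.borel_measurable_nn_integral) (simp add: case_prod_beta)
    from 2[OF this] show ?thesis by simp
  qed
  also have "\<dots> = (\<integral>\<^sup>+\<omega>. (\<integral>\<^sup>+c2. (\<integral>\<^sup>+c1. ennreal (gaussian_vec_density c2) *
        (ennreal (gaussian_vec_density c1) * F ((c1, c2), R \<omega>)) \<partial>lborel) \<partial>lborel) \<partial>M)"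
    by (simp add: nn_integral_cmult)
  finally show "(\<integral>\<^sup>+\<omega>. F ((C1 \<omega>, C2 \<omega>), R \<omega>) \<partial>M) =
      (\<integral>\<^sup>+\<omega>. (\<integral>\<^sup>+c2. (\<integral>\<^sup>+c1. ennreal (gaussian_vec_density c2) *
        (ennreal (gaussian_vec_density c1) * F ((c1, c2), R \<omega>)) \<partial>lborel) \<partial>lborel) \<partial>M)" .
qed

text \<open>For every rational \<open>q\<close> inside the disc of convergence, \<open>\<Sum> a\<^sub>n q\<^sup>n \<bar>\<zeta>\<^sub>n\<bar>\<close> has finite expectation and therefore converges
almost surely; countably many \<open>q\<close> exhaust the disc.\<close>

lemma AE_conv_radius: "AE \<omega> in M. conv_radius a \<le> conv_radius (rcoeff \<omega>)"
proof -
  have "AE \<omega> in M. \<forall>q::rat. 0 \<le> q \<longrightarrow> ereal (of_rat q) < conv_radius a \<longrightarrow> summable (\<lambda>n. (a n * of_rat q ^ n) * cmod (\<zeta> n \<omega>))"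
    unfolding AE_all_countable
  proof
    fix q :: rat
    show "AE \<omega> in M. 0 \<le> q \<longrightarrow> ereal (of_rat q) < conv_radius a \<longrightarrow> summable (\<lambda>n. (a n * of_rat q ^ n) * cmod (\<zeta> n \<omega>))"
    proof (cases "0 \<le> q \<and> ereal (of_rat q) < conv_radius a")
      case True
      have "AE \<omega> in M. summable (\<lambda>n. (a n * of_rat q ^ n) * cmod (\<zeta> n \<omega>))"
      proof (rule weighted_series_moment(1)[where p = "2 * 1"])
        show "summable (\<lambda>n. a n * real_of_rat q ^ n)" using True by (intro summable_in_conv_radius) auto
        show "(\<integral>\<^sup>+\<omega>. ennreal (cmod (\<zeta> n \<omega>) ^ (2 * 1)) \<partial>M) \<le> ennreal (2 * 2 ^ 1 * fact 1)" for n
          by (rule std_complex_normal_moment[OF normal])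
      qed (use True coeff_nonneg in auto)
      then show ?thesis by eventually_elim auto
    qed auto
  qed
  then show ?thesis
  proof eventually_elim
    case (elim \<omega>)
    show ?case
    proof (rule ccontr)
      assume "\<not> ?case"
      then obtain q :: rat where q: "conv_radius (rcoeff \<omega>) < of_rat q" "ereal (of_rat q) < conv_radius a"
        using ereal_dense3[of "conv_radius (rcoeff \<omega>)" "conv_radius a"] by (auto simp: not_le)
      have "0 \<le> ereal (of_rat q)" using q(1) conv_radius_nonneg[of "rcoeff \<omega>"] by (meson less_imp_le order_trans)
      then have q0: "0 \<le> q" by simp
      have "summable (\<lambda>n. norm (rcoeff \<omega> n * of_real (of_rat q) ^ n))"
        using elim q q0 coeff_nonneg by (simp add: norm_mult norm_power mult_ac)
      from conv_radius_geI[OF summable_norm_cancel[OF this]]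
      have "conv_radius (rcoeff \<omega>) \<ge> norm (complex_of_real (of_rat q))" .
      with q q0 show False by simp
    qed
  qed
qed

end

section \<open>The joint density of values and derivatives\<close>

text \<open>The decomposition of a series into the first \<open>k\<close> terms, the next \<open>k\<close> terms and the tail, matching the three
independent groups of coefficients.\<close>

lemma suminf_split_two_blocks:
  fixes f :: "nat \<Rightarrow> 'a::banach"
  assumes f: "summable f"
  shows "suminf f = (\<Sum>l\<in>(UNIV::'k::{finite,linorder} set). f (index_rank l)) +
    (\<Sum>l\<in>(UNIV::'k set). f (CARD('k) + index_rank l)) + (\<Sum>n. f (n + 2 * CARD('k)))"
proof -
  let ?k = "CARD('k)"
  have "suminf f = (\<Sum>n. f (n + ?k)) + (\<Sum>n<?k. f n)"
    by (rule suminf_split_initial_segment[OF f])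
  also have "(\<Sum>n. f (n + ?k)) = (\<Sum>n. f (n + ?k + ?k)) + (\<Sum>n<?k. f (n + ?k))"
    using f by (intro suminf_split_initial_segment) (simp add: summable_iff_shift)
  finally show ?thesis
    using sum_index_rank[where 'k='k, of f] sum_index_rank[where 'k='k, of "\<lambda>n. f (n + ?k)"]
    by (simp add: add_ac mult_2)
qed

lemma mult_power_le_power_add_one:
  fixes x :: real
  assumes "0 \<le> x"
  shows "real n * x ^ (n - 1) \<le> (x + 1) ^ n"
proof (induction n)
  case (Suc n)
  have "x ^ n \<le> (x + 1) ^ n" using assms by (intro power_mono) auto
  moreover have "x * (real n * x ^ (n - 1)) \<le> x * (x + 1) ^ n" using Suc assms by (intro mult_left_mono)
  moreover have "real (Suc n) * x ^ (Suc n - 1) = x ^ n + x * (real n * x ^ (n - 1))"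
    by (cases n) (auto simp: algebra_simps)
  moreover have "(x + 1) ^ Suc n = (x + 1) ^ n + x * (x + 1) ^ n" by (simp add: algebra_simps)
  ultimately show ?case by linarith
qed simp

lemma prod_pairwise_differences:
  fixes z :: "(complex, 'k::{finite,linorder}) vec"
  shows "(\<Prod>i\<in>UNIV. (cmod (\<Prod>j\<in>UNIV - {i}. z $ i - z $ j))\<^sup>2)
    = (\<Prod>(i, j)\<in>{(i, j). i < j}. (cmod (z $ i - z $ j))\<^sup>2)\<^sup>2"
proof -
  let ?f = "\<lambda>(i, j). (cmod (z $ i - z $ j))\<^sup>2"
  have "(\<Prod>i\<in>UNIV. (cmod (\<Prod>j\<in>UNIV - {i}. z $ i - z $ j))\<^sup>2) = (\<Prod>i\<in>UNIV. \<Prod>j\<in>UNIV - {i}. (cmod (z $ i - z $ j))\<^sup>2)"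
    by (simp add: prod_norm[symmetric] prod_power_distrib)
  also have "\<dots> = prod ?f (SIGMA i:UNIV. UNIV - {i})" by (simp add: prod.Sigma)
  also have "(SIGMA i:(UNIV::'k set). UNIV - {i}) = {(i, j). i < j} \<union> {(i, j). j < i}" by auto
  also have "prod ?f \<dots> = prod ?f {(i, j). i < j} * prod ?f {(i, j). j < i}"
    by (intro prod.union_disjoint) auto
  also have "prod ?f {(i, j). j < i} = prod ?f {(i, j). i < j}"
    by (rule prod.reindex_bij_witness[of _ "\<lambda>(i, j). (j, i)" "\<lambda>(i, j). (j, i)"]) (auto simp: norm_minus_commute)
  finally show ?thesis by (simp add: power2_eq_square)
qed

context gaussian_coefficients
begin

lemma random_series_dominated:
  assumes sm: "summable (\<lambda>n. b n * cmod (\<zeta> n \<omega>))"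
    and x: "\<And>n. cmod (of_real (a n) * x n) \<le> b n"
  shows "summable (\<lambda>n. rcoeff \<omega> n * x n)"
    and "cmod (\<Sum>n. rcoeff \<omega> n * x n) \<le> (\<Sum>n. b n * cmod (\<zeta> n \<omega>))"
proof -
  have le: "cmod (rcoeff \<omega> n * x n) \<le> b n * cmod (\<zeta> n \<omega>)" for n
    using mult_right_mono[OF x[of n], of "cmod (\<zeta> n \<omega>)"] by (simp add: norm_mult mult_ac)
  have "summable (\<lambda>n. cmod (rcoeff \<omega> n * x n))"
    by (rule summable_comparison_test'[OF sm, of 0]) (use le in simp)
  then show "summable (\<lambda>n. rcoeff \<omega> n * x n)" by (rule summable_norm_cancel)
  have "cmod (\<Sum>n. rcoeff \<omega> n * x n) \<le> (\<Sum>n. cmod (rcoeff \<omega> n * x n))"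
    by (rule summable_norm) fact
  also have "\<dots> \<le> (\<Sum>n. b n * cmod (\<zeta> n \<omega>))" by (rule suminf_le) (fact le, fact+)
  finally show "cmod (\<Sum>n. rcoeff \<omega> n * x n) \<le> (\<Sum>n. b n * cmod (\<zeta> n \<omega>))" .
qed

lemma AE_random_series_summable:
  assumes "\<And>n. 0 \<le> b n" "summable b"
  shows "AE \<omega> in M. summable (\<lambda>n. b n * cmod (\<zeta> n \<omega>))"
proof (rule weighted_series_moment(1)[where p = "2 * 1"])
  show "(\<integral>\<^sup>+\<omega>. ennreal (cmod (\<zeta> n \<omega>) ^ (2 * 1)) \<partial>M) \<le> ennreal (2 * 2 ^ 1 * fact 1)" for n
    by (rule std_complex_normal_moment[OF normal])
qed (use assms in auto)

lemma in_gaf_domain: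
  assumes "summable (\<lambda>n. a n * r ^ n)" "cmod x < r"
  shows "x \<in> gaf_domain a"
proof -
  have "ereal (norm r) \<le> conv_radius a" using assms(1) by (rule conv_radius_geI)
  moreover have "ereal (cmod x) < ereal (norm r)" using assms(2) by simp
  ultimately have "ereal (cmod x) < conv_radius a" by (rule less_le_trans[rotated])
  then show ?thesis by (simp add: gaf_domain_def)
qed

text \<open>Values and derivatives are controlled by the same majorant, since
\<open>n \<bar>x\<bar>\<^sup>n\<^sup>-\<^sup>1 \<le> (\<bar>x\<bar> + 1)\<^sup>n \<le> r\<^sup>n\<close>.\<close>

lemma gaf_values:
  assumes sm: "summable (\<lambda>n. a n * r ^ n * cmod (\<zeta> n \<omega>))" and ar: "summable (\<lambda>n. a n * r ^ n)"
    and G: "conv_radius a \<le> conv_radius (rcoeff \<omega>)" and x: "cmod x + 1 \<le> r"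
  shows "(\<lambda>n. rcoeff \<omega> n * x ^ n) sums gaf a \<zeta> \<omega> x"
    and "(\<lambda>n. rcoeff \<omega> n * (of_nat n * x ^ (n - 1))) sums deriv (gaf a \<zeta> \<omega>) x"
    and "cmod (gaf a \<zeta> \<omega> x) \<le> (\<Sum>n. a n * r ^ n * cmod (\<zeta> n \<omega>))"
    and "cmod (deriv (gaf a \<zeta> \<omega>) x) \<le> (\<Sum>n. a n * r ^ n * cmod (\<zeta> n \<omega>))"
proof -
  have xd: "x \<in> gaf_domain a" using x by (intro in_gaf_domain[OF ar]) simp
  have 1: "cmod (of_real (a n) * x ^ n) \<le> a n * r ^ n" for n
    using x coeff_nonneg[of n] by (auto simp: norm_mult norm_power intro!: mult_left_mono power_mono)
  have 2: "cmod (of_real (a n) * (of_nat n * x ^ (n - 1))) \<le> a n * r ^ n" for n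
  proof -
    have "real n * cmod x ^ (n - 1) \<le> (cmod x + 1) ^ n" by (rule mult_power_le_power_add_one) simp
    also have "\<dots> \<le> r ^ n" using x by (intro power_mono) auto
    finally show ?thesis using coeff_nonneg[of n] by (auto simp: norm_mult norm_power intro!: mult_left_mono)
  qed
  have g: "gaf a \<zeta> \<omega> x = (\<Sum>n. rcoeff \<omega> n * x ^ n)" by (rule gaf_eq_suminf[OF G])
  have d: "deriv (gaf a \<zeta> \<omega>) x = (\<Sum>n. rcoeff \<omega> n * (of_nat n * x ^ (n - 1)))"
    unfolding deriv_gaf_eq_suminf[OF G xd] by (simp add: mult_ac)
  show "(\<lambda>n. rcoeff \<omega> n * x ^ n) sums gaf a \<zeta> \<omega> x" "cmod (gaf a \<zeta> \<omega> x) \<le> (\<Sum>n. a n * r ^ n * cmod (\<zeta> n \<omega>))"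
    unfolding g using random_series_dominated[OF sm 1] by (auto intro: summable_sums)
  show "(\<lambda>n. rcoeff \<omega> n * (of_nat n * x ^ (n - 1))) sums deriv (gaf a \<zeta> \<omega>) x"
    "cmod (deriv (gaf a \<zeta> \<omega>) x) \<le> (\<Sum>n. a n * r ^ n * cmod (\<zeta> n \<omega>))"
    unfolding d using random_series_dominated[OF sm 2] by (auto intro: summable_sums)
qed

lemma gaf_vector_square_integrable:
  fixes z :: "(complex, 'k::finite) vec"
  assumes ar: "summable (\<lambda>n. a n * r ^ n)" and r: "0 \<le> r" and z: "\<And>i. cmod (z $ i) + 1 \<le> r"
  shows "integrable M (\<lambda>\<omega>. (cmod (gaf_vector a \<zeta> z \<omega> $ i))\<^sup>2)"
proof -
  let ?W = "\<lambda>\<omega>. \<Sum>n. a n * r ^ n * cmod (\<zeta> n \<omega>)"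
  have "z $ i \<in> gaf_domain a" for i using z[of i] by (intro in_gaf_domain[OF ar]) simp
  then have [measurable]: "gaf_vector a \<zeta> z \<in> borel_measurable M" by (rule gaf_vector_measurable)
  have sm: "AE \<omega> in M. summable (\<lambda>n. a n * r ^ n * cmod (\<zeta> n \<omega>))"
    using r coeff_nonneg ar by (intro AE_random_series_summable) auto
  have "AE \<omega> in M. ennreal (norm ((cmod (gaf_vector a \<zeta> z \<omega> $ i))\<^sup>2)) \<le> ennreal (?W \<omega> ^ (2 * 1))"
    using AE_conv_radius sm
  proof eventually_elim
    case (elim \<omega>)
    note sm = elim(2)
    have "cmod (gaf_vector a \<zeta> z \<omega> $ i) \<le> ?W \<omega>"
      using gaf_values(3,4)[OF sm ar elim(1) z] by (cases i) (auto simp: gaf_vector_def)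
    then show ?case by (auto intro!: ennreal_leI power_mono)
  qed
  then have "(\<integral>\<^sup>+\<omega>. ennreal (norm ((cmod (gaf_vector a \<zeta> z \<omega> $ i))\<^sup>2)) \<partial>M) \<le> (\<integral>\<^sup>+\<omega>. ennreal (?W \<omega> ^ (2 * 1)) \<partial>M)"
    by (rule nn_integral_mono_AE)
  also have "\<dots> \<le> ennreal ((\<Sum>n. a n * r ^ n) ^ (2 * 1) * (2 * 2 ^ 1 * fact 1))"
    using ar r coeff_nonneg by (intro weighted_series_moment(2) std_complex_normal_moment[OF normal]) auto
  also have "\<dots> < \<infinity>" by simp
  finally show ?thesis by (intro integrableI_bounded) auto
qed

text \<open>\<open>affine_density\<close> is applied to \<open>C1 = (\<zeta>\<^sub>n)\<^bsub>n < k\<^esub>\<close>, \<open>C2 = (\<zeta>\<^sub>n)\<^bsub>k \<le> n < 2k\<^esub>\<close> and the tail, with the Hermite matrix \<open>B\<close>. The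
Jacobian \<open>J1\<close> contributes \<open>\<Delta>\<^sup>-\<^sup>1 \<Prod> a\<^sub>n\<^sup>-\<^sup>2\<close>, the bound on the density of \<open>C1\<close> contributes \<open>\<pi>\<^sup>-\<^sup>k\<close>, and the factors \<open>w\<^sub>i\<close> in the reduced
derivatives contribute \<open>\<Delta>\<^sup>2\<close>.\<close>

lemma gaf_vector_density:
  fixes z :: "(complex, 'k::{finite,linorder}) vec"
  assumes z: "inj (($) z)" and r: "0 \<le> r" "\<And>i. cmod (z $ i) + 1 \<le> r"
    and ar: "summable (\<lambda>n. a n * r ^ n)" and a: "\<And>n. n < 2 * CARD('k) \<Longrightarrow> a n \<noteq> 0"
  defines "\<Delta> \<equiv> (\<Prod>(i, j)\<in>{(i, j). i < j}. (cmod (z $ i - z $ j))\<^sup>2)"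
  defines "W \<equiv> \<lambda>\<omega>. \<Sum>n. (if n < CARD('k) then 0 else a n * r ^ n) * cmod (\<zeta> n \<omega>)"
  obtains p where "continuous_density M (gaf_vector a \<zeta> z) p"
    "(\<integral>\<^sup>+\<eta>. ennreal ((cmod (\<Prod>j\<in>UNIV. \<eta> $ j))\<^sup>2 * p (\<chi> i. case i of Inl _ \<Rightarrow> 0 | Inr j \<Rightarrow> \<eta> $ j)) \<partial>lborel)
       \<le> ennreal (\<Delta> / (pi ^ CARD('k) * (\<Prod>n<CARD('k). (a n)\<^sup>2))) * (\<integral>\<^sup>+\<omega>. ennreal (W \<omega> ^ (2 * CARD('k))) \<partial>M)"
proof -
  let ?k = "CARD('k)"
  define w where "w i = (\<Prod>j\<in>UNIV - {i}. z $ i - z $ j)" for i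
  have w: "w i \<noteq> 0" for i using z by (auto simp: w_def inj_eq)
  have \<Delta>0: "0 < \<Delta>" unfolding \<Delta>_def using z by (intro prod_pos) (auto simp: inj_eq)
  obtain B Q where BQ:
      "\<And>n i. of_nat n * z $ i ^ (n - 1) = (\<Sum>j\<in>UNIV. B $ i $ j * z $ j ^ n) + w i * poly (Q n) (z $ i)"
    and Q0: "\<And>n. n < ?k \<Longrightarrow> Q n = 0"
    and Qm: "\<And>m. degree (Q (?k + m)) = m" "\<And>m. lead_coeff (Q (?k + m)) = 1"
    and Qb: "\<And>n i. cmod (poly (Q n) (z $ i)) \<le> r ^ n"
    by (rule hermite_interpolation_remainder[OF z r(2), folded w_def]) (rule that)
  define V1 V2 H :: "((complex, 'k) vec, 'k) vec" where "V1 = (\<chi> i j. of_real (a (index_rank j)) * vandermonde z $ i $ j)"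
    and "V2 = (\<chi> i j. of_real (a (?k + index_rank j)) * z $ i ^ (?k + index_rank j))"
    and "H = (\<chi> i j. of_real (a (?k + index_rank j)) * (\<chi> i j. w i * (\<chi> i j. poly (Q (?k + index_rank j)) (z $ i)) $ i $ j) $ i $ j)"
  have a1: "complex_of_real (a (index_rank i)) \<noteq> 0" for i :: 'k
    using a[of "index_rank i"] index_rank_less_card[of i] by simp
  have a2: "complex_of_real (a (?k + index_rank i)) \<noteq> 0" for i :: 'k
    using a[of "?k + index_rank i"] index_rank_less_card[of i] by simp
  define J1 where "J1 = 1 / \<Delta> * (\<Prod>i\<in>(UNIV::'k set). 1 / (cmod (of_real (a (index_rank i))))\<^sup>2)"
  have V1: "scales_lborel ((*v) V1) J1"
    unfolding V1_def J1_def \<Delta>_def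
    by (intro scales_lborel_column_scaling scales_lborel_vandermonde z a1)
  have "scales_lborel ((*v) (\<chi> l j. coeff (Q (?k + index_rank j)) (index_rank l))) 1"
    by (rule scales_lborel_monic_coeffs) (rule Qm)+
  from scales_lborel_compose[OF scales_lborel_vandermonde[OF z] this]
  have "scales_lborel ((*v) (\<chi> i j. poly (Q (?k + index_rank j)) (z $ i))) (1 / \<Delta> * 1)"
    by (simp only: vandermonde_monic_factor[of "\<lambda>j. Q (?k + index_rank j)", OF Qm(1)] matrix_vector_mul_assoc \<Delta>_def)
  note Hscale = scales_lborel_column_scaling[of _ _ "\<lambda>j. of_real (a (?k + index_rank j))",
      OF scales_lborel_row_scaling[of _ _ w, OF this w] a2, folded H_def]
  then obtain J2 where H: "scales_lborel ((*v) H) J2" by (rule that)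
  obtain V1' where V1': "V1' ** V1 = mat 1" using scales_lborel_matrix_left_inverse[OF V1] .
  obtain H' where H': "H' ** H = mat 1" using scales_lborel_matrix_left_inverse[OF H] .
  define C1 C2 where "C1 = (\<lambda>\<omega>. \<chi> i::'k. \<zeta> (index_rank i) \<omega>)" and "C2 = (\<lambda>\<omega>. \<chi> i::'k. \<zeta> (?k + index_rank i) \<omega>)"
  define \<Psi> :: "(nat \<Rightarrow> complex) \<Rightarrow> (complex, 'k) vec \<times> (complex, 'k) vec" where
    "\<Psi> t = (\<chi> i. \<Sum>n. of_real (a (n + 2 * ?k)) * t (n + 2 * ?k) * z $ i ^ (n + 2 * ?k),
            \<chi> i. w i * (\<Sum>n. of_real (a (n + 2 * ?k)) * t (n + 2 * ?k) * poly (Q (n + 2 * ?k)) (z $ i)))" for t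
  define R where "R \<omega> = \<Psi> (\<lambda>n\<in>{2 * ?k..}. \<zeta> n \<omega>)" for \<omega>
  have Rv: "fst (R \<omega>) $ i = (\<Sum>n. rcoeff \<omega> (n + 2 * ?k) * z $ i ^ (n + 2 * ?k))" for \<omega> i
    by (simp add: R_def \<Psi>_def)
  have Rg: "snd (R \<omega>) $ i = w i * (\<Sum>n. rcoeff \<omega> (n + 2 * ?k) * poly (Q (n + 2 * ?k)) (z $ i))" for \<omega> i
    by (simp add: R_def \<Psi>_def)
  have \<Psi>m: "\<Psi> \<in> borel_measurable (\<Pi>\<^sub>M n\<in>{2 * ?k..}. borel)"
  proof -
    have [measurable]: "(\<lambda>t. t (n + 2 * ?k)) \<in> borel_measurable (\<Pi>\<^sub>M n\<in>{2 * ?k..}. borel :: complex measure)" for n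
      by (rule measurable_component_singleton) simp
    show ?thesis unfolding \<Psi>_def by measurable
  qed
  have [measurable]: "C1 \<in> borel_measurable M" "C2 \<in> borel_measurable M"
    unfolding C1_def C2_def by measurable
  have [measurable]: "(\<lambda>\<omega>. fst (R \<omega>)) \<in> borel_measurable M" "(\<lambda>\<omega>. snd (R \<omega>)) \<in> borel_measurable M"
    unfolding R_def \<Psi>_def by simp_all
  have Rm [measurable]: "R \<in> borel_measurable M"
    using borel_measurable_Pair[of "\<lambda>\<omega>. fst (R \<omega>)" M "\<lambda>\<omega>. snd (R \<omega>)"] by simp
  have inj2: "inj (\<lambda>i::'k. ?k + index_rank i)" using inj_index_rank by (auto simp: inj_def)
  have dis: "range (index_rank :: 'k \<Rightarrow> nat) \<inter> range (\<lambda>i::'k. ?k + index_rank i) = {}"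
    "(range (index_rank :: 'k \<Rightarrow> nat) \<union> range (\<lambda>i::'k. ?k + index_rank i)) \<inter> {2 * ?k..} = {}"
    using index_rank_less_card[where 'k='k] by (auto simp: disjoint_iff mult_2 not_le) (metis add_lessD1 less_irrefl not_add_less1 add_strict_mono)+
  note joint = coeff_blocks_joint[OF inj_index_rank inj2 dis \<Psi>m, folded R_def]
  define Xv where "Xv \<omega> = V1 *v C1 \<omega> + V2 *v C2 \<omega> + fst (R \<omega>)" for \<omega>
  define Xd where "Xd \<omega> = B *v Xv \<omega> + (H *v C2 \<omega> + snd (R \<omega>))" for \<omega>
  have contmul: "continuous_on UNIV ((*v) A)" for A :: "((complex, 'k) vec, 'k) vec"
    unfolding matrix_vector_mult_def by (intro continuous_intros)
  obtain p where p: "continuous_on UNIV p" "\<And>x. 0 \<le> p x"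
    "distr M borel (\<lambda>\<omega>. (Xv \<omega>, Xd \<omega>)) = density lborel (\<lambda>x. ennreal (p x))"
    "\<And>\<phi>. \<phi> \<in> borel_measurable borel \<Longrightarrow>
      (\<integral>\<^sup>+\<eta>. \<phi> \<eta> * ennreal (p (0, \<eta>)) \<partial>lborel) \<le> ennreal (J1 * (1 / pi) ^ ?k) * (\<integral>\<^sup>+\<omega>. \<phi> (H *v C2 \<omega> + snd (R \<omega>)) \<partial>M)"
  proof (rule affine_density[of C1 C2 "\<lambda>\<omega>. fst (R \<omega>)" "\<lambda>\<omega>. snd (R \<omega>)" gaussian_vec_density
        "(*v) V1" J1 "(*v) H" J2 "(*v) V1'" "(*v) H'" "(*v) V2" "(*v) B" "(1 / pi) ^ ?k"])
    show "F \<in> borel_measurable borel \<Longrightarrow>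
      (\<integral>\<^sup>+\<omega>. F ((C1 \<omega>, C2 \<omega>), (fst (R \<omega>), snd (R \<omega>))) \<partial>M) =
      (\<integral>\<^sup>+\<omega>. (\<integral>\<^sup>+c2. (\<integral>\<^sup>+c1. ennreal (gaussian_vec_density c2) * (ennreal (gaussian_vec_density c1) *
        F ((c1, c2), (fst (R \<omega>), snd (R \<omega>)))) \<partial>lborel) \<partial>lborel) \<partial>M)" for F
      using joint(1)[of F] by (simp add: C1_def C2_def)
    show "F \<in> borel_measurable borel \<Longrightarrow> (\<integral>\<^sup>+\<omega>. F (C2 \<omega>, snd (R \<omega>)) \<partial>M) =
      (\<integral>\<^sup>+\<omega>. (\<integral>\<^sup>+c2. ennreal (gaussian_vec_density c2) * F (c2, snd (R \<omega>)) \<partial>lborel) \<partial>M)" for F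
    proof -
      assume F: "F \<in> borel_measurable borel"
      have "(\<lambda>x. F (fst x, snd (snd x))) \<in> borel_measurable borel"
        by (rule measurable_compose[OF _ F]) (intro borel_measurable_continuous_onI continuous_intros)
      from joint(2)[OF this] show ?thesis by (simp add: C2_def)
    qed
    fix p assume "continuous_on UNIV p" "\<And>x. 0 \<le> p x"
    "distr M borel (\<lambda>\<omega>. (V1 *v C1 \<omega> + V2 *v C2 \<omega> + fst (R \<omega>), B *v (V1 *v C1 \<omega> + V2 *v C2 \<omega> + fst (R \<omega>)) + (H *v C2 \<omega> + snd (R \<omega>))))
        = density lborel (\<lambda>x. ennreal (p x))"
    "\<And>\<phi>. \<phi> \<in> borel_measurable borel \<Longrightarrow>
      (\<integral>\<^sup>+\<eta>. \<phi> \<eta> * ennreal (p (0, \<eta>)) \<partial>lborel) \<le> ennreal (J1 * (1 / pi) ^ ?k) * (\<integral>\<^sup>+\<omega>. \<phi> (H *v C2 \<omega> + snd (R \<omega>)) \<partial>M)"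
    then show thesis by (intro that) (auto simp: Xv_def Xd_def)
  qed (use V1 H in \<open>auto simp: matrix_vector_mul_assoc V1' H' contmul continuous_gaussian_vec_density gaussian_vec_density_bounds\<close>)
  have good: "AE \<omega> in M. conv_radius a \<le> conv_radius (rcoeff \<omega>) \<and> summable (\<lambda>n. a n * r ^ n * cmod (\<zeta> n \<omega>))"
  proof -
    have "AE \<omega> in M. summable (\<lambda>n. a n * r ^ n * cmod (\<zeta> n \<omega>))"
      using r coeff_nonneg ar by (intro AE_random_series_summable) auto
    with AE_conv_radius show ?thesis by eventually_elim auto
  qed
  \<comment> \<open>The reduced derivatives are free of the first \<open>k\<close> coefficients and carry the factor \<open>w i\<close>.\<close>
  have rest: "(H *v C2 \<omega> + snd (R \<omega>)) $ i = w i * (\<Sum>n. rcoeff \<omega> n * poly (Q n) (z $ i))"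
    and restb: "cmod ((H *v C2 \<omega> + snd (R \<omega>)) $ i) \<le> cmod (w i) * W \<omega>"
    if sm: "summable (\<lambda>n. a n * r ^ n * cmod (\<zeta> n \<omega>))" for \<omega> i
  proof -
    have "summable (\<lambda>n. (if n < ?k then 0 else a n * r ^ n) * cmod (\<zeta> n \<omega>))"
      by (rule summable_comparison_test'[OF sm, of 0]) (use r coeff_nonneg in auto)
    moreover have "cmod (of_real (a n) * poly (Q n) (z $ i)) \<le> (if n < ?k then 0 else a n * r ^ n)" for n
      using Qb[of n i] coeff_nonneg[of n] by (auto simp: Q0 norm_mult intro!: mult_left_mono)
    ultimately have s: "summable (\<lambda>n. rcoeff \<omega> n * poly (Q n) (z $ i))"
      and b: "cmod (\<Sum>n. rcoeff \<omega> n * poly (Q n) (z $ i)) \<le> W \<omega>"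
      unfolding W_def by (rule random_series_dominated)+
    show eq: "(H *v C2 \<omega> + snd (R \<omega>)) $ i = w i * (\<Sum>n. rcoeff \<omega> n * poly (Q n) (z $ i))"
      unfolding suminf_split_two_blocks[where 'k='k, OF s] using index_rank_less_card[where 'k='k]
      by (simp add: Rg H_def C2_def matrix_vector_mult_def Q0 distrib_left sum_distrib_left mult_ac)
    show "cmod ((H *v C2 \<omega> + snd (R \<omega>)) $ i) \<le> cmod (w i) * W \<omega>"
      unfolding eq norm_mult using b by (intro mult_left_mono) auto
  qed
  have XvF: "Xv \<omega> $ i = gaf a \<zeta> \<omega> (z $ i)" and XdF: "Xd \<omega> $ i = deriv (gaf a \<zeta> \<omega>) (z $ i)"
    if "conv_radius a \<le> conv_radius (rcoeff \<omega>)" and sm: "summable (\<lambda>n. a n * r ^ n * cmod (\<zeta> n \<omega>))" for \<omega> i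
  proof -
    note F = gaf_values[OF sm ar that(1) r(2)]
    show *: "Xv \<omega> $ i = gaf a \<zeta> \<omega> (z $ i)" for i
      unfolding sums_unique[OF F(1)] suminf_split_two_blocks[where 'k='k, OF sums_summable[OF F(1)]]
      by (simp add: Xv_def Rv V1_def V2_def C1_def C2_def matrix_vector_mult_def vandermonde_def mult_ac)
    have "(\<lambda>n. \<Sum>j\<in>UNIV. B $ i $ j * (rcoeff \<omega> n * z $ j ^ n)) sums (\<Sum>j\<in>UNIV. B $ i $ j * gaf a \<zeta> \<omega> (z $ j))"
      by (intro sums_sum sums_mult F(1))
    moreover have "(\<lambda>n. w i * (rcoeff \<omega> n * poly (Q n) (z $ i))) sums (w i * (\<Sum>n. rcoeff \<omega> n * poly (Q n) (z $ i)))"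
    proof (intro sums_mult summable_sums random_series_dominated(1)[OF sm])
      show "cmod (of_real (a n) * poly (Q n) (z $ i)) \<le> a n * r ^ n" for n
        using Qb[of n i] coeff_nonneg[of n] by (auto simp: norm_mult intro!: mult_left_mono)
    qed
    ultimately have "(\<lambda>n. (\<Sum>j\<in>UNIV. B $ i $ j * (rcoeff \<omega> n * z $ j ^ n)) + w i * (rcoeff \<omega> n * poly (Q n) (z $ i)))
        sums ((\<Sum>j\<in>UNIV. B $ i $ j * gaf a \<zeta> \<omega> (z $ j)) + w i * (\<Sum>n. rcoeff \<omega> n * poly (Q n) (z $ i)))"
      by (rule sums_add)
    also have "(\<lambda>n. (\<Sum>j\<in>UNIV. B $ i $ j * (rcoeff \<omega> n * z $ j ^ n)) + w i * (rcoeff \<omega> n * poly (Q n) (z $ i)))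
        = (\<lambda>n. rcoeff \<omega> n * (of_nat n * z $ i ^ (n - 1)))"
      unfolding BQ by (simp add: fun_eq_iff distrib_left sum_distrib_left mult_ac)
    finally have "deriv (gaf a \<zeta> \<omega>) (z $ i) = (\<Sum>j\<in>UNIV. B $ i $ j * gaf a \<zeta> \<omega> (z $ j)) + w i * (\<Sum>n. rcoeff \<omega> n * poly (Q n) (z $ i))"
      using F(2) sums_unique2 by blast
    then show "Xd \<omega> $ i = deriv (gaf a \<zeta> \<omega>) (z $ i)"
      using rest[OF sm, of i] by (simp add: Xd_def matrix_vector_mult_def *)
  qed
  let ?T = "\<lambda>(v :: (complex, 'k) vec, u :: (complex, 'k) vec). \<chi> i. case i of Inl j \<Rightarrow> v $ j | Inr j \<Rightarrow> u $ j"
  \<comment> \<open>Transport of the density from pairs of vectors to vectors indexed by \<open>'k + 'k\<close>.\<close>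
  define p' where "p' u = p (\<chi> j. u $ Inl j, \<chi> j. u $ Inr j)" for u
  have p'T: "p' (?T x) = p x" for x by (cases x) (simp add: p'_def)
  have p'c: "continuous_on UNIV p'" unfolding p'_def
    by (intro continuous_on_compose2[OF p(1)] continuous_intros) auto
  have [measurable]: "p' \<in> borel_measurable borel" by (intro borel_measurable_continuous_onI p'c)
  have Tm [measurable]: "?T \<in> borel_measurable borel"
  proof -
    have "(\<lambda>x :: (complex, 'k) vec \<times> (complex, 'k) vec. \<chi> i. case i of Inl j \<Rightarrow> fst x $ j | Inr j \<Rightarrow> snd x $ j) \<in> borel_measurable (borel \<Otimes>\<^sub>M borel)"
    proof (rule borel_measurable_vec_lambda)
      show "(\<lambda>x :: (complex, 'k) vec \<times> (complex, 'k) vec. case i of Inl j \<Rightarrow> fst x $ j | Inr j \<Rightarrow> snd x $ j) \<in> borel_measurable (borel \<Otimes>\<^sub>M borel)" for i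
        by (cases i) auto
    qed
    then show ?thesis by (simp add: borel_prod case_prod_beta)
  qed
  have Xm [measurable]: "gaf_vector a \<zeta> z \<in> borel_measurable M"
    using r(2) by (intro gaf_vector_measurable in_gaf_domain[OF ar]) (metis less_add_one order_less_le_trans)
  have [measurable]: "Xv \<in> borel_measurable M" "Xd \<in> borel_measurable M"
    using borel_measurable_continuous_onI[OF contmul, of V1] borel_measurable_continuous_onI[OF contmul, of V2]
      borel_measurable_continuous_onI[OF contmul, of B] borel_measurable_continuous_onI[OF contmul, of H]
    unfolding Xd_def Xv_def by measurable
  have TX: "(\<lambda>\<omega>. ?T (Xv \<omega>, Xd \<omega>)) \<in> borel_measurable M"
    by (rule measurable_compose[OF _ Tm]) measurable
  have "distr M borel (gaf_vector a \<zeta> z) = distr M borel (\<lambda>\<omega>. ?T (Xv \<omega>, Xd \<omega>))"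
  proof (rule distr_cong_AE)
    show "AE \<omega> in M. gaf_vector a \<zeta> z \<omega> = ?T (Xv \<omega>, Xd \<omega>)"
      using good by eventually_elim (auto simp: gaf_vector_def vec_eq_iff XvF XdF split: sum.splits)
  qed (use TX in auto)
  also have "\<dots> = distr (distr M borel (\<lambda>\<omega>. (Xv \<omega>, Xd \<omega>))) borel ?T"
    by (subst distr_distr) (auto simp: comp_def)
  also have "\<dots> = distr (density (lborel \<Otimes>\<^sub>M lborel) (\<lambda>x. ennreal (p' (?T x)))) borel ?T"
    unfolding p(3) p'T lborel_prod ..
  also have "\<dots> = density (distr (lborel \<Otimes>\<^sub>M lborel) borel ?T) (\<lambda>u. ennreal (p' u))"
    by (rule density_distr[symmetric]) (auto simp: lborel_prod)
  also have "\<dots> = density lborel (\<lambda>u. ennreal (p' u))" unfolding lborel_vec_sum ..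
  finally have dens: "distr M borel (gaf_vector a \<zeta> z) = density lborel (\<lambda>u. ennreal (p' u))" .
  have p'0: "0 \<le> p' u" for u unfolding p'_def by (rule p(2))
  have cd: "continuous_density M (gaf_vector a \<zeta> z) p'"
    unfolding continuous_density_def distributed_def
    using p'c p'0 dens by (auto cong: distr_cong)
  have "(\<integral>\<^sup>+\<eta>. ennreal ((cmod (\<Prod>j\<in>UNIV. \<eta> $ j))\<^sup>2 * p' (\<chi> i. case i of Inl _ \<Rightarrow> 0 | Inr j \<Rightarrow> \<eta> $ j)) \<partial>lborel)
     = (\<integral>\<^sup>+\<eta>. ennreal ((cmod (\<Prod>j\<in>UNIV. \<eta> $ j))\<^sup>2) * ennreal (p (0, \<eta>)) \<partial>lborel)"
    using p(2) by (intro nn_integral_cong) (simp add: p'_def ennreal_mult zero_vec_def)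
  also have "\<dots> \<le> ennreal (J1 * (1 / pi) ^ ?k) * (\<integral>\<^sup>+\<omega>. ennreal ((cmod (\<Prod>j\<in>UNIV. (H *v C2 \<omega> + snd (R \<omega>)) $ j))\<^sup>2) \<partial>M)"
    by (rule p(4)) measurable
  also have "(\<integral>\<^sup>+\<omega>. ennreal ((cmod (\<Prod>j\<in>UNIV. (H *v C2 \<omega> + snd (R \<omega>)) $ j))\<^sup>2) \<partial>M)
      \<le> (\<integral>\<^sup>+\<omega>. ennreal (\<Delta>\<^sup>2) * ennreal (W \<omega> ^ (2 * ?k)) \<partial>M)"
  proof (rule nn_integral_mono_AE)
    show "AE \<omega> in M. ennreal ((cmod (\<Prod>j\<in>UNIV. (H *v C2 \<omega> + snd (R \<omega>)) $ j))\<^sup>2) \<le> ennreal (\<Delta>\<^sup>2) * ennreal (W \<omega> ^ (2 * ?k))"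
      using good
    proof eventually_elim
      case (elim \<omega>)
      have "(cmod (\<Prod>j\<in>UNIV. (H *v C2 \<omega> + snd (R \<omega>)) $ j))\<^sup>2 = (\<Prod>j\<in>UNIV. (cmod ((H *v C2 \<omega> + snd (R \<omega>)) $ j))\<^sup>2)"
        by (simp add: prod_norm[symmetric] prod_power_distrib)
      also have "\<dots> \<le> (\<Prod>j\<in>UNIV. (cmod (w j) * W \<omega>)\<^sup>2)"
        using restb elim by (intro prod_mono) (auto intro!: power_mono)
      also have "\<dots> = (\<Prod>j\<in>UNIV. (cmod (w j))\<^sup>2) * W \<omega> ^ (2 * ?k)"
        by (simp add: power_mult_distrib prod.distrib power_mult)
      also have "(\<Prod>j\<in>UNIV. (cmod (w j))\<^sup>2) = \<Delta>\<^sup>2"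
        unfolding w_def \<Delta>_def by (rule prod_pairwise_differences)
      finally show ?case by (simp add: ennreal_mult[symmetric])
    qed
  qed
  also have "(\<integral>\<^sup>+\<omega>. ennreal (\<Delta>\<^sup>2) * ennreal (W \<omega> ^ (2 * ?k)) \<partial>M) = ennreal (\<Delta>\<^sup>2) * (\<integral>\<^sup>+\<omega>. ennreal (W \<omega> ^ (2 * ?k)) \<partial>M)"
    unfolding W_def by (rule nn_integral_cmult) measurable
  also have "ennreal (J1 * (1 / pi) ^ ?k) * (ennreal (\<Delta>\<^sup>2) * (\<integral>\<^sup>+\<omega>. ennreal (W \<omega> ^ (2 * ?k)) \<partial>M))
     = ennreal (J1 * (1 / pi) ^ ?k * \<Delta>\<^sup>2) * (\<integral>\<^sup>+\<omega>. ennreal (W \<omega> ^ (2 * ?k)) \<partial>M)"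
    using scales_lborelD(2)[OF V1] by (subst ennreal_mult) (auto simp: mult.assoc)
  also have "J1 * (1 / pi) ^ ?k * \<Delta>\<^sup>2 = \<Delta> / (pi ^ ?k * (\<Prod>n<?k. (a n)\<^sup>2))"
    unfolding J1_def using \<Delta>0 prod_index_rank[where 'k='k, of "\<lambda>n. (a n)\<^sup>2"]
    by (simp add: prod_dividef power2_eq_square field_simps)
  finally show thesis by (intro that[OF cd]) (auto simp: mult_left_mono)
qed

end

section \<open>The intensity bound\<close>

text \<open>All constants, including \<open>k!\<close>, are absorbed by half of the available power: the hypothesis on \<open>S\<close> comes from the
coefficient with index \<open>2k - 1\<close> and gives \<open>(S/m)\<^sup>2\<^sup>k \<ge> 16\<^bsup>k(2k-1)\<^esup>\<close>.\<close>

lemma numeric_constant_bound: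
  fixes S m \<tau> P :: real
  assumes k: "1 \<le> k" and m: "0 < m" and \<tau>: "2 \<le> \<tau>" and S: "m * (2 * \<tau>) ^ (2 * k - 1) \<le> S"
    and P: "m ^ (2 * k) \<le> P"
  shows "1 / (pi ^ k * P) * ((3 * S) ^ (2 * k) * (2 * 2 ^ k * fact k)) \<le> (S / m) ^ (4 * k)"
proof -
  have q: "4 ^ (2 * k - 1) \<le> S / m"
  proof -
    have "(4::real) ^ (2 * k - 1) \<le> (2 * \<tau>) ^ (2 * k - 1)" using \<tau> by (intro power_mono) auto
    also have "\<dots> \<le> S / m" using S m by (simp add: field_simps)
    finally show ?thesis .
  qed
  then have q0: "0 \<le> S / m" by (rule order_trans[rotated]) simp
  then have S0: "0 \<le> S" using m by (simp add: zero_le_divide_iff)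
  have k16: "12 * real k \<le> 16 ^ (2 * k - 1)"
  proof -
    have "12 * real n \<le> 16 ^ n" for n
    proof (induction n)
      case (Suc n)
      have "12 * real n + 12 \<le> 16 ^ n + 12 * 16 ^ n" by (intro add_mono Suc.IH) simp
      then show ?case by simp
    qed simp
    then have "12 * real k \<le> 16 ^ k" .
    also have "\<dots> \<le> 16 ^ (2 * k - 1)" using k by (intro power_increasing) auto
    finally show ?thesis .
  qed
  have "2 * 6 ^ k * fact k \<le> (2::real) ^ k * 6 ^ k * real k ^ k"
    using k fact_le_power[of k] self_le_power[of "2::real" k] by (intro mult_mono) (auto simp: of_nat_power[symmetric] simp del: of_nat_power)
  also have "\<dots> = (2 * 6 * real k) ^ k" by (simp only: power_mult_distrib)
  also have "\<dots> = (12 * real k) ^ k" by simp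
  also have "\<dots> \<le> (16 ^ (2 * k - 1)) ^ k" using k16 by (intro power_mono) auto
  also have "\<dots> = (4 ^ (2 * k - 1)) ^ (2 * k)"
  proof -
    have "(16::real) ^ N = (4 ^ N)\<^sup>2" for N
      using power_mult_distrib[of "4::real" 4 N] by (simp add: power2_eq_square)
    then show ?thesis by (simp only: power_mult[of _ 2 k])
  qed
  also have "\<dots> \<le> (S / m) ^ (2 * k)" using q by (intro power_mono) auto
  finally have c: "2 * 6 ^ k * fact k \<le> (S / m) ^ (2 * k)" .
  have "1 / (pi ^ k * P) \<le> 1 / (3 ^ k * m ^ (2 * k))"
    using pi_gt3 m P by (intro divide_left_mono mult_mono power_mono) (auto intro!: mult_pos_pos less_le_trans[OF _ P])
  then have "1 / (pi ^ k * P) * ((3 * S) ^ (2 * k) * (2 * 2 ^ k * fact k))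
      \<le> 1 / (3 ^ k * m ^ (2 * k)) * ((3 * S) ^ (2 * k) * (2 * 2 ^ k * fact k))"
    using S0 by (intro mult_right_mono) auto
  also have "\<dots> = (S / m) ^ (2 * k) * (2 * 6 ^ k * fact k)"
  proof -
    have "(3::real) ^ (2 * k) = 3 ^ k * 3 ^ k" by (simp add: mult_2 power_add)
    moreover have "(6::real) ^ k = 3 ^ k * 2 ^ k"
      using power_mult_distrib[of "3::real" 2 k] by simp
    ultimately show ?thesis using m by (simp add: power_mult_distrib power_divide field_simps)
  qed
  also have "\<dots> \<le> (S / m) ^ (2 * k) * (S / m) ^ (2 * k)"
    using c q0 by (intro mult_left_mono) auto
  also have "\<dots> = (S / m) ^ (4 * k)" by (simp flip: power_add)
  finally show ?thesis .
qed

context gaussian_coefficients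
begin

text \<open>The radius is \<open>r = 3\<tau>/2\<close>: it exceeds every \<open>\<bar>z\<^sub>i\<bar>\<close> by at least \<open>\<tau>/2 \<ge> 1\<close>, and it is smaller than \<open>2\<tau>\<close> by the factor \<open>3/4\<close>, so
that \<open>a\<^sub>n r\<^sup>n \<le> S (3/4)\<^sup>n\<close>. As \<open>k \<ge> 1\<close>, the sum over \<open>n \<ge> k\<close> is at most \<open>3S\<close>.\<close>

lemma zero_intensity_le:
  fixes z :: "(complex, 'k::{finite,linorder}) vec"
  assumes \<rho>: "zero_intensity M a \<zeta> \<rho>" and \<tau>: "2 \<le> \<tau>" and z: "\<And>i. cmod (z $ i) < \<tau>"
    and a: "\<And>n. n < 2 * CARD('k) \<Longrightarrow> a n \<noteq> 0" and bdd: "bdd_above (range (\<lambda>n. a n * (2 * \<tau>) ^ n))"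
  shows "\<rho> z \<le> ennreal (((SUP n. a n * (2 * \<tau>) ^ n) / Min (a ` {..<2 * CARD('k)})) ^ (4 * CARD('k)) *
               (\<Prod>(i, j)\<in>{(i, j). i < j}. (cmod (z $ i - z $ j))\<^sup>2))"
proof -
  define k where "k = CARD('k)"
  define S where "S = (SUP n. a n * (2 * \<tau>) ^ n)"
  define m where "m = Min (a ` {..<2 * k})"
  define \<Delta> where "\<Delta> = (\<Prod>(i, j)\<in>{(i, j). i < j}. (cmod (z $ i - z $ j))\<^sup>2)"
  define r where "r = 3 / 2 * \<tau>"
  have k: "1 \<le> k" unfolding k_def by (simp add: Suc_le_eq)
  have S: "a n * (2 * \<tau>) ^ n \<le> S" for n unfolding S_def by (rule cSUP_upper[OF _ bdd]) simp
  have S0: "0 \<le> S" using S[of 0] coeff_nonneg[of 0] by simp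
  have ne: "a ` {..<2 * k} \<noteq> {}" using k by (auto simp: lessThan_empty_iff)
  have m_le: "m \<le> a n" if "n < 2 * k" for n unfolding m_def using that by (intro Min_le) auto
  have "m \<in> a ` {..<2 * k}" unfolding m_def using ne by (intro Min_in) auto
  then have m: "0 < m" using a coeff_nonneg by (force simp: k_def order_less_le)
  have ar_le: "a n * r ^ n \<le> S * (3 / 4) ^ n" for n
  proof -
    have "r ^ n = (2 * \<tau>) ^ n * (3 / 4) ^ n" unfolding power_mult_distrib[symmetric] by (simp add: r_def)
    then have "a n * r ^ n = (a n * (2 * \<tau>) ^ n) * (3 / 4) ^ n" by simp
    also have "\<dots> \<le> S * (3 / 4) ^ n" by (intro mult_right_mono S) auto
    finally show ?thesis .
  qed
  have r: "0 \<le> r" "cmod (z $ i) + 1 \<le> r" for i using \<tau> z[of i] by (auto simp: r_def)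
  have ar0: "0 \<le> a n * r ^ n" for n using coeff_nonneg r by simp
  have ar: "summable (\<lambda>n. a n * r ^ n)"
    by (rule summable_comparison_test'[of "\<lambda>n. S * (3 / 4) ^ n" 0]) (use ar_le ar0 in auto)
  have D: "z $ i \<in> gaf_domain a" for i using r(2)[of i] by (intro in_gaf_domain[OF ar]) simp
  show ?thesis
  proof (cases "inj (($) z)")
    case False
    then have "\<rho> z = 0" using \<rho> D unfolding zero_intensity_def Let_def by blast
    then show ?thesis by simp
  next
    case True
    let ?b = "\<lambda>n. if n < k then 0 else a n * r ^ n"
    obtain p where p: "continuous_density M (gaf_vector a \<zeta> z) p"
      "(\<integral>\<^sup>+\<eta>. ennreal ((cmod (\<Prod>j\<in>UNIV. \<eta> $ j))\<^sup>2 * p (\<chi> i. case i of Inl _ \<Rightarrow> 0 | Inr j \<Rightarrow> \<eta> $ j)) \<partial>lborel)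
       \<le> ennreal (\<Delta> / (pi ^ k * (\<Prod>n<k. (a n)\<^sup>2))) * (\<integral>\<^sup>+\<omega>. ennreal ((\<Sum>n. ?b n * cmod (\<zeta> n \<omega>)) ^ (2 * k)) \<partial>M)"
      using gaf_vector_density[OF True r ar a, folded k_def \<Delta>_def] by blast
    have Wb: "(\<integral>\<^sup>+\<omega>. ennreal ((\<Sum>n. ?b n * cmod (\<zeta> n \<omega>)) ^ (2 * k)) \<partial>M) \<le> ennreal ((3 * S) ^ (2 * k) * (2 * 2 ^ k * fact k))"
    proof -
      have b0: "0 \<le> ?b n" for n using ar0 by simp
      have bs: "summable ?b"
        by (rule summable_comparison_test'[OF ar, of 0]) (use ar0 in auto)
      have "(\<integral>\<^sup>+\<omega>. ennreal ((\<Sum>n. ?b n * cmod (\<zeta> n \<omega>)) ^ (2 * k)) \<partial>M) \<le> ennreal ((\<Sum>n. ?b n) ^ (2 * k) * (2 * 2 ^ k * fact k))"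
        using k by (intro weighted_series_moment(2) b0 bs std_complex_normal_moment[OF normal]) auto
      moreover have "(\<Sum>n. ?b n) \<le> 3 * S"
      proof -
        have "(\<Sum>n. ?b n) = (\<Sum>n. ?b (n + k)) + (\<Sum>n<k. ?b n)"
          by (rule suminf_split_initial_segment[OF bs])
        also have "\<dots> = (\<Sum>n. a (n + k) * r ^ (n + k))" by simp
        also have "\<dots> \<le> (\<Sum>n. S * (3 / 4) * (3 / 4) ^ n)"
        proof (rule suminf_le)
          fix n
          have "a (n + k) * r ^ (n + k) \<le> S * (3 / 4) ^ (n + k)" by (rule ar_le)
          also have "\<dots> \<le> S * (3 / 4) ^ (n + 1)"
            using k S0 by (intro mult_left_mono power_decreasing) auto
          finally show "a (n + k) * r ^ (n + k) \<le> S * (3 / 4) * (3 / 4) ^ n" by simp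
        next
          show "summable (\<lambda>n. a (n + k) * r ^ (n + k))" using ar by (rule summable_ignore_initial_segment)
        qed (intro summable_mult summable_geometric, simp)
        also have "\<dots> = S * (3 / 4) * (1 / (1 - 3 / 4))"
          by (subst suminf_mult) (auto simp: suminf_geometric)
        finally show ?thesis by simp
      qed
      then have "(\<Sum>n. ?b n) ^ (2 * k) * (2 * 2 ^ k * fact k) \<le> (3 * S) ^ (2 * k) * (2 * 2 ^ k * fact k)"
        using suminf_nonneg[OF bs b0] by (intro mult_right_mono power_mono) auto
      ultimately show ?thesis by (meson ennreal_leI order_trans)
    qed
    have "invertible (covariance_matrix M (gaf_vector a \<zeta> z))"
      using p(1) gaf_vector_square_integrable[OF ar r]
      unfolding continuous_density_def by (intro covariance_matrix_invertible) auto
    then have "\<rho> z = (\<integral>\<^sup>+\<eta>. ennreal ((cmod (\<Prod>j\<in>UNIV. \<eta> $ j))\<^sup>2 * p (\<chi> i. case i of Inl _ \<Rightarrow> 0 | Inr j \<Rightarrow> \<eta> $ j)) \<partial>lborel)"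
      using \<rho> D True p(1) unfolding zero_intensity_def Let_def by blast
    also have "\<dots> \<le> ennreal (\<Delta> / (pi ^ k * (\<Prod>n<k. (a n)\<^sup>2))) * ennreal ((3 * S) ^ (2 * k) * (2 * 2 ^ k * fact k))"
      by (rule order_trans[OF p(2) mult_left_mono[OF Wb]]) simp
    also have "ennreal (\<Delta> / (pi ^ k * (\<Prod>n<k. (a n)\<^sup>2))) * ennreal ((3 * S) ^ (2 * k) * (2 * 2 ^ k * fact k))
        = ennreal (1 / (pi ^ k * (\<Prod>n<k. (a n)\<^sup>2)) * ((3 * S) ^ (2 * k) * (2 * 2 ^ k * fact k)) * \<Delta>)"
      using S0 by (subst ennreal_mult[symmetric]) (auto simp: \<Delta>_def mult_ac intro!: prod_nonneg divide_nonneg_nonneg mult_nonneg_nonneg)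
    also have "\<dots> \<le> ennreal ((S / m) ^ (4 * k) * \<Delta>)"
    proof (intro ennreal_leI mult_right_mono numeric_constant_bound[OF k m \<tau>])
      have "m * (2 * \<tau>) ^ (2 * k - 1) \<le> a (2 * k - 1) * (2 * \<tau>) ^ (2 * k - 1)"
        using k \<tau> by (intro mult_right_mono m_le) auto
      also have "\<dots> \<le> S" by (rule S)
      finally show "m * (2 * \<tau>) ^ (2 * k - 1) \<le> S" .
      have "(\<Prod>n<k. m\<^sup>2) \<le> (\<Prod>n<k. (a n)\<^sup>2)"
        using m m_le by (intro prod_mono) (auto intro!: power_mono)
      then show "m ^ (2 * k) \<le> (\<Prod>n<k. (a n)\<^sup>2)" by (simp add: power_mult)
      show "0 \<le> \<Delta>" unfolding \<Delta>_def by (intro prod_nonneg) auto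
    qed
    finally show ?thesis unfolding S_def m_def \<Delta>_def k_def .
  qed
qed

end

text \<open>Since \<open>(a\<^sub>n (2\<tau>)\<^sup>n)\<^sup>2 = (4\<tau>\<^sup>2L)\<^sup>n/n!\<close> is a term of the series of \<open>exp (4\<tau>\<^sup>2L)\<close>, the supremum is at most \<open>exp (2\<tau>\<^sup>2L)\<close>. The
minimum is attained at some \<open>n < 2k\<close>, where \<open>n! \<le> (2k)\<^sup>2\<^sup>k\<close>.\<close>

lemma entire_gaf_ratio_bound:
  fixes L \<tau> :: real
  assumes L: "0 < L" and \<tau>: "0 \<le> \<tau>" and k: "1 \<le> k"
    and a: "\<And>n. a n = L powr (real n / 2) / sqrt (fact n)"
  shows "bdd_above (range (\<lambda>n. a n * (2 * \<tau>) ^ n))" and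
    "((SUP n. a n * (2 * \<tau>) ^ n) / Min (a ` {..<2 * k})) ^ (4 * k)
      \<le> real (2 * k) ^ (4 * k\<^sup>2) * exp (8 * \<tau>\<^sup>2 * L * real k) * max 1 (L powr (- real (4 * k\<^sup>2)))"
proof -
  have apos: "0 < a n" for n using L by (simp add: a)
  have asq: "(a n)\<^sup>2 = L ^ n / fact n" for n
    using L by (simp add: a power_divide powr_power powr_realpow)
  have bound: "a n * (2 * \<tau>) ^ n \<le> exp (2 * \<tau>\<^sup>2 * L)" for n
  proof (rule power2_le_imp_le)
    have "(a n * (2 * \<tau>) ^ n)\<^sup>2 = (4 * \<tau>\<^sup>2 * L) ^ n / fact n"
      by (simp add: power_mult_distrib asq power_mult[symmetric] mult.commute[of n] power_even_eq[symmetric]) (simp add: power_mult power_mult_distrib)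
    also have "\<dots> \<le> exp (4 * \<tau>\<^sup>2 * L)"
      using L by (intro power_div_fact_le_exp) auto
    also have "\<dots> = (exp (2 * \<tau>\<^sup>2 * L))\<^sup>2" by (simp add: exp_double[symmetric])
    finally show "(a n * (2 * \<tau>) ^ n)\<^sup>2 \<le> (exp (2 * \<tau>\<^sup>2 * L))\<^sup>2" .
  qed simp
  then show bdd: "bdd_above (range (\<lambda>n. a n * (2 * \<tau>) ^ n))" by (intro bdd_aboveI2)
  let ?S = "SUP n. a n * (2 * \<tau>) ^ n" and ?m = "Min (a ` {..<2 * k})"
  have S: "?S \<le> exp (2 * \<tau>\<^sup>2 * L)" using bound by (intro cSUP_least) auto
  have S0: "0 \<le> ?S" using order_trans[OF less_imp_le[OF apos[of 0]], of "?S"] cSUP_upper[OF _ bdd, of 0] by simp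
  have "?m \<in> a ` {..<2 * k}" using k by (intro Min_in) (auto simp: lessThan_empty_iff)
  then obtain n where n: "n < 2 * k" "?m = a n" by auto
  have "(?S / ?m) ^ (4 * k) \<le> exp (2 * \<tau>\<^sup>2 * L) ^ (4 * k) * ((1 / (a n)\<^sup>2) ^ (2 * k))"
  proof -
    have "(?S / a n) ^ (4 * k) = ?S ^ (4 * k) * ((1 / (a n)\<^sup>2) ^ (2 * k))"
      by (simp add: power_divide power_mult[symmetric])
    also have "\<dots> \<le> exp (2 * \<tau>\<^sup>2 * L) ^ (4 * k) * ((1 / (a n)\<^sup>2) ^ (2 * k))"
      using S S0 by (intro mult_right_mono power_mono) auto
    finally show ?thesis unfolding n(2) .
  qed
  also have "exp (2 * \<tau>\<^sup>2 * L) ^ (4 * k) = exp (8 * \<tau>\<^sup>2 * L * real k)"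
    by (simp add: exp_of_nat_mult[symmetric] mult_ac)
  also have "(1 / (a n)\<^sup>2) ^ (2 * k) = fact n ^ (2 * k) * (1 / L ^ n) ^ (2 * k)"
    by (simp add: asq power_divide)
  also have "exp (8 * \<tau>\<^sup>2 * L * real k) * (fact n ^ (2 * k) * (1 / L ^ n) ^ (2 * k))
      \<le> exp (8 * \<tau>\<^sup>2 * L * real k) * (real (2 * k) ^ (4 * k\<^sup>2) * max 1 (L powr (- real (4 * k\<^sup>2))))"
  proof (intro mult_left_mono mult_mono)
    have "fact n \<le> (real (2 * k)) ^ (2 * k)"
    proof -
      have "(fact n :: real) \<le> real n ^ n" using fact_le_power[of n] by simp
      also have "\<dots> \<le> real (2 * k) ^ n" using n by (intro power_mono) auto
      also have "\<dots> \<le> real (2 * k) ^ (2 * k)" using n k by (intro power_increasing) auto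
      finally show ?thesis .
    qed
    then have "fact n ^ (2 * k) \<le> ((real (2 * k)) ^ (2 * k)) ^ (2 * k)" by (intro power_mono) auto
    also have "\<dots> = real (2 * k) ^ (4 * k\<^sup>2)"
    proof -
      have "2 * k * (2 * k) = 4 * k\<^sup>2" by (simp add: power2_eq_square)
      then show ?thesis by (simp only: power_mult[symmetric])
    qed
    finally show "fact n ^ (2 * k) \<le> real (2 * k) ^ (4 * k\<^sup>2)" .
    have eq: "(1 / L ^ n) ^ (2 * k) = L powr (- real (n * (2 * k)))"
      using L by (simp add: power_divide powr_minus powr_realpow inverse_eq_divide flip: power_mult of_nat_mult)
    show "(1 / L ^ n) ^ (2 * k) \<le> max 1 (L powr (- real (4 * k\<^sup>2)))"
    proof (cases "1 \<le> L")
      case True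
      then have "L powr (- real (n * (2 * k))) \<le> L powr 0" by (intro powr_mono) auto
      then show ?thesis using eq L by simp
    next
      case False
      have "n * (2 * k) \<le> 4 * k\<^sup>2" using n mult_right_mono[of n "2 * k" "2 * k"] by (simp add: power2_eq_square)
      then have "real (n * (2 * k)) \<le> real (4 * k\<^sup>2)" by (simp only: of_nat_le_iff)
      then have "L powr (- real (n * (2 * k))) \<le> L powr (- real (4 * k\<^sup>2))"
        using L False by (intro powr_mono') auto
      then show ?thesis using eq by simp
    qed
  qed (use L in auto)
  finally show "(?S / ?m) ^ (4 * k) \<le> real (2 * k) ^ (4 * k\<^sup>2) * exp (8 * \<tau>\<^sup>2 * L * real k) * max 1 (L powr (- real (4 * k\<^sup>2)))"
    by (simp add: mult_ac)
qed

theorem lemma5p2: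
  fixes M :: "'w measure" and a :: "nat \<Rightarrow> real" and \<zeta> :: "nat \<Rightarrow> 'w \<Rightarrow> complex"
    and \<rho> :: "(complex, 'k::{finite,linorder}) vec \<Rightarrow> ennreal"
    and \<tau> :: real and z :: "(complex, 'k) vec"
  assumes "gaussian_coefficients M a \<zeta>"
    and "zero_intensity M a \<zeta> \<rho>"
    and "2 \<le> \<tau>"
    and "\<forall>i. z $ i \<in> ball 0 \<tau>"
  shows "((\<forall>n<2 * CARD('k). a n \<noteq> 0) \<and> bdd_above (range (\<lambda>n. a n * (2 * \<tau>) ^ n)) \<longrightarrow>
            \<rho> z \<le> ennreal
              (((SUP n. a n * (2 * \<tau>) ^ n) / Min (a ` {..<2 * CARD('k)})) ^ (4 * CARD('k)) *
               (\<Prod>(i, j)\<in>{(i, j). i < j}. (cmod (z $ i - z $ j))\<^sup>2))) \<and>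
         (\<forall>L>0. (\<forall>n. a n = L powr (real n / 2) / sqrt (fact n)) \<longrightarrow>
            \<rho> z \<le> ennreal
              (real (2 * CARD('k)) ^ (4 * CARD('k)\<^sup>2) * exp (8 * \<tau>\<^sup>2 * L * real CARD('k)) *
               max 1 (L powr (- real (4 * CARD('k)\<^sup>2))) *
               (\<Prod>(i, j)\<in>{(i, j). i < j}. (cmod (z $ i - z $ j))\<^sup>2)))"
proof (intro conjI impI allI)
  interpret gaussian_coefficients M a \<zeta> by fact
  have z: "cmod (z $ i) < \<tau>" for i using assms(4) by simp
  note bound = zero_intensity_le[OF assms(2,3) z]
  {
    assume "(\<forall>n<2 * CARD('k). a n \<noteq> 0) \<and> bdd_above (range (\<lambda>n. a n * (2 * \<tau>) ^ n))"
    then show "\<rho> z \<le> ennreal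
              (((SUP n. a n * (2 * \<tau>) ^ n) / Min (a ` {..<2 * CARD('k)})) ^ (4 * CARD('k)) *
               (\<Prod>(i, j)\<in>{(i, j). i < j}. (cmod (z $ i - z $ j))\<^sup>2))"
      by (intro bound) auto
  next
    fix L :: real assume L: "0 < L" and a: "\<forall>n. a n = L powr (real n / 2) / sqrt (fact n)"
    have k: "1 \<le> CARD('k)" by (simp add: Suc_le_eq)
    note ratio = entire_gaf_ratio_bound[OF L _ k, of \<tau> a, OF _ a[rule_format]]
    have "\<rho> z \<le> ennreal
              (((SUP n. a n * (2 * \<tau>) ^ n) / Min (a ` {..<2 * CARD('k)})) ^ (4 * CARD('k)) *
               (\<Prod>(i, j)\<in>{(i, j). i < j}. (cmod (z $ i - z $ j))\<^sup>2))"
    proof (rule bound)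
      show "a n \<noteq> 0" for n using L by (simp add: a)
      show "bdd_above (range (\<lambda>n. a n * (2 * \<tau>) ^ n))" using ratio(1) assms(3) by auto
    qed
    also have "\<dots> \<le> ennreal
              (real (2 * CARD('k)) ^ (4 * CARD('k)\<^sup>2) * exp (8 * \<tau>\<^sup>2 * L * real CARD('k)) *
               max 1 (L powr (- real (4 * CARD('k)\<^sup>2))) *
               (\<Prod>(i, j)\<in>{(i, j). i < j}. (cmod (z $ i - z $ j))\<^sup>2))"
      using assms(3) by (intro ennreal_leI mult_right_mono ratio(2) prod_nonneg) auto
    finally show "\<rho> z \<le> ennreal
              (real (2 * CARD('k)) ^ (4 * CARD('k)\<^sup>2) * exp (8 * \<tau>\<^sup>2 * L * real CARD('k)) *
               max 1 (L powr (- real (4 * CARD('k)\<^sup>2))) *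
               (\<Prod>(i, j)\<in>{(i, j). i < j}. (cmod (z $ i - z $ j))\<^sup>2))" .
  }
qed

end
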